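(* Let $X$ be any set, and let $\Lambda=\Lambda(X)$, $\mathcal S$, $\mathfrak T$ and $R$ be the set of generators, the admissible set, the admissible topology on $\mathrm{BF}(\Lambda;\mathcal S)$ and the set of relations defined in the context. Then $(\Lambda,\mathcal S,\mathfrak T,R)$ is a generalized presentation of the symmetric group $\Sigma(X)$. In particular, if $X$ is infinite, then $\Sigma(X)$ admits a generalized presentation of type $|X|$.
   Context: **Big free groups.** For a set $\Lambda$ with a fixed-point-free involution $\lambda\mapsto\lambda^{-1}$, let $\mathcal T(\Lambda)$ be the set of all maps $f:S\to\Lambda$ with $S$ totally ordered and $f^{-1}(\lambda)$ finite for every $\lambda\in\Lambda$; $f:S\to\Lambda$ and $f':S'\to\Lambda$ are identified if $f=f'\circ\varphi$ for an order-preserving bijection $\varphi:S\to S'$. Write $f\searrow g$ ("$g$ is obtained from $f:S\to\Lambda$ by cancellation") if there are $T\subseteq S$ with $g=f|_{S\setminus T}$ and an involution $*$ on $T$ such that for all $t\in T$: $f(t^* )=f(t)^{-1}$, $[t,t^*]\subseteq T$, and $([t,t^*])^*=[t,t^*]$, where $[s,s']=\{x\in S\mid s\le x\le s'\}$. Let $\approx$ be the equivalence relation generated by $\searrow$; $\mathrm{BF}(\Lambda)=\mathcal T(\Lambda)/\!\approx$ is a group under concatenation, with class of $f$ denoted $[f]$. For $f:S\to\Lambda$ let $\bar f:\bar S\to\Lambda$, $\bar f(s)=f(s)^{-1}$, where $\bar S$ is $S$ with reversed order. A subset $\mathcal S\subseteq\mathcal T(\Lambda)$ is admissible if it is closed under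 concatenation, under $f\mapsto\bar f$, and under $f\searrow g$; then $\mathrm{BF}(\Lambda;\mathcal S)=\mathcal S/\!\approx$ is a subgroup of $\mathrm{BF}(\Lambda)$. $\Lambda$ is regarded as a subset of $\mathrm{BF}(\Lambda)$ via one-letter maps, and $\mathcal F(\Lambda)$ is the subgroup generated by $\Lambda$ (a free group). **Topologies.** For $A=A^{-1}\subseteq\Lambda$, restriction of $f$ to $f^{-1}(A)$ induces a homomorphism $\varphi_A:\mathrm{BF}(\Lambda)\to\mathrm{BF}(A)$. The natural topology on $\mathrm{BF}(\Lambda)$ and its subgroups has the subgroups $\ker\varphi_A$, $A$ finite, (intersected with the subgroup) as a basis of neighborhoods of $1$. If $\Lambda\subseteq\mathcal S$, a topology on $\mathrm{BF}(\Lambda;\mathcal S)$ is admissible if it makes it a topological group, is finer than (or equal to) the natural topology, and $\mathcal F(\Lambda)$ is dense. **Generalized presentations.** A generalized presentation of a group $G$ is a tuple $(\Lambda,\mathcal S,\mathfrak T,R)$ where $\Lambda$ is a set with a free involution, $\mathcal S\subseteq\mathcal T(\Lambda)$ is admissible with $\Lambda\subseteq\mathcal S$, $\mathfrak T$ is an admissible topology on $\mathrm{BF}(\Lambda;\mathcal S)$, $R\subseteq\mathrm{BF}(\Lambda;\mathcal S)$, and there is an epimorphism $p:\mathrm{BF}(\Lambda;\mathcal S)\to G$ such that $\ker p$ is the smallest $\mathfrak T$-closed normal subgroup containing $R$. It is of type $c$ ($c$ a cardinal) if $|\Lambda|\le c$ and $|R|\le c$. **The data for $\Sigma(X)$.**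 $\Sigma(X)$ is the group of all bijections of $X$. Let $\Lambda=\Lambda(X)=\{T_{x,y}\mid x,y\in X,\ x\ne y\}$ (formal symbols) with involution $T_{x,y}^{-1}=T_{y,x}$. For $f:S\to\Lambda$ write $f(s)=T_{f_1(s),f_2(s)}$ and $U(z,f)=\{s\in S\mid z\in\{f_1(s),f_2(s)\}\}$. Let $\mathcal S_0=\{f\mid |U(x,f)|<\infty\ \forall x\in X\}$. For $f\in\mathcal S_0$ and $x\in X$ define sequences as follows: $x_0^+=x$; if $U(x,f)=\emptyset$ put $n^+(x)=0$; otherwise $s_1^+(x)=\min U(x,f)$. Given $x_{n-1}^+$ and $s_n^+(x)$, define $x_n^+$ by $\{x_{n-1}^+,x_n^+\}=\{f_1(s_n^+(x)),f_2(s_n^+(x))\}$, and let $s_{n+1}^+(x)$ be the smallest element of $U(x_n^+,f)$ bigger than $s_n^+(x)$, if it exists; if not, put $n^+(x)=n$. If this never stops, $n^+(x)=\infty$. Define $x_n^-$, $s_n^-(x)$, $n^-(x)$ symmetrically (with max instead of min, moving downwards in $S$). Let $\mathcal S=\{f\in\mathcal S_0\mid n^+(x)<\infty,\ n^-(x)<\infty\ \forall x\in X\}$. For $f\in\mathcal S$ let $x_\infty(f)$ be the last element of the finite sequence $x_0^+,x_1^+,\dots$; it depends only on $[f]$ and $x$. For finite $C\subseteq X$ let $\psi_C$ be the restriction of $\varphi_{\Lambda(C)}$ to $\mathrm{BF}(\Lambda;\mathcal S)$, $V_C=\{[\gamma]\in\mathrm{BF}(\Lambda;\mathcal S)\mid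 x_\infty(\gamma)=x\ \forall x\in C\}$. The topology $\mathfrak T$ on $\mathrm{BF}(\Lambda;\mathcal S)$ has the subgroups $W_C=\ker\psi_C\cap V_C$ ($C\subseteq X$ finite) as a basis of neighborhoods of $1$. $R$ consists of the elements $T_{x,y}^2$ ($x\neq y$); $[T_{x,y},T_{z,w}]$ for $|\{x,y,z,w\}|=4$; and $T_{x,y}T_{x,z}T_{x,y}^{-1}T_{y,z}^{-1}$ for $|\{x,y,z\}|=3$. *)

theory Defs
  imports
    "HOL-Analysis.Analysis"
    "HOL-Algebra.Bij"
    "HOL-Algebra.Generated_Groups"
    "HOL-Library.Extended_Nat"
begin

section \<open>Words indexed by totally ordered sets\<close>

record ('s, 'l) lword =
  pos :: "'s set"
  ord_rel :: "('s \<times> 's) set"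
  letter :: "'s \<Rightarrow> 'l"

text \<open>The values of \<^const>\<open>letter\<close> outside \<^const>\<open>pos\<close> are irrelevant; all notions below respect
  \<open>word_iso\<close>, which ignores them.\<close>

definition words :: "'l set \<Rightarrow> ('s, 'l) lword set" where
  "words \<Lambda> = {f. linear_order_on (pos f) (ord_rel f) \<and> letter f ` pos f \<subseteq> \<Lambda> \<and>
                 (\<forall>l\<in>\<Lambda>. finite {s \<in> pos f. letter f s = l})}"

definition word_iso :: "('s, 'l) lword \<Rightarrow> ('t, 'l) lword \<Rightarrow> bool" where
  "word_iso f g \<longleftrightarrow>
     (\<exists>\<phi>. bij_betw \<phi> (pos f) (pos g) \<and>
          (\<forall>s\<in>pos f. \<forall>t\<in>pos f. (s, t) \<in> ord_rel f \<longleftrightarrow> (\<phi> s, \<phi> t) \<in> ord_rel g) \<and>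
          (\<forall>s\<in>pos f. letter f s = letter g (\<phi> s)))"

text \<open>A word has only finitely many positions for each letter, so up to isomorphism all words over
  letters of type \<open>'l\<close>, whatever their position type, have positions in \<open>'l \<times> nat\<close>.\<close>

type_synonym 'l bword = "('l \<times> nat, 'l) lword"

lemma words_universe:
  fixes f :: "('s, 'l) lword"
  assumes f: "f \<in> words \<Lambda>"
  shows "\<exists>g :: 'l bword. g \<in> words \<Lambda> \<and> word_iso f g"
proof -
  have "\<forall>l\<in>\<Lambda>. \<exists>e :: 's \<Rightarrow> nat. inj_on e {s \<in> pos f. letter f s = l}"
  proof
    fix l assume "l \<in> \<Lambda>"
    then have "finite {s \<in> pos f. letter f s = l}"
      using f unfolding words_def by simp
    from finite_imp_inj_to_nat_seg[OF this]
    show "\<exists>e :: 's \<Rightarrow> nat. inj_on e {s \<in> pos f. letter f s = l}" by metis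
  qed
  then obtain e :: "'l \<Rightarrow> 's \<Rightarrow> nat"
    where e: "\<And>l. l \<in> \<Lambda> \<Longrightarrow> inj_on (e l) {s \<in> pos f. letter f s = l}"
    by metis
  define \<phi> where "\<phi> s = (letter f s, e (letter f s) s)" for s
  define g :: "'l bword" where
    "g = \<lparr>pos = \<phi> ` pos f, ord_rel = map_prod \<phi> \<phi> ` ord_rel f, letter = fst\<rparr>"
  have lin: "linear_order_on (pos f) (ord_rel f)" and let_in: "letter f ` pos f \<subseteq> \<Lambda>"
    and fin: "\<And>l. l \<in> \<Lambda> \<Longrightarrow> finite {s \<in> pos f. letter f s = l}"
    using f by (auto simp: words_def)
  have sub: "ord_rel f \<subseteq> pos f \<times> pos f"
    using lin by (simp add: order_on_defs)
  have inj: "inj_on \<phi> (pos f)"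
    using e let_in unfolding \<phi>_def inj_on_def by auto
  have ord: "(\<phi> s, \<phi> t) \<in> map_prod \<phi> \<phi> ` ord_rel f \<longleftrightarrow> (s, t) \<in> ord_rel f"
    if "s \<in> pos f" "t \<in> pos f" for s t
  proof
    assume "(\<phi> s, \<phi> t) \<in> map_prod \<phi> \<phi> ` ord_rel f"
    then obtain a b where ab: "(a, b) \<in> ord_rel f" "\<phi> s = \<phi> a" "\<phi> t = \<phi> b" by auto
    then have "s = a" "t = b" using inj_onD[OF inj] sub that by blast+
    then show "(s, t) \<in> ord_rel f" using ab by simp
  qed force
  have "linear_order_on (\<phi> ` pos f) (map_prod \<phi> \<phi> ` ord_rel f)"
    unfolding order_on_defs
  proof (intro conjI)
    show "map_prod \<phi> \<phi> ` ord_rel f \<subseteq> \<phi> ` pos f \<times> \<phi> ` pos f"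
      using sub by auto
    show "refl_on (\<phi> ` pos f) (map_prod \<phi> \<phi> ` ord_rel f)"
      using lin ord by (auto simp: order_on_defs refl_on_def)
    have tr: "trans (ord_rel f)" and an: "antisym (ord_rel f)" and tot: "total_on (pos f) (ord_rel f)"
      using lin by (auto simp: order_on_defs)
    show "trans (map_prod \<phi> \<phi> ` ord_rel f)"
    proof (rule transI)
      fix x y z
      assume "(x, y) \<in> map_prod \<phi> \<phi> ` ord_rel f" "(y, z) \<in> map_prod \<phi> \<phi> ` ord_rel f"
      then obtain a b c d where abcd: "(a, b) \<in> ord_rel f" "(c, d) \<in> ord_rel f" "x = \<phi> a" "y = \<phi> b"
        "y = \<phi> c" "z = \<phi> d"
        by auto
      then have "b = c" using inj sub by (auto simp: inj_on_def)
      then have "(a, d) \<in> ord_rel f" using abcd tr by (meson transD)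
      then show "(x, z) \<in> map_prod \<phi> \<phi> ` ord_rel f"
        using abcd by force
    qed
    show "antisym (map_prod \<phi> \<phi> ` ord_rel f)"
    proof (rule antisymI)
      fix x y
      assume a: "(x, y) \<in> map_prod \<phi> \<phi> ` ord_rel f" "(y, x) \<in> map_prod \<phi> \<phi> ` ord_rel f"
      then obtain a b where ab: "(a, b) \<in> ord_rel f" "x = \<phi> a" "y = \<phi> b" by auto
      then have "(b, a) \<in> ord_rel f" using ord[of b a] sub a(2) by auto
      then show "x = y" using ab an by (auto dest: antisymD)
    qed
    show "total_on (\<phi> ` pos f) (map_prod \<phi> \<phi> ` ord_rel f)"
      using tot ord by (fastforce simp: total_on_def)
  qed
  moreover have "finite {s \<in> \<phi> ` pos f. fst s = l}" if "l \<in> \<Lambda>" for l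
  proof -
    have "{s \<in> \<phi> ` pos f. fst s = l} = \<phi> ` {s \<in> pos f. letter f s = l}"
      by (auto simp: \<phi>_def)
    then show ?thesis using fin[OF that] by simp
  qed
  moreover have "fst ` \<phi> ` pos f \<subseteq> \<Lambda>"
    using let_in by (auto simp: \<phi>_def)
  ultimately have "g \<in> words \<Lambda>"
    by (auto simp: words_def g_def)
  moreover have "word_iso f g"
    unfolding word_iso_def
    by (rule exI[of _ \<phi>]) (use inj ord in \<open>auto simp: g_def bij_betw_def \<phi>_def\<close>)
  ultimately show ?thesis by blast
qed

definition word_restrict :: "('s, 'l) lword \<Rightarrow> 's set \<Rightarrow> ('s, 'l) lword" where
  "word_restrict f P = \<lparr>pos = pos f \<inter> P, ord_rel = Restr (ord_rel f) (pos f \<inter> P), letter = letter f\<rparr>"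

definition word_interval :: "('s, 'l) lword \<Rightarrow> 's \<Rightarrow> 's \<Rightarrow> 's set" where
  "word_interval f s t = {x \<in> pos f. (s, x) \<in> ord_rel f \<and> (x, t) \<in> ord_rel f}"

text \<open>Here \<open>i\<close> is the involution on the letters. Words are identified up to isomorphism, so the
  result of a cancellation is only required to be isomorphic to the restriction; taking
  \<open>T = {}\<close> shows that \<open>cancels\<close> contains \<^const>\<open>word_iso\<close>.\<close>

definition cancels :: "('l \<Rightarrow> 'l) \<Rightarrow> ('s, 'l) lword \<Rightarrow> ('t, 'l) lword \<Rightarrow> bool" where
  "cancels i f g \<longleftrightarrow>
     (\<exists>T star. T \<subseteq> pos f \<and>
        (\<forall>t\<in>T. star t \<in> T \<and> star (star t) = t \<and>
               letter f (star t) = i (letter f t) \<and>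
               word_interval f t (star t) \<subseteq> T \<and>
               star ` word_interval f t (star t) = word_interval f t (star t)) \<and>
        word_iso g (word_restrict f (pos f - T)))"

text \<open>Two disjoint copies of \<open>'l \<times> nat\<close> are placed inside \<open>'l \<times> nat\<close> via even and odd indices, the
  even copy preceding the odd one.\<close>

definition word_concat :: "'l bword \<Rightarrow> 'l bword \<Rightarrow> 'l bword" where
  "word_concat f g =
     (let L = (\<lambda>(l, n). (l, 2 * n)); R = (\<lambda>(l, n). (l, 2 * n + 1)) in
      \<lparr>pos = L ` pos f \<union> R ` pos g,
       ord_rel = map_prod L L ` ord_rel f \<union> map_prod R R ` ord_rel g \<union> (L ` pos f) \<times> (R ` pos g),
       letter = (\<lambda>(l, n). if even n then letter f (l, n div 2) else letter g (l, n div 2))\<rparr>)"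

definition word_inverse :: "('l \<Rightarrow> 'l) \<Rightarrow> ('s, 'l) lword \<Rightarrow> ('s, 'l) lword" where
  "word_inverse i f = \<lparr>pos = pos f, ord_rel = (ord_rel f)\<inverse>, letter = i \<circ> letter f\<rparr>"

definition word_empty :: "'l bword" where
  "word_empty = \<lparr>pos = {}, ord_rel = {}, letter = fst\<rparr>"

definition word_single :: "'l \<Rightarrow> 'l bword" where
  "word_single l = \<lparr>pos = {(l, 0)}, ord_rel = {((l, 0), (l, 0))}, letter = fst\<rparr>"


section \<open>Big free groups\<close>

definition free_involution_on :: "'l set \<Rightarrow> ('l \<Rightarrow> 'l) \<Rightarrow> bool" where
  "free_involution_on \<Lambda> i \<longleftrightarrow> (\<forall>l\<in>\<Lambda>. i l \<in> \<Lambda> \<and> i (i l) = l \<and> i l \<noteq> l)"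

definition cancel_rel :: "'l set \<Rightarrow> ('l \<Rightarrow> 'l) \<Rightarrow> ('l bword \<times> 'l bword) set" where
  "cancel_rel \<Lambda> i = {(f, g). f \<in> words \<Lambda> \<and> g \<in> words \<Lambda> \<and> cancels i f g}"

definition word_equiv :: "'l set \<Rightarrow> ('l \<Rightarrow> 'l) \<Rightarrow> ('l bword \<times> 'l bword) set" where
  "word_equiv \<Lambda> i = Restr ((cancel_rel \<Lambda> i \<union> (cancel_rel \<Lambda> i)\<inverse>)\<^sup>*) (words \<Lambda>)"

definition word_class :: "'l set \<Rightarrow> ('l \<Rightarrow> 'l) \<Rightarrow> 'l bword \<Rightarrow> 'l bword set" where
  "word_class \<Lambda> i f = word_equiv \<Lambda> i `` {f}"

definition BF :: "'l set \<Rightarrow> ('l \<Rightarrow> 'l) \<Rightarrow> 'l bword set monoid" where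
  "BF \<Lambda> i = \<lparr>carrier = words \<Lambda> // word_equiv \<Lambda> i,
             mult = (\<lambda>a b. \<Union>f\<in>a. \<Union>g\<in>b. word_class \<Lambda> i (word_concat f g)),
             one = word_class \<Lambda> i word_empty\<rparr>"

definition admissible_words :: "'l set \<Rightarrow> ('l \<Rightarrow> 'l) \<Rightarrow> 'l bword set \<Rightarrow> bool" where
  "admissible_words \<Lambda> i S \<longleftrightarrow>
     S \<subseteq> words \<Lambda> \<and>
     (\<forall>f\<in>S. \<forall>g\<in>S. word_concat f g \<in> S) \<and>
     (\<forall>f\<in>S. word_inverse i f \<in> S) \<and>
     (\<forall>f\<in>S. \<forall>g\<in>words \<Lambda>. cancels i f g \<longrightarrow> g \<in> S)"

definition BF_sub :: "'l set \<Rightarrow> ('l \<Rightarrow> 'l) \<Rightarrow> 'l bword set \<Rightarrow> 'l bword set monoid" where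
  "BF_sub \<Lambda> i S = (BF \<Lambda> i)\<lparr>carrier := word_class \<Lambda> i ` S\<rparr>"

text \<open>The homomorphism from the big free group on some \<open>\<Lambda> \<supseteq> A\<close> to the one on \<open>A\<close>.\<close>

definition BF_proj :: "'l set \<Rightarrow> ('l \<Rightarrow> 'l) \<Rightarrow> 'l bword set \<Rightarrow> 'l bword set" where
  "BF_proj A i a = (\<Union>f\<in>a. word_class A i (word_restrict f {s. letter f s \<in> A}))"


section \<open>Topologies on big free groups\<close>

text \<open>The topology with a prescribed family of subgroups as a basis of neighbourhoods of the identity.\<close>

definition subgroup_topology :: "('g, 'b) monoid_scheme \<Rightarrow> 'g set set \<Rightarrow> 'g topology" where
  "subgroup_topology G \<B> = topology_generated_by {g <#\<^bsub>G\<^esub> U | g U. g \<in> carrier G \<and> U \<in> \<B>}"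

lemma openin_subgroup_topology:
  fixes G :: "('g, 'b) monoid_scheme"
  assumes G: "group G" and sub: "\<And>U. U \<in> \<B> \<Longrightarrow> subgroup U G" and ne: "\<B> \<noteq> {}"
    and dir: "\<And>U V. U \<in> \<B> \<Longrightarrow> V \<in> \<B> \<Longrightarrow> \<exists>W\<in>\<B>. W \<subseteq> U \<inter> V"
  shows "openin (subgroup_topology G \<B>) A \<longleftrightarrow>
           A \<subseteq> carrier G \<and> (\<forall>g\<in>A. \<exists>U\<in>\<B>. g <#\<^bsub>G\<^esub> U \<subseteq> A)"
proof
  interpret group G by (rule G)
  let ?S = "{g <#\<^bsub>G\<^esub> U | g U. g \<in> carrier G \<and> U \<in> \<B>}"
  assume "openin (subgroup_topology G \<B>) A"
  then have "generate_topology_on ?S A"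
    by (simp add: subgroup_topology_def openin_topology_generated_by_iff)
  then show "A \<subseteq> carrier G \<and> (\<forall>g\<in>A. \<exists>U\<in>\<B>. g <#\<^bsub>G\<^esub> U \<subseteq> A)"
  proof induction
    case Empty
    then show ?case by simp
  next
    case (Int a b)
    have "\<exists>U\<in>\<B>. g <#\<^bsub>G\<^esub> U \<subseteq> a \<inter> b" if g: "g \<in> a \<inter> b" for g
    proof -
      obtain U V where UV: "U \<in> \<B>" "V \<in> \<B>" "g <#\<^bsub>G\<^esub> U \<subseteq> a" "g <#\<^bsub>G\<^esub> V \<subseteq> b"
        using Int.IH g by blast
      then obtain W where "W \<in> \<B>" "W \<subseteq> U \<inter> V" using dir by blast
      then show ?thesis using UV by (intro bexI[of _ W]) (unfold l_coset_def, blast)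
    qed
    then show ?case using Int by blast
  next
    case (UN K)
    show ?case
    proof (intro conjI ballI)
      show "\<Union>K \<subseteq> carrier G" using UN by blast
    next
      fix g assume "g \<in> \<Union>K"
      then obtain k where k: "k \<in> K" "g \<in> k" by blast
      then obtain U where "U \<in> \<B>" "g <#\<^bsub>G\<^esub> U \<subseteq> k" using UN by blast
      then show "\<exists>U\<in>\<B>. g <#\<^bsub>G\<^esub> U \<subseteq> \<Union>K" using k by blast
    qed
  next
    case (Basis s)
    then obtain h U where hU: "s = h <#\<^bsub>G\<^esub> U" "h \<in> carrier G" "U \<in> \<B>" by blast
    have U: "subgroup U G" using sub hU by simp
    then have "s \<subseteq> carrier G"
      using hU by (simp add: l_coset_subset_G subgroup.subset)
    moreover have "g <#\<^bsub>G\<^esub> U \<subseteq> s" if g: "g \<in> s" for g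
      using l_repr_independence[OF _ _ U] g hU by simp
    ultimately show ?case using hU by blast
  qed
next
  interpret group G by (rule G)
  let ?S = "{g <#\<^bsub>G\<^esub> U | g U. g \<in> carrier G \<and> U \<in> \<B>}"
  assume A: "A \<subseteq> carrier G \<and> (\<forall>g\<in>A. \<exists>U\<in>\<B>. g <#\<^bsub>G\<^esub> U \<subseteq> A)"
  have mem: "g \<in> g <#\<^bsub>G\<^esub> U" if "g \<in> A" "U \<in> \<B>" for g U
  proof -
    have "g \<in> carrier G" using A that(1) by blast
    moreover have "\<one>\<^bsub>G\<^esub> \<in> U" using subgroup.one_closed[OF sub[OF that(2)]] .
    ultimately have "g = g \<otimes>\<^bsub>G\<^esub> \<one>\<^bsub>G\<^esub>" "\<one>\<^bsub>G\<^esub> \<in> U" by simp_all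
    then show ?thesis unfolding l_coset_def by blast
  qed
  have "A = \<Union>{s \<in> ?S. s \<subseteq> A}"
  proof
    show "A \<subseteq> \<Union>{s \<in> ?S. s \<subseteq> A}"
    proof
      fix g assume g: "g \<in> A"
      then obtain U where "U \<in> \<B>" "g <#\<^bsub>G\<^esub> U \<subseteq> A" using A by blast
      then show "g \<in> \<Union>{s \<in> ?S. s \<subseteq> A}" using mem[OF g] A g by blast
    qed
  qed auto
  also have "generate_topology_on ?S (\<Union>{s \<in> ?S. s \<subseteq> A})"
    by (intro generate_topology_on.UN generate_topology_on.Basis) auto
  finally show "openin (subgroup_topology G \<B>) A"
    by (simp add: subgroup_topology_def openin_topology_generated_by_iff)
qed

definition topological_group_on :: "('g, 'b) monoid_scheme \<Rightarrow> 'g topology \<Rightarrow> bool" where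
  "topological_group_on G \<T> \<longleftrightarrow>
     group G \<and> topspace \<T> = carrier G \<and>
     continuous_map (prod_topology \<T> \<T>) \<T> (\<lambda>(x, y). x \<otimes>\<^bsub>G\<^esub> y) \<and>
     continuous_map \<T> \<T> (\<lambda>x. inv\<^bsub>G\<^esub> x)"

definition natural_topology :: "'l set \<Rightarrow> ('l \<Rightarrow> 'l) \<Rightarrow> 'l bword set \<Rightarrow> 'l bword set topology" where
  "natural_topology \<Lambda> i S =
     subgroup_topology (BF_sub \<Lambda> i S)
       {kernel (BF_sub \<Lambda> i S) (BF A i) (BF_proj A i) | A. A \<subseteq> \<Lambda> \<and> i ` A = A \<and> finite A}"

definition admissible_topology ::
    "'l set \<Rightarrow> ('l \<Rightarrow> 'l) \<Rightarrow> 'l bword set \<Rightarrow> 'l bword set topology \<Rightarrow> bool" where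
  "admissible_topology \<Lambda> i S \<T> \<longleftrightarrow>
     topological_group_on (BF_sub \<Lambda> i S) \<T> \<and>
     (\<forall>U. openin (natural_topology \<Lambda> i S) U \<longrightarrow> openin \<T> U) \<and>
     \<T> closure_of (generate (BF_sub \<Lambda> i S) ((\<lambda>l. word_class \<Lambda> i (word_single l)) ` \<Lambda>))
       = topspace \<T>"


section \<open>Generalized presentations\<close>

definition generalized_presentation ::
    "'l set \<Rightarrow> ('l \<Rightarrow> 'l) \<Rightarrow> 'l bword set \<Rightarrow> 'l bword set topology \<Rightarrow> 'l bword set set \<Rightarrow>
     ('g, 'b) monoid_scheme \<Rightarrow> bool" where
  "generalized_presentation \<Lambda> i S \<T> R G \<longleftrightarrow>
     group G \<and>
     free_involution_on \<Lambda> i \<and>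
     admissible_words \<Lambda> i S \<and> word_single ` \<Lambda> \<subseteq> S \<and>
     admissible_topology \<Lambda> i S \<T> \<and>
     R \<subseteq> carrier (BF_sub \<Lambda> i S) \<and>
     (\<exists>p \<in> epi (BF_sub \<Lambda> i S) G.
        let K = kernel (BF_sub \<Lambda> i S) G p;
            \<N> = {N. N \<lhd> BF_sub \<Lambda> i S \<and> closedin \<T> N \<and> R \<subseteq> N}
        in K \<in> \<N> \<and> (\<forall>N\<in>\<N>. K \<subseteq> N))"

unbundle cardinal_syntax

definition presentation_of_type :: "'c rel \<Rightarrow> 'l set \<Rightarrow> 'l bword set set \<Rightarrow> bool" where
  "presentation_of_type c \<Lambda> R \<longleftrightarrow> |\<Lambda>| \<le>o c \<and> |R| \<le>o c"


section \<open>The data for the symmetric group\<close>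

text \<open>The formal symbol \<open>T\<^sub>x\<^sub>,\<^sub>y\<close> is the pair \<open>(x, y)\<close>; the involution is \<^const>\<open>prod.swap\<close>.\<close>

definition transp_letters :: "'a set \<Rightarrow> ('a \<times> 'a) set" where
  "transp_letters X = {(x, y). x \<in> X \<and> y \<in> X \<and> x \<noteq> y}"

definition occurrences :: "'a \<Rightarrow> ('s, 'a \<times> 'a) lword \<Rightarrow> 's set" where
  "occurrences z f = {s \<in> pos f. z \<in> {fst (letter f s), snd (letter f s)}}"

definition S0 :: "'a set \<Rightarrow> ('a \<times> 'a) bword set" where
  "S0 X = {f \<in> words (transp_letters X). \<forall>x\<in>X. finite (occurrences x f)}"

definition other_end :: "'a \<times> 'a \<Rightarrow> 'a \<Rightarrow> 'a" where
  "other_end l x = (if x = fst l then snd l else fst l)"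

definition is_least :: "'s rel \<Rightarrow> 's set \<Rightarrow> 's \<Rightarrow> bool" where
  "is_least r P s \<longleftrightarrow> s \<in> P \<and> (\<forall>t\<in>P. (s, t) \<in> r)"

text \<open>\<open>track r f x n\<close> is the pair of \<open>x\<^sub>n\<close> and \<open>s\<^sub>n\<close> (with no \<open>s\<^sub>0\<close>), or \<^const>\<open>None\<close> once the
  sequence has stopped, with positions ordered by \<open>r\<close>. The upward sequences are obtained with
  the order of \<open>f\<close>, the downward ones with its converse.\<close>

primrec track :: "'s rel \<Rightarrow> ('s, 'a \<times> 'a) lword \<Rightarrow> 'a \<Rightarrow> nat \<Rightarrow> ('a \<times> 's option) option" where
  "track r f x 0 = Some (x, None)"
| "track r f x (Suc n) =
     (case track r f x n of
        None \<Rightarrow> None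
      | Some (y, q) \<Rightarrow>
          let P = (case q of
                     None \<Rightarrow> occurrences y f
                   | Some s \<Rightarrow> {t \<in> occurrences y f. (s, t) \<in> r \<and> t \<noteq> s})
          in if \<exists>t. is_least r P t
             then let t = (THE t. is_least r P t) in Some (other_end (letter f t) y, Some t)
             else None)"

definition track_length :: "'s rel \<Rightarrow> ('s, 'a \<times> 'a) lword \<Rightarrow> 'a \<Rightarrow> enat" where
  "track_length r f x =
     (if \<exists>n. track r f x (Suc n) = None then enat (LEAST n. track r f x (Suc n) = None) else \<infinity>)"

definition n_plus :: "('s, 'a \<times> 'a) lword \<Rightarrow> 'a \<Rightarrow> enat" where
  "n_plus f x = track_length (ord_rel f) f x"

definition n_minus :: "('s, 'a \<times> 'a) lword \<Rightarrow> 'a \<Rightarrow> enat" where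
  "n_minus f x = track_length ((ord_rel f)\<inverse>) f x"

definition perm_words :: "'a set \<Rightarrow> ('a \<times> 'a) bword set" where
  "perm_words X = {f \<in> S0 X. \<forall>x\<in>X. n_plus f x < \<infinity> \<and> n_minus f x < \<infinity>}"

definition x_infinity :: "('s, 'a \<times> 'a) lword \<Rightarrow> 'a \<Rightarrow> 'a" where
  "x_infinity f x = fst (the (track (ord_rel f) f x (the_enat (n_plus f x))))"

definition perm_BF :: "'a set \<Rightarrow> ('a \<times> 'a) bword set monoid" where
  "perm_BF X = BF_sub (transp_letters X) prod.swap (perm_words X)"

definition stab_nbhd :: "'a set \<Rightarrow> 'a set \<Rightarrow> ('a \<times> 'a) bword set set" where
  "stab_nbhd X C =
     {word_class (transp_letters X) prod.swap f | f. f \<in> perm_words X \<and> (\<forall>x\<in>C. x_infinity f x = x)}"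

definition basic_nbhd :: "'a set \<Rightarrow> 'a set \<Rightarrow> ('a \<times> 'a) bword set set" where
  "basic_nbhd X C =
     kernel (perm_BF X) (BF (transp_letters C) prod.swap) (BF_proj (transp_letters C) prod.swap)
       \<inter> stab_nbhd X C"

definition perm_topology :: "'a set \<Rightarrow> ('a \<times> 'a) bword set topology" where
  "perm_topology X = subgroup_topology (perm_BF X) {basic_nbhd X C | C. C \<subseteq> X \<and> finite C}"

definition transp_gen :: "'a set \<Rightarrow> 'a \<Rightarrow> 'a \<Rightarrow> ('a \<times> 'a) bword set" where
  "transp_gen X x y = word_class (transp_letters X) prod.swap (word_single (x, y))"

definition perm_relators :: "'a set \<Rightarrow> ('a \<times> 'a) bword set set" where
  "perm_relators X =
     (let G = perm_BF X; T = transp_gen X in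
        {T x y [^]\<^bsub>G\<^esub> (2::nat) | x y. x \<in> X \<and> y \<in> X \<and> x \<noteq> y}
      \<union> {T x y \<otimes>\<^bsub>G\<^esub> T z w \<otimes>\<^bsub>G\<^esub> inv\<^bsub>G\<^esub> (T x y) \<otimes>\<^bsub>G\<^esub> inv\<^bsub>G\<^esub> (T z w) | x y z w.
           {x, y, z, w} \<subseteq> X \<and> card {x, y, z, w} = 4}
      \<union> {T x y \<otimes>\<^bsub>G\<^esub> T x z \<otimes>\<^bsub>G\<^esub> inv\<^bsub>G\<^esub> (T x y) \<otimes>\<^bsub>G\<^esub> inv\<^bsub>G\<^esub> (T y z) | x y z.
           {x, y, z} \<subseteq> X \<and> card {x, y, z} = 3})"

end

theory Submission
  imports Defs
begin

text \<open>
  For a finite set \<open>F\<close> of positions of a word \<open>f\<close> let \<open>F\<close> act on \<open>X\<close> by the product of the transpositions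
  at \<open>F\<close>. The sequence from \<open>x\<close> is finite iff the image of \<open>x\<close> is constant for all large \<open>F\<close>, and then this
  constant is \<open>x\<^sub>\<infinity>(f)\<close>. In this form finiteness is inherited under concatenation and, because \<open>F\<close> can be
  enlarged to be closed under the pairing \<open>*\<close>, under cancellation; and taking for \<open>F\<close> the positions with
  letters in \<open>\<Lambda>(C)\<close>, \<open>C\<close> finite, shows that \<open>x\<^sub>\<infinity>(f)\<close> depends only on the class of \<open>f\<close>. The epimorphism
  sends \<open>[f]\<close> to the inverse of \<open>x \<mapsto> x\<^sub>\<infinity>(f)\<close>; it is onto because every permutation is a product of two
  involutions, and an involution is a word of disjoint transpositions. Modulo the relations, a finite word
  which fixes \<open>C\<close> pointwise can be rewritten without letters meeting \<open>C\<close>, so that every neighbourhood of an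
  element of the kernel meets every normal subgroup containing \<open>R\<close>.
\<close>

section \<open>Words, their cancellations, and the big free group\<close>

section \<open>Sorted enumerations of finite sets of positions\<close>

text \<open>The sequences of points behave badly under cancellation: erasing pairs may change every
  step, and an infinite set of pairs cannot be removed one pair at a time. In a finite word,
  however, a cancellation is a succession of free reductions, which do not affect a product of
  transpositions. This is why everything is expressed by finite sets of positions.

  Two equivalent admissible words may be linked by a chain of words that leaves the admissible set,
  so invariance of the limit cannot be followed along the chain. The positions with letters in
  \<Lambda>(C) help because they form finite sets determined by the letters alone, and every finite
  set of positions lies in one of them.

  An element is approximated modulo W_C by a finite word over \<Lambda>(D) with D larger than C,
  since the points of C may leave C on their way. Letters meeting C are removed through the normal
  form w T_{x,y} with w avoiding x: if the word fixes x, the last letter is absent. Letters with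
  both ends outside C lie in W_C.

  The inverse in the epimorphism is due to orders of composition: the first letter of a word acts
  first, whereas \<open>BijGroup\<close> composes from right to left.\<close>

definition enum_by :: "'s rel \<Rightarrow> 's set \<Rightarrow> 's list" where
  "enum_by r F = (THE xs. set xs = F \<and> sorted_wrt (\<lambda>a b. (a, b) \<in> r \<and> a \<noteq> b) xs)"

text \<open>The head of a sorted list precedes all other entries, so two heads precede each other
  and antisymmetry identifies them. With this weak hypothesis \<open>enum_by_eqI\<close> applies
  directly to images of sorted lists under monotone injections.\<close>

lemma sorted_enum_unique:
  assumes "antisym r"
    and "sorted_wrt (\<lambda>a b. (a, b) \<in> r \<and> a \<noteq> b) xs" "sorted_wrt (\<lambda>a b. (a, b) \<in> r \<and> a \<noteq> b) ys"
    and "set xs = set ys"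
  shows "xs = ys"
  using assms(2-)
proof (induction xs arbitrary: ys)
  case Nil
  then show ?case by simp
next
  case (Cons x xs)
  then obtain y zs where ys: "ys = y # zs" by (cases ys) auto
  have xy: "x = y"
  proof (rule ccontr)
    assume "x \<noteq> y"
    then have "(x, y) \<in> r" "(y, x) \<in> r" using Cons.prems ys by (auto simp: set_eq_iff)
    then show False using assms(1) \<open>x \<noteq> y\<close> by (auto dest: antisymD)
  qed
  have "x \<notin> set xs" "y \<notin> set zs" using Cons.prems ys by auto
  then have "set xs = set zs" using Cons.prems(3) ys xy by auto
  then show ?case using Cons.IH[of zs] Cons.prems ys xy by simp
qed

lemma enum_by_eqI:
  assumes "antisym r" "sorted_wrt (\<lambda>a b. (a, b) \<in> r \<and> a \<noteq> b) xs" "set xs = F"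
  shows "enum_by r F = xs"
  unfolding enum_by_def
proof (rule the_equality)
  fix ys assume "set ys = F \<and> sorted_wrt (\<lambda>a b. (a, b) \<in> r \<and> a \<noteq> b) ys"
  then show "ys = xs"
    using sorted_enum_unique[of r ys xs] assms by simp
qed (use assms in simp)

lemma finite_has_least:
  assumes lin: "linear_order_on A r" and "finite F" "F \<noteq> {}" "F \<subseteq> A"
  shows "\<exists>m\<in>F. \<forall>t\<in>F. (m, t) \<in> r"
  using assms(2-)
proof (induction F rule: finite_ne_induct)
  case (singleton x)
  then show ?case using lin by (auto simp: order_on_defs refl_on_def)
next
  case (insert x F)
  then obtain m where m: "m \<in> F" "\<forall>t\<in>F. (m, t) \<in> r" by auto
  have tr: "trans r" and tot: "total_on A r" and re: "refl_on A r"
    using lin by (auto simp: order_on_defs)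
  show ?case
  proof (cases "(m, x) \<in> r")
    case True
    then show ?thesis using m by auto
  next
    case False
    then have "x \<noteq> m" using insert m by auto
    then have "(x, m) \<in> r" using tot False insert.prems m(1) by (auto simp: total_on_def)
    then have "\<forall>t\<in>insert x F. (x, t) \<in> r"
      using m tr re insert.prems by (auto simp: refl_on_def dest: transD)
    then show ?thesis by blast
  qed
qed

lemma sorted_enum_exists:
  assumes lin: "linear_order_on A r" and "finite F" "F \<subseteq> A"
  shows "\<exists>xs. set xs = F \<and> sorted_wrt (\<lambda>a b. (a, b) \<in> r \<and> a \<noteq> b) xs"
  using assms(2-)
proof (induction F rule: finite_psubset_induct)
  case (psubset F)
  show ?case
  proof (cases "F = {}")
    case True
    then show ?thesis by auto
  next
    case False
    then obtain m where m: "m \<in> F" "\<forall>t\<in>F. (m, t) \<in> r"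
      using finite_has_least[OF lin] psubset by meson
    then have "F - {m} \<subset> F" by auto
    then obtain xs where "set xs = F - {m}" "sorted_wrt (\<lambda>a b. (a, b) \<in> r \<and> a \<noteq> b) xs"
      using psubset by (meson Diff_subset dual_order.trans)
    then show ?thesis using m by (intro exI[of _ "m # xs"]) auto
  qed
qed

lemma
  assumes "linear_order_on A r" "finite F" "F \<subseteq> A"
  shows set_enum_by: "set (enum_by r F) = F"
    and sorted_enum_by: "sorted_wrt (\<lambda>a b. (a, b) \<in> r \<and> a \<noteq> b) (enum_by r F)"
proof -
  obtain xs where xs: "set xs = F" "sorted_wrt (\<lambda>a b. (a, b) \<in> r \<and> a \<noteq> b) xs"
    using sorted_enum_exists[OF assms] by blast
  then have "enum_by r F = xs"
    using assms(1) by (intro enum_by_eqI) (auto simp: order_on_defs)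
  then show "set (enum_by r F) = F"
    "sorted_wrt (\<lambda>a b. (a, b) \<in> r \<and> a \<noteq> b) (enum_by r F)"
    using xs by auto
qed

lemma enum_by_append:
  assumes lin: "linear_order_on A r" and F: "finite F" "F \<subseteq> A" and G: "finite G" "G \<subseteq> A"
    and less: "\<And>s t. s \<in> F \<Longrightarrow> t \<in> G \<Longrightarrow> (s, t) \<in> r \<and> s \<noteq> t"
  shows "enum_by r (F \<union> G) = enum_by r F @ enum_by r G"
proof (rule enum_by_eqI)
  show "antisym r" using lin by (auto simp: order_on_defs)
qed (use set_enum_by[OF lin F] set_enum_by[OF lin G] sorted_enum_by[OF lin F]
      sorted_enum_by[OF lin G] less in \<open>auto simp: sorted_wrt_append\<close>)

lemma enum_by_singleton: "antisym r \<Longrightarrow> enum_by r {s} = [s]"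
  by (rule enum_by_eqI) auto

lemma enum_by_empty: "antisym r \<Longrightarrow> enum_by r {} = []"
  by (rule enum_by_eqI) auto

section \<open>Isomorphism and cancellation of words\<close>

abbreviation linear_word :: "('s, 'l) lword \<Rightarrow> bool" where
  "linear_word f \<equiv> linear_order_on (pos f) (ord_rel f)"

abbreviation letter_restrict :: "('s, 'l) lword \<Rightarrow> 'l set \<Rightarrow> ('s, 'l) lword" where
  "letter_restrict f A \<equiv> word_restrict f {s. letter f s \<in> A}"

lemma words_linear: "f \<in> words \<Lambda> \<Longrightarrow> linear_word f"
  by (simp add: words_def)

lemma linear_order_Restr:
  assumes "linear_order_on A r" "B \<subseteq> A"
  shows "linear_order_on B (Restr r B)"
  using assms unfolding order_on_defs refl_on_def total_on_def
  by (auto intro!: antisymI transI dest: antisymD transD; blast)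

lemma pos_word_restrict [simp]: "pos (word_restrict f P) = pos f \<inter> P"
  and ord_word_restrict [simp]: "ord_rel (word_restrict f P) = Restr (ord_rel f) (pos f \<inter> P)"
  and letter_word_restrict [simp]: "letter (word_restrict f P) = letter f"
  by (simp_all add: word_restrict_def)

lemma word_restrict_restrict: "word_restrict (word_restrict f P) Q = word_restrict f (P \<inter> Q)"
  by (auto simp: word_restrict_def)

lemma word_restrict_cong: "pos f \<inter> P = pos f \<inter> Q \<Longrightarrow> word_restrict f P = word_restrict f Q"
  by (simp add: word_restrict_def)

lemma word_restrict_linear:
  "linear_word f \<Longrightarrow>
   linear_word (word_restrict f P)"
  by (simp add: linear_order_Restr)

lemma word_restrict_words:
  assumes "f \<in> words \<Lambda>" "A \<subseteq> \<Lambda>" "letter f ` (pos f \<inter> P) \<subseteq> A"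
  shows "word_restrict f P \<in> words A"
  using assms word_restrict_linear[of f P]
  by (auto simp: words_def intro: finite_subset[of _ "{s \<in> pos f. letter f s = _}"])

lemma word_iso_refl: "word_iso f f"
  unfolding word_iso_def by (rule exI[of _ id]) auto

lemma word_iso_sym:
  assumes "word_iso f g" shows "word_iso g f"
proof -
  obtain \<phi> where bij: "bij_betw \<phi> (pos f) (pos g)"
    and ord: "\<And>s t. s \<in> pos f \<Longrightarrow> t \<in> pos f \<Longrightarrow> (s, t) \<in> ord_rel f \<longleftrightarrow> (\<phi> s, \<phi> t) \<in> ord_rel g"
    and let_eq: "\<And>s. s \<in> pos f \<Longrightarrow> letter f s = letter g (\<phi> s)"
    using assms by (auto simp: word_iso_def)
  let ?\<psi> = "inv_into (pos f) \<phi>"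
  have "bij_betw ?\<psi> (pos g) (pos f)" using bij by (rule bij_betw_inv_into)
  moreover have "\<phi> (?\<psi> t) = t" "?\<psi> t \<in> pos f" if "t \<in> pos g" for t
    using bij that by (auto simp: bij_betw_def f_inv_into_f inv_into_into)
  ultimately show ?thesis
    unfolding word_iso_def using ord let_eq by (intro exI[of _ ?\<psi>]) auto
qed

lemma word_iso_trans:
  assumes "word_iso f g" "word_iso g h" shows "word_iso f h"
proof -
  obtain \<phi> where bij: "bij_betw \<phi> (pos f) (pos g)"
    and 1: "\<And>s t. s \<in> pos f \<Longrightarrow> t \<in> pos f \<Longrightarrow> (s, t) \<in> ord_rel f \<longleftrightarrow> (\<phi> s, \<phi> t) \<in> ord_rel g"
      "\<And>s. s \<in> pos f \<Longrightarrow> letter f s = letter g (\<phi> s)"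
    using assms(1) by (auto simp: word_iso_def)
  obtain \<psi> where bij': "bij_betw \<psi> (pos g) (pos h)"
    and 2: "\<And>s t. s \<in> pos g \<Longrightarrow> t \<in> pos g \<Longrightarrow> (s, t) \<in> ord_rel g \<longleftrightarrow> (\<psi> s, \<psi> t) \<in> ord_rel h"
      "\<And>s. s \<in> pos g \<Longrightarrow> letter g s = letter h (\<psi> s)"
    using assms(2) by (auto simp: word_iso_def)
  have "\<phi> s \<in> pos g" if "s \<in> pos f" for s using bij that by (auto simp: bij_betw_def)
  then show ?thesis
    unfolding word_iso_def using bij_betw_trans[OF bij bij'] 1 2
    by (intro exI[of _ "\<psi> \<circ> \<phi>"]) auto
qed

lemma word_iso_restrict:
  assumes "word_iso f g"
  shows "word_iso (letter_restrict f A) (letter_restrict g A)"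
proof -
  obtain \<phi> where bij: "bij_betw \<phi> (pos f) (pos g)"
    and 1: "\<And>s t. s \<in> pos f \<Longrightarrow> t \<in> pos f \<Longrightarrow> (s, t) \<in> ord_rel f \<longleftrightarrow> (\<phi> s, \<phi> t) \<in> ord_rel g"
      "\<And>s. s \<in> pos f \<Longrightarrow> letter f s = letter g (\<phi> s)"
    using assms(1) by (auto simp: word_iso_def)
  have "bij_betw \<phi> (pos f \<inter> {s. letter f s \<in> A}) (pos g \<inter> {s. letter g s \<in> A})"
    using bij 1(2) unfolding bij_betw_def inj_on_def set_eq_iff image_iff by fastforce
  moreover have "\<phi> s \<in> pos g" if "s \<in> pos f" for s using bij that by (auto simp: bij_betw_def)
  ultimately show ?thesis
    unfolding word_iso_def using 1 by (intro exI[of _ \<phi>]) auto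
qed

text \<open>The condition inside \<open>cancels\<close> with its witnesses \<open>T\<close> and
  \<open>star\<close> exposed, because one and the same pairing has to be followed through
  restrictions, concatenations and inverses.\<close>

definition cancelling :: "('l \<Rightarrow> 'l) \<Rightarrow> ('s, 'l) lword \<Rightarrow> 's set \<Rightarrow> ('s \<Rightarrow> 's) \<Rightarrow> bool" where
  "cancelling i f T star \<longleftrightarrow> T \<subseteq> pos f \<and>
     (\<forall>t\<in>T. star t \<in> T \<and> star (star t) = t \<and> letter f (star t) = i (letter f t) \<and>
            word_interval f t (star t) \<subseteq> T \<and>
            star ` word_interval f t (star t) = word_interval f t (star t))"

lemma cancels_iff:
  "cancels i f g \<longleftrightarrow> (\<exists>T star. cancelling i f T star \<and> word_iso g (word_restrict f (pos f - T)))"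
  unfolding cancels_def cancelling_def by blast

lemma cancellingD:
  assumes "cancelling i f T star" "t \<in> T"
  shows "t \<in> pos f" "star t \<in> T" "star (star t) = t" "letter f (star t) = i (letter f t)"
    "word_interval f t (star t) \<subseteq> T"
    "\<And>u. u \<in> word_interval f t (star t) \<Longrightarrow> star u \<in> word_interval f t (star t)"
  using assms unfolding cancelling_def by blast+

text \<open>An involution that maps a set into itself maps it onto itself, so the equality required
  of the intervals reduces to an inclusion.\<close>

lemma cancellingI:
  assumes "T \<subseteq> pos f"
    and "\<And>t. t \<in> T \<Longrightarrow> star t \<in> T \<and> star (star t) = t \<and> letter f (star t) = i (letter f t)"
    and sub: "\<And>t. t \<in> T \<Longrightarrow> word_interval f t (star t) \<subseteq> T"
    and "\<And>t u. t \<in> T \<Longrightarrow> u \<in> word_interval f t (star t) \<Longrightarrow> star u \<in> word_interval f t (star t)"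
  shows "cancelling i f T star"
proof -
  have "star ` word_interval f t (star t) = word_interval f t (star t)" if t: "t \<in> T" for t
  proof
    show "star ` word_interval f t (star t) \<subseteq> word_interval f t (star t)" using assms t by blast
    show "word_interval f t (star t) \<subseteq> star ` word_interval f t (star t)"
    proof
      fix u assume u: "u \<in> word_interval f t (star t)"
      then have "u = star (star u)" using assms t by (metis subsetD)
      then show "u \<in> star ` word_interval f t (star t)" using assms(4)[OF t u] by blast
    qed
  qed
  then show ?thesis using assms unfolding cancelling_def by blast
qed

text \<open>Inside \<open>P\<close> each interval becomes its intersection with \<open>P\<close>,
  and both sets are stable under \<open>star\<close>. This cuts a cancellation down to finitely many
  positions, or to the letters of a subalphabet.\<close>

lemma cancelling_restrict:
  assumes c: "cancelling i f T star" and star: "\<And>t. t \<in> T \<inter> P \<Longrightarrow> star t \<in> P"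
  shows "cancelling i (word_restrict f P) (T \<inter> P) star"
proof (rule cancellingI)
  fix t assume t: "t \<in> T \<inter> P"
  then show "star t \<in> T \<inter> P \<and> star (star t) = t \<and>
        letter (word_restrict f P) (star t) = i (letter (word_restrict f P) t)"
    using cancellingD[OF c, of t] star by simp
  have int: "word_interval (word_restrict f P) t (star t) = word_interval f t (star t) \<inter> P"
    using t star[OF t] cancellingD[OF c, of t] cancellingD(1)[OF c, of "star t"]
    by (auto simp: word_interval_def)
  show "word_interval (word_restrict f P) t (star t) \<subseteq> T \<inter> P"
    using int cancellingD(5)[OF c] t by auto
  fix u assume "u \<in> word_interval (word_restrict f P) t (star t)"
  then show "star u \<in> word_interval (word_restrict f P) t (star t)"
    using int cancellingD(5,6)[OF c, of t] t star by auto
qed (use cancellingD(1)[OF c] in auto)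

lemma cancels_iso_right: "cancels i f g \<Longrightarrow> word_iso g g' \<Longrightarrow> cancels i f g'"
  unfolding cancels_iff using word_iso_sym word_iso_trans by blast

lemma cancelling_empty: "cancelling i f {} star"
  by (simp add: cancelling_def)

lemma word_iso_cancels:
  assumes "word_iso f g" shows "cancels i f g"
proof -
  have "word_iso (word_restrict f (pos f - {})) f"
    unfolding word_iso_def by (rule exI[of _ id]) auto
  then have "cancels i f f"
    unfolding cancels_iff using cancelling_empty word_iso_sym by blast
  then show ?thesis using cancels_iso_right assms by blast
qed

text \<open>Since \<open>star\<close> inverts letters, the positions with letters in an
  inverse-closed set are closed under \<open>star\<close>. This makes the projections \<phi>_A well
  defined on classes.\<close>

lemma cancels_restrict:
  assumes "cancels i f g" "\<And>l. l \<in> A \<Longrightarrow> i l \<in> A"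
  shows "cancels i (letter_restrict f A) (letter_restrict g A)"
proof -
  let ?P = "{s. letter f s \<in> A}"
  obtain T star where c: "cancelling i f T star" and g: "word_iso g (word_restrict f (pos f - T))"
    using assms by (auto simp: cancels_iff)
  have "cancelling i (word_restrict f ?P) (T \<inter> ?P) star"
    using cancellingD(4)[OF c] assms(2) by (intro cancelling_restrict[OF c]) auto
  moreover have "letter_restrict (word_restrict f (pos f - T)) A
     = word_restrict (word_restrict f ?P) (pos (word_restrict f ?P) - T \<inter> ?P)"
    unfolding word_restrict_restrict by (rule word_restrict_cong) auto
  ultimately show ?thesis
    unfolding cancels_iff using word_iso_restrict[OF g, of A] by (metis)
qed

section \<open>Concatenation\<close>

definition left_copy :: "'l \<times> nat \<Rightarrow> 'l \<times> nat" where "left_copy = (\<lambda>(l, n). (l, 2 * n))"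

definition right_copy :: "'l \<times> nat \<Rightarrow> 'l \<times> nat" where "right_copy = (\<lambda>(l, n). (l, 2 * n + 1))"

text \<open>Case distinction between the two copies of positions. With the simplification rules
  below, maps out of a concatenation are defined and computed without arithmetic on
  parities.\<close>

definition join_maps :: "('l \<times> nat \<Rightarrow> 'b) \<Rightarrow> ('l \<times> nat \<Rightarrow> 'b) \<Rightarrow> 'l \<times> nat \<Rightarrow> 'b" where
  "join_maps \<phi> \<psi> = (\<lambda>(l, n). if even n then \<phi> (l, n div 2) else \<psi> (l, n div 2))"

lemma left_copy_eq [simp]: "left_copy s = left_copy t \<longleftrightarrow> s = t"
  and right_copy_eq [simp]: "right_copy s = right_copy t \<longleftrightarrow> s = t"
  by (auto simp: left_copy_def right_copy_def split: prod.splits)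

lemma copies_disjoint [simp]: "left_copy s \<noteq> right_copy t" "right_copy t \<noteq> left_copy s"
  by (auto simp: left_copy_def right_copy_def split: prod.splits) presburger+

lemma join_maps_left [simp]: "join_maps \<phi> \<psi> (left_copy s) = \<phi> s"
  and join_maps_right [simp]: "join_maps \<phi> \<psi> (right_copy s) = \<psi> s"
  by (auto simp: join_maps_def left_copy_def right_copy_def split: prod.splits)

lemma pos_concat: "pos (word_concat f g) = left_copy ` pos f \<union> right_copy ` pos g"
  and ord_concat: "ord_rel (word_concat f g) =
     map_prod left_copy left_copy ` ord_rel f \<union> map_prod right_copy right_copy ` ord_rel g \<union>
     left_copy ` pos f \<times> right_copy ` pos g"
  and letter_concat: "letter (word_concat f g) = join_maps (letter f) (letter g)"
  by (auto simp: word_concat_def left_copy_def right_copy_def join_maps_def Let_def)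

lemma in_pos_concat [simp]:
  "left_copy s \<in> pos (word_concat f g) \<longleftrightarrow> s \<in> pos f"
  "right_copy s \<in> pos (word_concat f g) \<longleftrightarrow> s \<in> pos g"
  by (auto simp: pos_concat)

lemma in_ord_concat [simp]:
  "(left_copy s, left_copy t) \<in> ord_rel (word_concat f g) \<longleftrightarrow> (s, t) \<in> ord_rel f"
  "(right_copy s, right_copy t) \<in> ord_rel (word_concat f g) \<longleftrightarrow> (s, t) \<in> ord_rel g"
  "(left_copy s, right_copy t) \<in> ord_rel (word_concat f g) \<longleftrightarrow> s \<in> pos f \<and> t \<in> pos g"
  "(right_copy s, left_copy t) \<notin> ord_rel (word_concat f g)"
  by (auto simp: ord_concat)

lemma letter_concat_simps [simp]:
  "letter (word_concat f g) (left_copy s) = letter f s"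
  "letter (word_concat f g) (right_copy s) = letter g s"
  by (simp_all add: letter_concat)

lemma pos_concatE:
  assumes "p \<in> pos (word_concat f g)"
  obtains s where "s \<in> pos f" "p = left_copy s" | s where "s \<in> pos g" "p = right_copy s"
  using assms by (auto simp: pos_concat)

lemma concat_linear:
  assumes f: "linear_word f" and g: "linear_word g"
  shows "linear_word (word_concat f g)"
proof -
  have f': "ord_rel f \<subseteq> pos f \<times> pos f" "refl_on (pos f) (ord_rel f)" "trans (ord_rel f)"
    "antisym (ord_rel f)" "total_on (pos f) (ord_rel f)"
    and g': "ord_rel g \<subseteq> pos g \<times> pos g" "refl_on (pos g) (ord_rel g)" "trans (ord_rel g)"
    "antisym (ord_rel g)" "total_on (pos g) (ord_rel g)"
    using f g by (simp_all add: order_on_defs)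
  let ?r = "ord_rel (word_concat f g)" and ?A = "pos (word_concat f g)"
  have sub: "?r \<subseteq> ?A \<times> ?A" using f'(1) g'(1) by (auto simp: ord_concat pos_concat)
  have "trans ?r"
  proof (rule transI)
    fix x y z assume xyz: "(x, y) \<in> ?r" "(y, z) \<in> ?r"
    then have "x \<in> ?A" "y \<in> ?A" "z \<in> ?A" using sub by auto
    then show "(x, z) \<in> ?r"
      using xyz f'(1) g'(1)
      by (elim pos_concatE) (auto dest: transD[OF f'(3)] transD[OF g'(3)])
  qed
  moreover have "antisym ?r"
  proof (rule antisymI)
    fix x y assume xy: "(x, y) \<in> ?r" "(y, x) \<in> ?r"
    then have "x \<in> ?A" "y \<in> ?A" using sub by auto
    then show "x = y"
      using xy by (elim pos_concatE) (auto dest: antisymD[OF f'(4)] antisymD[OF g'(4)])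
  qed
  moreover have "total_on ?A ?r"
    unfolding total_on_def
  proof (intro ballI impI)
    fix x y assume "x \<in> ?A" "y \<in> ?A" "x \<noteq> y"
    then show "(x, y) \<in> ?r \<or> (y, x) \<in> ?r"
      using f'(5) g'(5) by (elim pos_concatE) (auto simp: total_on_def)
  qed
  moreover have "refl_on ?A ?r"
    using f'(2) g'(2) by (auto simp: refl_on_def pos_concat)
  ultimately show ?thesis using sub by (simp add: order_on_defs)
qed

lemma concat_words:
  assumes "f \<in> words \<Lambda>" "g \<in> words \<Lambda>" shows "word_concat f g \<in> words \<Lambda>"
proof -
  have "{s \<in> pos (word_concat f g). letter (word_concat f g) s = l} =
     left_copy ` {s \<in> pos f. letter f s = l} \<union> right_copy ` {s \<in> pos g. letter g s = l}" for l
    by (auto simp: pos_concat)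
  moreover have "letter (word_concat f g) ` pos (word_concat f g) \<subseteq> \<Lambda>"
    using assms by (auto simp: words_def pos_concat)
  ultimately show ?thesis
    using assms by (auto simp: words_def concat_linear)
qed

lemma concat_iso:
  assumes "word_iso f f'" "word_iso g g'"
  shows "word_iso (word_concat f g) (word_concat f' g')"
proof -
  obtain \<phi> where bij: "bij_betw \<phi> (pos f) (pos f')"
    and 1: "\<And>s t. s \<in> pos f \<Longrightarrow> t \<in> pos f \<Longrightarrow> (s, t) \<in> ord_rel f \<longleftrightarrow> (\<phi> s, \<phi> t) \<in> ord_rel f'"
      "\<And>s. s \<in> pos f \<Longrightarrow> letter f s = letter f' (\<phi> s)"
    using assms(1) by (auto simp: word_iso_def)
  obtain \<psi> where bij': "bij_betw \<psi> (pos g) (pos g')"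
    and 2: "\<And>s t. s \<in> pos g \<Longrightarrow> t \<in> pos g \<Longrightarrow> (s, t) \<in> ord_rel g \<longleftrightarrow> (\<psi> s, \<psi> t) \<in> ord_rel g'"
      "\<And>s. s \<in> pos g \<Longrightarrow> letter g s = letter g' (\<psi> s)"
    using assms(2) by (auto simp: word_iso_def)
  have im: "\<phi> ` pos f = pos f'" "\<psi> ` pos g = pos g'" "inj_on \<phi> (pos f)" "inj_on \<psi> (pos g)"
    using bij bij' by (auto simp: bij_betw_def)
  let ?h = "join_maps (left_copy \<circ> \<phi>) (right_copy \<circ> \<psi>)"
  have "bij_betw ?h (pos (word_concat f g)) (pos (word_concat f' g'))"
    unfolding bij_betw_def
  proof
    show "inj_on ?h (pos (word_concat f g))"
      by (rule inj_onI) (elim pos_concatE; simp add: inj_on_eq_iff[OF im(3)] inj_on_eq_iff[OF im(4)])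
    show "?h ` pos (word_concat f g) = pos (word_concat f' g')"
      unfolding pos_concat im(1,2)[symmetric] by (simp add: image_Un image_image)
  qed
  moreover have "\<forall>s\<in>pos (word_concat f g). \<forall>t\<in>pos (word_concat f g).
      (s, t) \<in> ord_rel (word_concat f g) \<longleftrightarrow> (?h s, ?h t) \<in> ord_rel (word_concat f' g')"
    using 1 2 im(1,2) by (intro ballI; elim pos_concatE; simp; blast)
  moreover have "\<forall>s\<in>pos (word_concat f g). letter (word_concat f g) s = letter (word_concat f' g') (?h s)"
    using 1(2) 2(2) by (intro ballI; elim pos_concatE; simp)
  ultimately show ?thesis unfolding word_iso_def by blast
qed

text \<open>An equality and not only an isomorphism, because the two embeddings of positions do not
  depend on the words.\<close>

lemma concat_restrict:
  "word_concat (word_restrict f P) (word_restrict g Q) =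
   word_restrict (word_concat f g) (left_copy ` P \<union> right_copy ` Q)"
proof -
  have "ord_rel (word_concat (word_restrict f P) (word_restrict g Q)) =
    ord_rel (word_restrict (word_concat f g) (left_copy ` P \<union> right_copy ` Q))"
    by (auto simp: ord_concat pos_concat)
  moreover have "pos (word_concat (word_restrict f P) (word_restrict g Q)) =
    pos (word_restrict (word_concat f g) (left_copy ` P \<union> right_copy ` Q))"
    by (auto simp: pos_concat)
  moreover have "letter (word_concat (word_restrict f P) (word_restrict g Q)) =
    letter (word_restrict (word_concat f g) (left_copy ` P \<union> right_copy ` Q))"
    by (simp add: letter_concat)
  ultimately show ?thesis by simp
qed

text \<open>Two positions of the same copy enclose only positions of that copy, so the two pairings
  can be put side by side.\<close>

lemma concat_cancels:
  assumes "cancels i f f'" "cancels i g g'"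
  shows "cancels i (word_concat f g) (word_concat f' g')"
proof -
  obtain T star where c: "cancelling i f T star" and f': "word_iso f' (word_restrict f (pos f - T))"
    using assms(1) by (auto simp: cancels_iff)
  obtain U star' where d: "cancelling i g U star'" and g': "word_iso g' (word_restrict g (pos g - U))"
    using assms(2) by (auto simp: cancels_iff)
  let ?h = "word_concat f g" and ?T = "left_copy ` T \<union> right_copy ` U"
  let ?star = "join_maps (left_copy \<circ> star) (right_copy \<circ> star')"
  have int: "word_interval ?h (left_copy s) (left_copy t) = left_copy ` word_interval f s t"
    "word_interval ?h (right_copy s) (right_copy t) = right_copy ` word_interval g s t" for s t
    by (auto simp: word_interval_def pos_concat)
  have "cancelling i ?h ?T ?star"
  proof (rule cancellingI)
    show "?T \<subseteq> pos ?h" using cancellingD(1)[OF c] cancellingD(1)[OF d] by (auto simp: pos_concat)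
    fix t assume t: "t \<in> ?T"
    show "word_interval ?h t (?star t) \<subseteq> ?T"
      using t by (elim UnE imageE)
        (simp add: int, use cancellingD(5)[OF c] cancellingD(5)[OF d] in blast)+
    from t show "?star t \<in> ?T \<and> ?star (?star t) = t \<and> letter ?h (?star t) = i (letter ?h t)"
      "\<And>u. u \<in> word_interval ?h t (?star t) \<Longrightarrow> ?star u \<in> word_interval ?h t (?star t)"
      using cancellingD[OF c] cancellingD[OF d] by (auto simp: int)
  qed
  moreover have "word_iso (word_concat f' g')
      (word_concat (word_restrict f (pos f - T)) (word_restrict g (pos g - U)))"
    using f' g' by (rule concat_iso)
  moreover have "word_concat (word_restrict f (pos f - T)) (word_restrict g (pos g - U)) =
     word_restrict ?h (pos ?h - ?T)"
    unfolding concat_restrict by (rule word_restrict_cong) (auto simp: pos_concat)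
  ultimately show ?thesis unfolding cancels_iff by metis
qed

text \<open>The three factors have indices 4n, 4n+2, 2n+1 on the left and 2n, 4n+1, 4n+3 on the
  right; the map translates one coding into the other.\<close>

lemma concat_assoc_iso:
  "word_iso (word_concat (word_concat f g) h) (word_concat f (word_concat g h))"
proof -
  let ?\<phi> = "join_maps (join_maps left_copy (right_copy \<circ> left_copy)) (right_copy \<circ> right_copy)
    :: 'a \<times> nat \<Rightarrow> 'a \<times> nat"
  let ?a = "word_concat (word_concat f g) h" and ?b = "word_concat f (word_concat g h)"
  have "bij_betw ?\<phi> (pos ?a) (pos ?b)"
    unfolding bij_betw_def
  proof
    show "inj_on ?\<phi> (pos ?a)" by (rule inj_onI) (elim pos_concatE; simp)
    show "?\<phi> ` pos ?a = pos ?b" by (auto simp: pos_concat image_Un image_image)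
  qed
  moreover have "\<forall>s\<in>pos ?a. \<forall>t\<in>pos ?a. (s, t) \<in> ord_rel ?a \<longleftrightarrow> (?\<phi> s, ?\<phi> t) \<in> ord_rel ?b"
    "\<forall>s\<in>pos ?a. letter ?a s = letter ?b (?\<phi> s)"
    by (auto simp: pos_concat)
  ultimately show ?thesis unfolding word_iso_def by blast
qed

lemma concat_empty_left: "word_iso (word_concat word_empty f) f"
proof -
  let ?\<phi> = "join_maps id id :: 'a \<times> nat \<Rightarrow> 'a \<times> nat"
  have "bij_betw ?\<phi> (pos (word_concat word_empty f)) (pos f)"
    unfolding bij_betw_def pos_concat inj_on_def by (auto simp: word_empty_def image_image)
  then show ?thesis
    unfolding word_iso_def by (intro exI[of _ ?\<phi>]) (auto simp: pos_concat word_empty_def)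
qed

lemma pos_inverse [simp]: "pos (word_inverse i f) = pos f"
  and ord_inverse [simp]: "ord_rel (word_inverse i f) = (ord_rel f)\<inverse>"
  and letter_inverse [simp]: "letter (word_inverse i f) s = i (letter f s)"
  by (simp_all add: word_inverse_def)

lemma inverse_linear:
  "linear_word f \<Longrightarrow>
   linear_word (word_inverse i f)"
  by simp

lemma word_empty_words: "word_empty \<in> words \<Lambda>"
  by (auto simp: words_def word_empty_def order_on_defs refl_on_def trans_def antisym_def)

lemma word_single_words: "l \<in> \<Lambda> \<Longrightarrow> word_single l \<in> words \<Lambda>"
  by (auto simp: words_def word_single_def order_on_defs refl_on_def trans_def antisym_def total_on_def)

lemma empty_iso:
  assumes "pos f = {}" "pos g = {}" shows "word_iso f g"
  using assms by (auto simp: word_iso_def bij_betw_def)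

text \<open>Each position is paired with its own copy.\<close>

lemma concat_inverse_cancels:
  assumes "linear_word f" and "\<And>s. s \<in> pos f \<Longrightarrow> i (i (letter f s)) = letter f s"
  shows "cancels i (word_concat f (word_inverse i f)) word_empty"
proof -
  let ?h = "word_concat f (word_inverse i f)"
  let ?star = "join_maps right_copy left_copy :: 'a \<times> nat \<Rightarrow> 'a \<times> nat"
  have "cancelling i ?h (pos ?h) ?star"
  proof (rule cancellingI)
    fix t assume "t \<in> pos ?h"
    then show "?star t \<in> pos ?h \<and> ?star (?star t) = t \<and> letter ?h (?star t) = i (letter ?h t)"
      using assms(2) by (auto elim!: pos_concatE)
  next
    \<comment> \<open>The second half carries the reversed order, so a position lies between
      \<open>t\<close> and its copy exactly if its own copy does. If \<open>t\<close> is in the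
      second half, the interval is empty.\<close>
    fix t u assume t: "t \<in> pos ?h" and u: "u \<in> word_interval ?h t (?star t)"
    then have "u \<in> pos ?h" by (simp add: word_interval_def)
    then show "?star u \<in> word_interval ?h t (?star t)"
      using t u by (elim pos_concatE) (auto simp: word_interval_def)
  qed (auto simp: word_interval_def)
  moreover have "word_iso word_empty (word_restrict ?h (pos ?h - pos ?h))"
    by (rule empty_iso) (auto simp: word_empty_def)
  ultimately show ?thesis unfolding cancels_iff by blast
qed

section \<open>The big free group\<close>

lemma equiv_word_equiv: "equiv (words \<Lambda>) (word_equiv \<Lambda> i)"
proof -
  let ?r = "cancel_rel \<Lambda> i \<union> (cancel_rel \<Lambda> i)\<inverse>"
  have "sym (?r\<^sup>*)" by (rule sym_rtrancl) (auto simp: sym_def)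
  then show ?thesis
    unfolding equiv_def word_equiv_def
    by (auto simp: refl_on_def sym_def trans_def)
qed

lemma word_equivI: "f \<in> words \<Lambda> \<Longrightarrow> g \<in> words \<Lambda> \<Longrightarrow> cancels i f g \<Longrightarrow> (f, g) \<in> word_equiv \<Lambda> i"
  by (auto simp: word_equiv_def cancel_rel_def)

text \<open>The equivalence is generated by single cancellations, so any function that is constant
  along one cancellation is constant on classes. All arguments about independence of representatives
  go through this.\<close>

lemma word_equiv_invariant:
  assumes "(f, g) \<in> word_equiv \<Lambda> i"
    and inv: "\<And>f g. f \<in> words \<Lambda> \<Longrightarrow> g \<in> words \<Lambda> \<Longrightarrow> cancels i f g \<Longrightarrow> F f = F g"
  shows "F f = F g"
proof -
  have "(f, g) \<in> (cancel_rel \<Lambda> i \<union> (cancel_rel \<Lambda> i)\<inverse>)\<^sup>*"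
    using assms(1) by (simp add: word_equiv_def)
  then show ?thesis
  proof induction
    case (step y z)
    then show ?case using inv[of y z] inv[of z y] by (auto simp: cancel_rel_def)
  qed simp
qed

lemma word_class_eq_iff:
  assumes "f \<in> words \<Lambda>" "g \<in> words \<Lambda>"
  shows "word_class \<Lambda> i f = word_class \<Lambda> i g \<longleftrightarrow> (f, g) \<in> word_equiv \<Lambda> i"
  unfolding word_class_def using eq_equiv_class_iff[OF equiv_word_equiv assms] by simp

lemma word_class_cancels:
  "f \<in> words \<Lambda> \<Longrightarrow> g \<in> words \<Lambda> \<Longrightarrow> cancels i f g \<Longrightarrow> word_class \<Lambda> i f = word_class \<Lambda> i g"
  by (simp add: word_class_eq_iff word_equivI)

lemma word_class_iso:
  "f \<in> words \<Lambda> \<Longrightarrow> g \<in> words \<Lambda> \<Longrightarrow> word_iso f g \<Longrightarrow> word_class \<Lambda> i f = word_class \<Lambda> i g"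
  by (simp add: word_class_cancels word_iso_cancels)

lemma word_class_self: "f \<in> words \<Lambda> \<Longrightarrow> f \<in> word_class \<Lambda> i f"
  using equiv_class_self[OF equiv_word_equiv] by (simp add: word_class_def)

lemma word_classD:
  assumes "g \<in> word_class \<Lambda> i f" shows "(f, g) \<in> word_equiv \<Lambda> i" "f \<in> words \<Lambda>" "g \<in> words \<Lambda>"
  using assms by (auto simp: word_class_def word_equiv_def)

lemma carrier_BF: "carrier (BF \<Lambda> i) = word_class \<Lambda> i ` words \<Lambda>"
  by (auto simp: BF_def quotient_def word_class_def)

lemma one_BF: "\<one>\<^bsub>BF \<Lambda> i\<^esub> = word_class \<Lambda> i word_empty"
  by (simp add: BF_def)

lemma concat_equiv:
  assumes "(f, f') \<in> word_equiv \<Lambda> i" "(g, g') \<in> word_equiv \<Lambda> i"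
  shows "word_class \<Lambda> i (word_concat f g) = word_class \<Lambda> i (word_concat f' g')"
proof -
  have w: "f' \<in> words \<Lambda>" "g \<in> words \<Lambda>" using assms by (auto simp: word_equiv_def)
  have "word_class \<Lambda> i (word_concat f g) = word_class \<Lambda> i (word_concat f' g)"
    using assms(1)
    by (rule word_equiv_invariant)
      (intro word_class_cancels concat_words concat_cancels word_iso_cancels[OF word_iso_refl] w; assumption)
  also have "\<dots> = word_class \<Lambda> i (word_concat f' g')"
    using assms(2)
    by (rule word_equiv_invariant)
      (intro word_class_cancels concat_words concat_cancels word_iso_cancels[OF word_iso_refl] w; assumption)
  finally show ?thesis .
qed

text \<open>The union in the definition of the product runs over equal classes by
  \<open>concat_equiv\<close>. \<open>BF_proj_class\<close> evaluates the projections in the same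
  way.\<close>

lemma mult_BF:
  assumes "f \<in> words \<Lambda>" "g \<in> words \<Lambda>"
  shows "word_class \<Lambda> i f \<otimes>\<^bsub>BF \<Lambda> i\<^esub> word_class \<Lambda> i g = word_class \<Lambda> i (word_concat f g)"
proof -
  have "word_class \<Lambda> i (word_concat f' g') = word_class \<Lambda> i (word_concat f g)"
    if "f' \<in> word_class \<Lambda> i f" "g' \<in> word_class \<Lambda> i g" for f' g'
    using concat_equiv[OF word_classD(1)[OF that(1)] word_classD(1)[OF that(2)]] by simp
  then show ?thesis
    unfolding BF_def monoid.simps
    by (intro UN_constant_eq[OF word_class_self[OF assms(1)]]
        UN_constant_eq[OF word_class_self[OF assms(2)]] ballI)
qed

lemma inverse_words:
  assumes f: "f \<in> words \<Lambda>" and i: "\<And>l. l \<in> \<Lambda> \<Longrightarrow> i l \<in> \<Lambda> \<and> i (i l) = l"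
  shows "word_inverse i f \<in> words \<Lambda>"
proof -
  have "{s \<in> pos f. i (letter f s) = l} \<subseteq> {s \<in> pos f. letter f s = i l}" for l
  proof
    fix s assume "s \<in> {s \<in> pos f. i (letter f s) = l}"
    then show "s \<in> {s \<in> pos f. letter f s = i l}" using f i[of "letter f s"] by (auto simp: words_def)
  qed
  then have "finite {s \<in> pos f. i (letter f s) = l}" if "l \<in> \<Lambda>" for l
    by (rule finite_subset) (use f i[OF that] in \<open>simp add: words_def\<close>)
  then show ?thesis
    using f i by (simp add: words_def image_subset_iff)
qed

lemma inverse_inverse_iso:
  assumes "\<And>s. s \<in> pos f \<Longrightarrow> i (i (letter f s)) = letter f s"
  shows "word_iso (word_inverse i (word_inverse i f)) f"
  unfolding word_iso_def by (rule exI[of _ id]) (use assms in auto)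

lemma concat_inverse_class:
  assumes f: "f \<in> words \<Lambda>" and i: "\<And>l. l \<in> \<Lambda> \<Longrightarrow> i l \<in> \<Lambda> \<and> i (i l) = l"
  shows "word_class \<Lambda> i (word_concat f (word_inverse i f)) = word_class \<Lambda> i word_empty"
    and "word_class \<Lambda> i (word_concat (word_inverse i f) f) = word_class \<Lambda> i word_empty"
proof -
  have let_in: "letter f s \<in> \<Lambda>" if "s \<in> pos f" for s using f that by (auto simp: words_def)
  have f': "word_inverse i f \<in> words \<Lambda>" by (rule inverse_words) fact+
  have f'': "word_inverse i (word_inverse i f) \<in> words \<Lambda>"
    using f' by (rule inverse_words) (rule i)
  show "word_class \<Lambda> i (word_concat f (word_inverse i f)) = word_class \<Lambda> i word_empty"
    using f f' let_in i words_linear[OF f]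
    by (intro word_class_cancels concat_words word_empty_words concat_inverse_cancels) auto
  \<comment> \<open>The second identity is the first one for the inverse word, whose own inverse is
    isomorphic to \<open>f\<close>.\<close>
  have "word_class \<Lambda> i (word_concat (word_inverse i f) f) =
      word_class \<Lambda> i (word_concat (word_inverse i f) (word_inverse i (word_inverse i f)))"
    using f f' f'' let_in i
    by (intro word_class_iso concat_words concat_iso word_iso_refl word_iso_sym[OF inverse_inverse_iso]) auto
  also have "\<dots> = word_class \<Lambda> i word_empty"
    using f' f'' let_in i words_linear[OF f']
    by (intro word_class_cancels concat_words word_empty_words concat_inverse_cancels) auto
  finally show "word_class \<Lambda> i (word_concat (word_inverse i f) f) = word_class \<Lambda> i word_empty" .
qed

lemma group_BF:
  assumes i: "\<And>l. l \<in> \<Lambda> \<Longrightarrow> i l \<in> \<Lambda> \<and> i (i l) = l"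
  shows "group (BF \<Lambda> i)"
proof (rule groupI)
  show "\<one>\<^bsub>BF \<Lambda> i\<^esub> \<in> carrier (BF \<Lambda> i)"
    by (simp add: one_BF carrier_BF word_empty_words)
next
  fix a b assume "a \<in> carrier (BF \<Lambda> i)" "b \<in> carrier (BF \<Lambda> i)"
  then show "a \<otimes>\<^bsub>BF \<Lambda> i\<^esub> b \<in> carrier (BF \<Lambda> i)"
    by (auto simp: carrier_BF mult_BF concat_words)
next
  fix a b c assume "a \<in> carrier (BF \<Lambda> i)" "b \<in> carrier (BF \<Lambda> i)" "c \<in> carrier (BF \<Lambda> i)"
  then show "a \<otimes>\<^bsub>BF \<Lambda> i\<^esub> b \<otimes>\<^bsub>BF \<Lambda> i\<^esub> c = a \<otimes>\<^bsub>BF \<Lambda> i\<^esub> (b \<otimes>\<^bsub>BF \<Lambda> i\<^esub> c)"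
    unfolding carrier_BF
    by (elim imageE) (simp add: mult_BF concat_words word_class_iso[OF _ _ concat_assoc_iso])
next
  fix a assume "a \<in> carrier (BF \<Lambda> i)"
  then obtain f where f: "f \<in> words \<Lambda>" "a = word_class \<Lambda> i f" by (auto simp: carrier_BF)
  then show "\<one>\<^bsub>BF \<Lambda> i\<^esub> \<otimes>\<^bsub>BF \<Lambda> i\<^esub> a = a"
    using word_class_iso[OF concat_words[OF word_empty_words f(1)] f(1) concat_empty_left, of i]
    by (simp add: one_BF mult_BF word_empty_words)
  have "word_inverse i f \<in> words \<Lambda>" using f(1) i by (rule inverse_words)
  then show "\<exists>b\<in>carrier (BF \<Lambda> i). b \<otimes>\<^bsub>BF \<Lambda> i\<^esub> a = \<one>\<^bsub>BF \<Lambda> i\<^esub>"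
    using f concat_inverse_class(2)[OF f(1) i]
    by (auto simp: carrier_BF mult_BF one_BF)
qed

lemma inv_BF:
  assumes f: "f \<in> words \<Lambda>" and i: "\<And>l. l \<in> \<Lambda> \<Longrightarrow> i l \<in> \<Lambda> \<and> i (i l) = l"
  shows "inv\<^bsub>BF \<Lambda> i\<^esub> (word_class \<Lambda> i f) = word_class \<Lambda> i (word_inverse i f)"
proof -
  interpret group "BF \<Lambda> i" by (rule group_BF) (rule i)
  have "word_inverse i f \<in> words \<Lambda>" using f i by (rule inverse_words)
  then show ?thesis
    using f concat_inverse_class(2)[OF f i]
    by (intro inv_equality) (auto simp: carrier_BF mult_BF one_BF)
qed

lemma subgroup_admissible:
  assumes i: "\<And>l. l \<in> \<Lambda> \<Longrightarrow> i l \<in> \<Lambda> \<and> i (i l) = l" and S: "admissible_words \<Lambda> i S" "S \<noteq> {}"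
  shows "subgroup (word_class \<Lambda> i ` S) (BF \<Lambda> i)"
proof -
  interpret group "BF \<Lambda> i" by (rule group_BF) (rule i)
  have S': "S \<subseteq> words \<Lambda>" using S by (simp add: admissible_words_def)
  show ?thesis
  proof (rule subgroupI)
    fix a assume "a \<in> word_class \<Lambda> i ` S"
    then obtain f where f: "f \<in> S" "a = word_class \<Lambda> i f" by auto
    then have "inv\<^bsub>BF \<Lambda> i\<^esub> a = word_class \<Lambda> i (word_inverse i f)"
      using inv_BF[OF _ i] S' by auto
    then show "inv\<^bsub>BF \<Lambda> i\<^esub> a \<in> word_class \<Lambda> i ` S"
      using S f by (auto simp: admissible_words_def)
    fix b assume "b \<in> word_class \<Lambda> i ` S"
    then obtain g where g: "g \<in> S" "b = word_class \<Lambda> i g" by auto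
    have "f \<in> words \<Lambda>" "g \<in> words \<Lambda>" using f g S' by auto
    then show "a \<otimes>\<^bsub>BF \<Lambda> i\<^esub> b \<in> word_class \<Lambda> i ` S"
      using S f g by (auto simp: mult_BF admissible_words_def)
  qed (use S S' in \<open>auto simp: carrier_BF\<close>)
qed

lemma group_BF_sub:
  assumes "\<And>l. l \<in> \<Lambda> \<Longrightarrow> i l \<in> \<Lambda> \<and> i (i l) = l" "admissible_words \<Lambda> i S" "S \<noteq> {}"
  shows "group (BF_sub \<Lambda> i S)"
  unfolding BF_sub_def
  using subgroup.subgroup_is_group[OF subgroup_admissible[OF assms] group_BF[OF assms(1)]] by simp

lemma carrier_BF_sub: "carrier (BF_sub \<Lambda> i S) = word_class \<Lambda> i ` S"
  and one_BF_sub: "\<one>\<^bsub>BF_sub \<Lambda> i S\<^esub> = word_class \<Lambda> i word_empty"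
  by (simp_all add: BF_sub_def one_BF)

lemma mult_BF_sub:
  "f \<in> words \<Lambda> \<Longrightarrow> g \<in> words \<Lambda> \<Longrightarrow>
   word_class \<Lambda> i f \<otimes>\<^bsub>BF_sub \<Lambda> i S\<^esub> word_class \<Lambda> i g = word_class \<Lambda> i (word_concat f g)"
  by (simp add: BF_sub_def mult_BF)

lemma inv_BF_sub:
  assumes "\<And>l. l \<in> \<Lambda> \<Longrightarrow> i l \<in> \<Lambda> \<and> i (i l) = l" "admissible_words \<Lambda> i S" "f \<in> S"
  shows "inv\<^bsub>BF_sub \<Lambda> i S\<^esub> (word_class \<Lambda> i f) = word_class \<Lambda> i (word_inverse i f)"
proof -
  have f: "f \<in> words \<Lambda>" using assms by (auto simp: admissible_words_def)
  have "subgroup (word_class \<Lambda> i ` S) (BF \<Lambda> i)"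
    using assms by (intro subgroup_admissible) auto
  then show ?thesis
    unfolding BF_sub_def
    using group.m_inv_consistent[OF group_BF[OF assms(1)]] inv_BF[OF f assms(1)] assms(3) by simp
qed

lemma BF_proj_class:
  assumes f: "f \<in> words \<Lambda>" and A: "A \<subseteq> \<Lambda>" "\<And>l. l \<in> A \<Longrightarrow> i l \<in> A"
  shows "BF_proj A i (word_class \<Lambda> i f) = word_class A i (letter_restrict f A)"
proof -
  have "word_class A i (letter_restrict g A) =
      word_class A i (letter_restrict f A)" if "g \<in> word_class \<Lambda> i f" for g
    using word_classD(1)[OF that]
    by (rule word_equiv_invariant[symmetric])
      (rule word_class_cancels[OF word_restrict_words[OF _ A(1)] word_restrict_words[OF _ A(1)]
         cancels_restrict], use A(2) in auto)
  then show ?thesis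
    unfolding BF_proj_def by (intro UN_constant_eq[OF word_class_self[OF f]] ballI)
qed

lemma BF_proj_hom:
  assumes A: "A \<subseteq> \<Lambda>" "\<And>l. l \<in> A \<Longrightarrow> i l \<in> A" and S: "S \<subseteq> words \<Lambda>"
  shows "BF_proj A i \<in> hom (BF_sub \<Lambda> i S) (BF A i)"
proof (rule homI)
  fix a assume "a \<in> carrier (BF_sub \<Lambda> i S)"
  then obtain f where f: "f \<in> words \<Lambda>" "a = word_class \<Lambda> i f"
    using S by (auto simp: carrier_BF_sub)
  have rf: "letter_restrict f A \<in> words A"
    using f A by (intro word_restrict_words) auto
  then show "BF_proj A i a \<in> carrier (BF A i)"
    using BF_proj_class[OF f(1) A] f(2) by (simp add: carrier_BF)
  fix b assume "b \<in> carrier (BF_sub \<Lambda> i S)"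
  then obtain g where g: "g \<in> words \<Lambda>" "b = word_class \<Lambda> i g"
    using S by (auto simp: carrier_BF_sub)
  have rg: "letter_restrict g A \<in> words A"
    using g A by (intro word_restrict_words) auto
  have "letter_restrict (word_concat f g) A =
     word_concat (letter_restrict f A) (letter_restrict g A)"
    unfolding concat_restrict by (rule word_restrict_cong) (auto simp: pos_concat)
  then show "BF_proj A i (a \<otimes>\<^bsub>BF_sub \<Lambda> i S\<^esub> b) = BF_proj A i a \<otimes>\<^bsub>BF A i\<^esub> BF_proj A i b"
    using f g rf rg by (simp add: mult_BF_sub mult_BF BF_proj_class[OF _ A] concat_words)
qed

section \<open>Finite products of transpositions and their limits\<close>

section \<open>The action of finite sets of positions\<close>

definition letter_act :: "'a \<times> 'a \<Rightarrow> 'a \<Rightarrow> 'a" where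
  "letter_act l = Transposition.transpose (fst l) (snd l)"

definition letters_on :: "('s, 'l) lword \<Rightarrow> 's set \<Rightarrow> 'l list" where
  "letters_on f F = map (letter f) (enum_by (ord_rel f) F)"

text \<open>As \<open>fold\<close> runs from left to right, the lowest position acts first;
  concatenation therefore becomes a right action.\<close>

definition word_act :: "('s, 'a \<times> 'a) lword \<Rightarrow> 's set \<Rightarrow> 'a \<Rightarrow> 'a" where
  "word_act f F = fold letter_act (letters_on f F)"

lemma letter_act_swap [simp]: "letter_act (prod.swap l) = letter_act l"
  by (simp add: letter_act_def transpose_commute)

lemma letter_act_letter_act [simp]: "letter_act l (letter_act l x) = x"
  by (simp add: letter_act_def)

lemma letter_act_other: "x \<notin> {fst l, snd l} \<Longrightarrow> letter_act l x = x"
  by (simp add: letter_act_def)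

lemma letter_act_other_end: "x \<in> {fst l, snd l} \<Longrightarrow> letter_act l x = other_end l x"
  by (auto simp: letter_act_def other_end_def)

lemma fold_letter_act_fixed:
  "(\<And>l. l \<in> set ls \<Longrightarrow> x \<notin> {fst l, snd l}) \<Longrightarrow> fold letter_act ls x = x"
proof (induction ls)
  case (Cons l ls)
  then show ?case using letter_act_other[of x l] by simp
qed simp

lemma word_act_Un:
  assumes "linear_word f" "finite F" "F \<subseteq> pos f" "finite G" "G \<subseteq> pos f"
    and "\<And>s t. s \<in> F \<Longrightarrow> t \<in> G \<Longrightarrow> (s, t) \<in> ord_rel f \<and> s \<noteq> t"
  shows "word_act f (F \<union> G) x = word_act f G (word_act f F x)"
  using enum_by_append[OF assms] by (simp add: word_act_def letters_on_def)

lemma word_act_empty: "linear_word f \<Longrightarrow> word_act f {} x = x"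
  by (simp add: word_act_def letters_on_def enum_by_empty order_on_defs)

lemma word_act_singleton:
  "linear_word f \<Longrightarrow> word_act f {s} x = letter_act (letter f s) x"
  by (simp add: word_act_def letters_on_def enum_by_singleton order_on_defs)

lemma word_act_fixed:
  assumes "linear_word f" "finite F" "F \<subseteq> pos f" "F \<inter> occurrences x f = {}"
  shows "word_act f F x = x"
  unfolding word_act_def letters_on_def
  by (rule fold_letter_act_fixed)
    (use assms set_enum_by[OF assms(1-3)] in \<open>auto simp: occurrences_def\<close>)

text \<open>A monotone injection carries the sorted enumeration of \<open>F\<close> to that of its
  image. Stated for maps on \<open>F\<close> only, it covers isomorphisms, restrictions and the two
  embeddings into a concatenation alike.\<close>

lemma letters_on_embed:
  assumes f: "linear_word f" and g: "antisym (ord_rel g)"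
    and F: "finite F" "F \<subseteq> pos f" and inj: "inj_on \<phi> F"
    and ord: "\<And>s t. s \<in> F \<Longrightarrow> t \<in> F \<Longrightarrow> (s, t) \<in> ord_rel f \<Longrightarrow> (\<phi> s, \<phi> t) \<in> ord_rel g"
    and let_eq: "\<And>s. s \<in> F \<Longrightarrow> letter g (\<phi> s) = letter f s"
  shows "letters_on g (\<phi> ` F) = letters_on f F"
proof -
  let ?xs = "enum_by (ord_rel f) F"
  have xs: "set ?xs = F" by (rule set_enum_by[OF f F])
  have "sorted_wrt (\<lambda>s t. (\<phi> s, \<phi> t) \<in> ord_rel g \<and> \<phi> s \<noteq> \<phi> t) ?xs"
    using sorted_enum_by[OF f F]
    by (rule sorted_wrt_mono_rel[rotated]) (use ord inj xs in \<open>auto dest: inj_onD\<close>)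
  then have "enum_by (ord_rel g) (\<phi> ` F) = map \<phi> ?xs"
    using xs by (intro enum_by_eqI[OF g]) (simp_all add: sorted_wrt_map)
  then show ?thesis using xs let_eq by (simp add: letters_on_def)
qed

lemma letters_on_restrict:
  assumes f: "linear_word f" and F: "finite F" "F \<subseteq> pos f \<inter> P"
  shows "letters_on (word_restrict f P) F = letters_on f F"
proof -
  have "letters_on f (id ` F) = letters_on (word_restrict f P) F"
    by (rule letters_on_embed) (use F f word_restrict_linear[OF f, of P] in \<open>auto simp: order_on_defs\<close>)
  then show ?thesis by simp
qed

lemma word_act_restrict:
  assumes "linear_word f" "finite F" "F \<subseteq> pos f \<inter> P"
  shows "word_act (word_restrict f P) F = word_act f F"
  unfolding word_act_def letters_on_restrict[OF assms] ..

text \<open>A cancelling pair enclosing as few positions as possible is adjacent.\<close>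

lemma adjacent_cancelling_pair:
  assumes f: "linear_word f" and fin: "finite (pos f)"
    and c: "cancelling i f T star" and T: "T \<noteq> {}"
  shows "\<exists>t\<in>T. (t, star t) \<in> ord_rel f \<and> word_interval f t (star t) \<subseteq> {t, star t}"
proof -
  have tot: "total_on (pos f) (ord_rel f)" and re: "refl_on (pos f) (ord_rel f)"
    and tr: "trans (ord_rel f)" and an: "antisym (ord_rel f)"
    using f by (auto simp: order_on_defs)
  let ?I = "\<lambda>t. word_interval f t (star t)"
  have orient: "(t, star t) \<in> ord_rel f \<or> (star t, t) \<in> ord_rel f" if "t \<in> T" for t
    using tot re cancellingD(1,2)[OF c] that unfolding total_on_def refl_on_def by metis
  \<comment> \<open>Only pairs with \<open>t\<close> below \<open>star t\<close> are compared: if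
    \<open>star t\<close> is strictly below \<open>t\<close>, the interval is empty and would be a
    spurious minimum.\<close>
  let ?D = "{t \<in> T. (t, star t) \<in> ord_rel f}"
  obtain t0 where "t0 \<in> ?D"
    using T orient cancellingD(2,3)[OF c] by fastforce
  then obtain t where t: "t \<in> ?D" and min: "\<And>s. s \<in> ?D \<Longrightarrow> card (?I t) \<le> card (?I s)"
    using ex_has_least_nat[of "\<lambda>t. t \<in> ?D" t0 "\<lambda>t. card (?I t)"] by blast
  have finI: "finite (?I s)" for s using fin by (simp add: word_interval_def)
  have "?I t \<subseteq> {t, star t}"
  proof (rule ccontr)
    assume "\<not> ?I t \<subseteq> {t, star t}"
    then obtain u where u: "u \<in> ?I t" "u \<noteq> t" "u \<noteq> star t" by auto
    have tT: "t \<in> T" using t by simp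
    have uT: "u \<in> T" using cancellingD(5)[OF c tT] u(1) by auto
    have us: "star u \<in> ?I t" "star u \<noteq> t" "star (star u) = u"
      using cancellingD(6)[OF c tT u(1)] u cancellingD(3)[OF c] tT uT by auto
    \<comment> \<open>\<open>v\<close> is the lower one of \<open>u\<close> and
      \<open>star u\<close>. Its interval lies in that of \<open>t\<close> but misses
      \<open>t\<close>, against minimality.\<close>
    obtain v where v: "v \<in> ?D" "v \<in> ?I t" "star v \<in> ?I t" "v \<noteq> t"
      using orient[OF uT] that[of u] that[of "star u"] u us uT cancellingD(2)[OF c uT] by auto
    have "?I v \<subseteq> ?I t" using v(2,3) tr by (auto simp: word_interval_def dest: transD)
    moreover have "t \<notin> ?I v" "t \<in> ?I t"
      using v an t re cancellingD(1)[OF c tT]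
      by (auto simp: word_interval_def refl_on_def dest: antisymD)
    ultimately have "card (?I v) < card (?I t)" using finI by (metis psubsetI psubset_card_mono)
    then show False using min[OF v(1)] by simp
  qed
  then show ?thesis using t by auto
qed

text \<open>The positions split into those before the pair, the pair, and those after it. Both
  letters of the pair are the same transposition, so the middle factor is the identity.\<close>

lemma word_act_remove_adjacent:
  assumes f: "linear_word f" and fin: "finite (pos f)"
    and t: "t \<in> pos f" "t' \<in> pos f" "t \<noteq> t'" "(t, t') \<in> ord_rel f"
    and adj: "word_interval f t t' \<subseteq> {t, t'}" and let_eq: "letter f t' = prod.swap (letter f t)"
  shows "word_act f (pos f) x = word_act f (pos f - {t, t'}) x"
proof -
  have tot: "total_on (pos f) (ord_rel f)" and re: "refl_on (pos f) (ord_rel f)"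
    and tr: "trans (ord_rel f)" and an: "antisym (ord_rel f)"
    using f by (auto simp: order_on_defs)
  let ?A = "{s \<in> pos f. (s, t) \<in> ord_rel f \<and> s \<noteq> t}" and ?B = "{s \<in> pos f. (t', s) \<in> ord_rel f \<and> s \<noteq> t'}"
  have AB: "(s, u) \<in> ord_rel f \<and> s \<noteq> u" if "s \<in> ?A" "u \<in> ?B" for s u
    using that t tr an by (auto dest: transD antisymD)
  have At: "(s, t') \<in> ord_rel f \<and> s \<noteq> t'" if "s \<in> ?A" for s
    using that t tr an by (auto dest: transD antisymD)
  have tB: "(t, s) \<in> ord_rel f \<and> t \<noteq> s" if "s \<in> ?B" for s
    using that t tr an by (auto dest: transD antisymD)
  have eq: "pos f = (?A \<union> ({t} \<union> {t'})) \<union> ?B"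
  proof
    show "pos f \<subseteq> (?A \<union> ({t} \<union> {t'})) \<union> ?B"
    proof
      fix s assume s: "s \<in> pos f"
      show "s \<in> (?A \<union> ({t} \<union> {t'})) \<union> ?B"
      proof (rule ccontr)
        assume "s \<notin> (?A \<union> ({t} \<union> {t'})) \<union> ?B"
        then have "(t, s) \<in> ord_rel f" "(s, t') \<in> ord_rel f" "s \<noteq> t" "s \<noteq> t'"
          using s t(1,2) tot by (auto simp: total_on_def)
        then show False using adj s by (auto simp: word_interval_def)
      qed
    qed
  qed (use t in auto)
  define A B where "A = ?A" and "B = ?B"
  have sub: "finite A" "A \<subseteq> pos f" "finite B" "B \<subseteq> pos f"
    using fin by (auto simp: A_def B_def)
  have eq': "pos f = (A \<union> ({t} \<union> {t'})) \<union> B" unfolding A_def B_def by (rule eq)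
  have At: "(s, t') \<in> ord_rel f \<and> s \<noteq> t'" "(s, t) \<in> ord_rel f \<and> s \<noteq> t" if "s \<in> A" for s
    using At that by (auto simp: A_def)
  have tB: "(t, s) \<in> ord_rel f \<and> t \<noteq> s" "(t', s) \<in> ord_rel f \<and> t' \<noteq> s" if "s \<in> B" for s
    using tB that by (auto simp: B_def)
  have AB: "(s, u) \<in> ord_rel f \<and> s \<noteq> u" if "s \<in> A" "u \<in> B" for s u
    using AB[of s u] that unfolding A_def B_def by blast
  have notin: "t \<notin> A" "t' \<notin> A" "t \<notin> B" "t' \<notin> B" using At tB by blast+
  then have "pos f - {t, t'} = A \<union> B"
    using eq' by auto
  then have "word_act f (pos f - {t, t'}) x = word_act f (A \<union> B) x" by simp
  also have "\<dots> = word_act f B (word_act f A x)"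
    by (rule word_act_Un[OF f sub AB])
  also have "word_act f A x = word_act f ({t} \<union> {t'}) (word_act f A x)" for x
    using t let_eq by (subst word_act_Un[OF f]) (simp_all add: word_act_singleton[OF f])
  also have "word_act f ({t} \<union> {t'}) (word_act f A x) = word_act f (A \<union> ({t} \<union> {t'})) x"
    by (rule word_act_Un[OF f sub(1,2), symmetric]) (use t At in auto)
  also have "word_act f B (word_act f (A \<union> ({t} \<union> {t'})) x) = word_act f ((A \<union> ({t} \<union> {t'})) \<union> B) x"
    by (rule word_act_Un[OF f _ _ sub(3,4), symmetric]) (use sub t AB tB notin in auto)
  also have "\<dots> = word_act f (pos f) x"
    by (rule arg_cong[where f = "\<lambda>F. word_act f F x", OF eq'[symmetric]])
  finally show ?thesis by simp
qed

text \<open>Removing an adjacent pair leaves a cancellation of the shorter word, so in a finite word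
  the pairs can be removed successively without changing the product.\<close>

lemma word_act_cancelling:
  assumes "linear_word f" "finite (pos f)" "cancelling prod.swap f T star"
    and "\<And>s. s \<in> pos f \<Longrightarrow> fst (letter f s) \<noteq> snd (letter f s)"
  shows "word_act f (pos f) x = word_act f (pos f - T) x"
  using assms
proof (induction "card T" arbitrary: f T rule: less_induct)
  case less
  note f = less.prems(1) and fin = less.prems(2) and c = less.prems(3)
  show ?case
  proof (cases "T = {}")
    case False
    obtain t where t: "t \<in> T" "(t, star t) \<in> ord_rel f" "word_interval f t (star t) \<subseteq> {t, star t}"
      using adjacent_cancelling_pair[OF f fin c False] by blast
    note D = cancellingD[OF c t(1)]
    \<comment> \<open>A position paired with itself would carry a letter equal to its own swap,
      hence with equal ends.\<close>
    have ne: "t \<noteq> star t"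
      using less.prems(4)[OF D(1)] D(4) by (metis fst_swap)
    have pos': "star t \<in> pos f" using cancellingD(1)[OF c D(2)] .
    let ?P = "pos f - {t, star t}"
    have TP: "T \<inter> ?P = T - {t, star t}" using cancellingD(1)[OF c] by auto
    have "star s \<in> ?P" if "s \<in> T \<inter> ?P" for s
      using that D(3) cancellingD(3)[OF c, of s] cancellingD(1)[OF c cancellingD(2)[OF c, of s]] by auto
    then have c': "cancelling prod.swap (word_restrict f ?P) (T - {t, star t}) star"
      using cancelling_restrict[OF c, of ?P] TP by simp
    have "finite T" using fin c by (auto intro: finite_subset simp: cancelling_def)
    then have "card (T - {t, star t}) < card T" using t(1) by (intro psubset_card_mono) auto
    then have "word_act (word_restrict f ?P) (pos (word_restrict f ?P)) x =
        word_act (word_restrict f ?P) (pos (word_restrict f ?P) - (T - {t, star t})) x"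
      by (rule less.hyps) (use c' fin less.prems(4) word_restrict_linear[OF f] in auto)
    then have "word_act f ?P x = word_act f (?P - (T - {t, star t})) x"
      using fin by (simp add: word_act_restrict[OF f] Int_absorb1 Diff_subset)
    also have "?P - (T - {t, star t}) = pos f - T" using t(1) D(2) by auto
    also have "word_act f ?P x = word_act f (pos f) x"
      using word_act_remove_adjacent[OF f fin D(1) pos' ne t(2,3) D(4)] by simp
    finally show ?thesis .
  qed simp
qed

section \<open>The limit action\<close>

text \<open>On \<open>S0 X\<close> this is equivalent to the finiteness of the upward sequence from \<open>x\<close>, and then \<open>y\<close> is
  its last element (see \<open>n_plus_finite_iff\<close> and \<open>x_infinity_eqI\<close> below). Unlike that sequence, it
  behaves well under cancellation.\<close>

definition word_lim :: "('s, 'a \<times> 'a) lword \<Rightarrow> 'a \<Rightarrow> 'a \<Rightarrow> bool" where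
  "word_lim f x y \<longleftrightarrow> (\<exists>P. finite P \<and> P \<subseteq> pos f \<and>
     (\<forall>F. finite F \<longrightarrow> P \<subseteq> F \<longrightarrow> F \<subseteq> pos f \<longrightarrow> word_act f F x = y))"

lemma word_limE:
  assumes "word_lim f x y"
  obtains P where "finite P" "P \<subseteq> pos f"
    "\<And>F. finite F \<Longrightarrow> P \<subseteq> F \<Longrightarrow> F \<subseteq> pos f \<Longrightarrow> word_act f F x = y"
  using assms unfolding word_lim_def by blast

lemma word_limI:
  assumes "finite P" "P \<subseteq> pos f"
    "\<And>F. finite F \<Longrightarrow> P \<subseteq> F \<Longrightarrow> F \<subseteq> pos f \<Longrightarrow> word_act f F x = y"
  shows "word_lim f x y"
  using assms unfolding word_lim_def by blast

lemma word_lim_unique: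
  assumes "word_lim f x y" "word_lim f x z" shows "y = z"
proof -
  obtain P where P: "finite P" "P \<subseteq> pos f"
    "\<And>F. finite F \<Longrightarrow> P \<subseteq> F \<Longrightarrow> F \<subseteq> pos f \<Longrightarrow> word_act f F x = y"
    using assms(1) by (elim word_limE) blast
  obtain Q where Q: "finite Q" "Q \<subseteq> pos f"
    "\<And>F. finite F \<Longrightarrow> Q \<subseteq> F \<Longrightarrow> F \<subseteq> pos f \<Longrightarrow> word_act f F x = z"
    using assms(2) by (elim word_limE) blast
  show ?thesis using P(3)[of "P \<union> Q"] Q(3)[of "P \<union> Q"] P(1,2) Q(1,2) by simp
qed

lemma word_lim_finite: "finite (pos f) \<Longrightarrow> word_lim f x (word_act f (pos f) x)"
  by (rule word_limI[of "pos f"]) auto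

lemma word_lim_fixed:
  assumes "linear_word f" "occurrences x f = {}"
  shows "word_lim f x x"
  by (rule word_limI[of "{}"]) (use assms in \<open>auto intro: word_act_fixed\<close>)

lemma word_lim_iso:
  assumes f: "linear_word f" and g: "linear_word g"
    and iso: "word_iso f g" and lim: "word_lim f x y"
  shows "word_lim g x y"
proof -
  obtain \<phi> where bij: "bij_betw \<phi> (pos f) (pos g)"
    and ord: "\<And>s t. s \<in> pos f \<Longrightarrow> t \<in> pos f \<Longrightarrow> (s, t) \<in> ord_rel f \<longleftrightarrow> (\<phi> s, \<phi> t) \<in> ord_rel g"
    and let_eq: "\<And>s. s \<in> pos f \<Longrightarrow> letter f s = letter g (\<phi> s)"
    using iso by (auto simp: word_iso_def)
  obtain P where P: "finite P" "P \<subseteq> pos f"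
    "\<And>F. finite F \<Longrightarrow> P \<subseteq> F \<Longrightarrow> F \<subseteq> pos f \<Longrightarrow> word_act f F x = y"
    using lim by (elim word_limE) blast
  show ?thesis
  proof (rule word_limI[of "\<phi> ` P"])
    show "finite (\<phi> ` P)" "\<phi> ` P \<subseteq> pos g" using P bij by (auto simp: bij_betw_def)
    fix F assume F: "finite F" "\<phi> ` P \<subseteq> F" "F \<subseteq> pos g"
    let ?F = "{s \<in> pos f. \<phi> s \<in> F}"
    have im: "\<phi> ` ?F = F" using F(3) bij by (auto simp: bij_betw_def)
    have inj: "inj_on \<phi> ?F" using bij by (auto simp: bij_betw_def inj_on_def)
    have fin: "finite ?F" using F(1) im inj by (metis finite_imageD)
    have "letters_on g (\<phi> ` ?F) = letters_on f ?F"
      by (rule letters_on_embed[OF f _ fin _ inj])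
        (use g ord let_eq in \<open>auto simp: order_on_defs\<close>)
    then have "word_act g F x = word_act f ?F x" unfolding im word_act_def by simp
    also have "\<dots> = y" using P F fin by (intro P(3)) auto
    finally show "word_act g F x = y" .
  qed
qed

lemma word_lim_cancelling:
  assumes f: "linear_word f" and c: "cancelling prod.swap f T star"
    and ne: "\<And>s. s \<in> pos f \<Longrightarrow> fst (letter f s) \<noteq> snd (letter f s)" and lim: "word_lim f x y"
  shows "word_lim (word_restrict f (pos f - T)) x y"
proof -
  obtain P where P: "finite P" "P \<subseteq> pos f"
    "\<And>F. finite F \<Longrightarrow> P \<subseteq> F \<Longrightarrow> F \<subseteq> pos f \<Longrightarrow> word_act f F x = y"
    using lim by (elim word_limE) blast
  let ?g = "word_restrict f (pos f - T)"
  show ?thesis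
  proof (rule word_limI[of "P - T"])
    fix F assume F: "finite F" "P - T \<subseteq> F" "F \<subseteq> pos ?g"
    \<comment> \<open>The smallest \<open>star\<close>-closed set containing what \<open>P\<close>
      has in \<open>T\<close>. Adding it to \<open>F\<close> makes the hypothesis on
      \<open>P\<close> applicable, and cancelling it again leaves exactly \<open>F\<close>.\<close>
    let ?Q = "(P \<inter> T) \<union> star ` (P \<inter> T)"
    let ?F = "F \<union> ?Q"
    have Q: "?Q \<subseteq> T" "?Q \<subseteq> pos f" using cancellingD(1,2)[OF c] by auto
    have F': "finite ?F" "?F \<subseteq> pos f" "P \<subseteq> ?F" using F P(1) Q by auto
    have TF: "T \<inter> ?F = ?Q" using Q(1) F(3) by auto
    have "cancelling prod.swap (word_restrict f ?F) (T \<inter> ?F) star"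
      by (rule cancelling_restrict[OF c]) (use TF cancellingD(3)[OF c] in auto)
    then have c': "cancelling prod.swap (word_restrict f ?F) ?Q star" unfolding TF .
    have pos': "pos (word_restrict f ?F) = ?F" using F' by auto
    have "word_act (word_restrict f ?F) (pos (word_restrict f ?F)) x =
        word_act (word_restrict f ?F) (pos (word_restrict f ?F) - ?Q) x"
      by (rule word_act_cancelling[OF word_restrict_linear[OF f] _ c']) (use pos' F' ne in auto)
    moreover have "?F - ?Q = F" using Q(1) F(3) by auto
    ultimately have "word_act f ?F x = word_act f F x"
      unfolding pos' using F' F by (simp add: word_act_restrict[OF f])
    moreover have "word_act ?g F x = word_act f F x"
      using F by (subst word_act_restrict[OF f]) auto
    ultimately show "word_act ?g F x = y" using P(3)[OF F'(1,3,2)] by simp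
  qed (use P in auto)
qed

lemma word_lim_cancels:
  assumes f: "linear_word f" and g: "linear_word g"
    and "cancels prod.swap f g"
    and "\<And>s. s \<in> pos f \<Longrightarrow> fst (letter f s) \<noteq> snd (letter f s)" and "word_lim f x y"
  shows "word_lim g x y"
proof -
  obtain T star where c: "cancelling prod.swap f T star" and iso: "word_iso g (word_restrict f (pos f - T))"
    using assms(3) by (auto simp: cancels_iff)
  show ?thesis
    by (rule word_lim_iso[OF word_restrict_linear[OF f] g word_iso_sym[OF iso]
          word_lim_cancelling[OF f c assms(4,5)]])
qed

text \<open>A finite set of positions is a left part followed by a right part. The left part takes
  \<open>x\<close> to \<open>y\<close>, so the threshold for the right part is the one belonging to
  \<open>y\<close>.\<close>

lemma word_lim_concat:
  assumes f: "linear_word f" and g: "linear_word g"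
    and "word_lim f x y" "word_lim g y z"
  shows "word_lim (word_concat f g) x z"
proof -
  obtain P where P: "finite P" "P \<subseteq> pos f"
    "\<And>F. finite F \<Longrightarrow> P \<subseteq> F \<Longrightarrow> F \<subseteq> pos f \<Longrightarrow> word_act f F x = y"
    using assms(3) by (elim word_limE) blast
  obtain Q where Q: "finite Q" "Q \<subseteq> pos g"
    "\<And>F. finite F \<Longrightarrow> Q \<subseteq> F \<Longrightarrow> F \<subseteq> pos g \<Longrightarrow> word_act g F y = z"
    using assms(4) by (elim word_limE) blast
  let ?h = "word_concat f g"
  have h: "linear_word ?h" by (rule concat_linear[OF f g])
  then have an: "antisym (ord_rel ?h)" by (simp add: order_on_defs)
  show ?thesis
  proof (rule word_limI[of "left_copy ` P \<union> right_copy ` Q"])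
    fix F assume F: "finite F" "left_copy ` P \<union> right_copy ` Q \<subseteq> F" "F \<subseteq> pos ?h"
    define A where "A = {s \<in> pos f. left_copy s \<in> F}"
    define B where "B = {s \<in> pos g. right_copy s \<in> F}"
    have eq: "F = left_copy ` A \<union> right_copy ` B"
      using F(3) unfolding A_def B_def by (auto simp: pos_concat)
    have finA: "finite A" and finB: "finite B"
      using F(1) eq finite_imageD[of left_copy A] finite_imageD[of right_copy B]
      by (auto simp: inj_on_def)
    have AB: "A \<subseteq> pos f" "B \<subseteq> pos g" "P \<subseteq> A" "Q \<subseteq> B"
      using F(2) P(2) Q(2) by (auto simp: A_def B_def)
    have actA: "word_act ?h (left_copy ` A) = word_act f A"
      unfolding word_act_def
      by (subst letters_on_embed[OF f an finA AB(1)]) (auto simp: inj_on_def)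
    have actB: "word_act ?h (right_copy ` B) = word_act g B"
      unfolding word_act_def
      by (subst letters_on_embed[OF g an finB AB(2)]) (auto simp: inj_on_def)
    have "word_act ?h F x = word_act ?h (right_copy ` B) (word_act ?h (left_copy ` A) x)"
      unfolding eq using AB finA finB by (intro word_act_Un[OF h]) auto
    also have "\<dots> = z" unfolding actA actB using P(3)[OF finA AB(3,1)] Q(3)[OF finB AB(4,2)] by simp
    finally show "word_act ?h F x = z" .
  qed (use P Q in auto)
qed

section \<open>The limit action and the sequences of the definition\<close>

text \<open>The option is the position last read by the sequence. Before the first step nothing has
  been read, so with \<open>None\<close> every position is still to come and, in
  \<open>up_to\<close>, none is behind.\<close>

definition follows :: "'s rel \<Rightarrow> 's option \<Rightarrow> 's \<Rightarrow> bool" where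
  "follows r q t = (case q of None \<Rightarrow> True | Some s \<Rightarrow> (s, t) \<in> r \<and> t \<noteq> s)"

definition up_to :: "'s rel \<Rightarrow> 's option \<Rightarrow> 's \<Rightarrow> bool" where
  "up_to r q t = (case q of None \<Rightarrow> False | Some s \<Rightarrow> (t, s) \<in> r)"

text \<open>With \<open>follows\<close> the first step and the later steps obey the same recursion,
  which spares a case distinction in each induction.\<close>

lemma track_Suc:
  assumes "track r f x n = Some (y, q)"
  shows "track r f x (Suc n) =
    (if \<exists>t. is_least r {t \<in> occurrences y f. follows r q t} t
     then let t = (THE t. is_least r {t \<in> occurrences y f. follows r q t} t)
          in Some (other_end (letter f t) y, Some t)
     else None)"
  using assms by (cases q) (simp_all add: follows_def Let_def)

lemma track_SucE:
  assumes an: "antisym r" and tr: "track r f x (Suc n) = Some (z, q')"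
  obtains y q t where "track r f x n = Some (y, q)"
    "is_least r {t \<in> occurrences y f. follows r q t} t" "z = other_end (letter f t) y" "q' = Some t"
proof -
  obtain y q where yq: "track r f x n = Some (y, q)"
    using tr by (cases "track r f x n") auto
  let ?L = "is_least r {t \<in> occurrences y f. follows r q t}"
  obtain t where t: "?L t"
    using tr track_Suc[OF yq] by (auto split: if_splits)
  then have "(THE t. ?L t) = t"
    using an by (intro the_equality) (auto simp: is_least_def dest: antisymD)
  moreover have "\<exists>t. ?L t" using t by blast
  ultimately have "track r f x (Suc n) = Some (other_end (letter f t) y, Some t)"
    using track_Suc[OF yq] by (simp add: Let_def del: track.simps)
  then show ?thesis using that[OF yq t] tr by simp
qed

definition track_positions :: "'s rel \<Rightarrow> ('s, 'a \<times> 'a) lword \<Rightarrow> 'a \<Rightarrow> nat \<Rightarrow> 's set" where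
  "track_positions r f x n = {s. \<exists>m\<le>n. \<exists>y. track r f x m = Some (y, Some s)}"

lemma finite_track_positions: "finite (track_positions r f x n)"
proof -
  have "track_positions r f x n \<subseteq> (\<lambda>m. the (snd (the (track r f x m)))) ` {..n}"
    by (force simp: track_positions_def)
  then show ?thesis by (rule finite_subset) simp
qed

lemma track_positions_pos:
  assumes "antisym r" shows "track_positions r f x n \<subseteq> pos f"
proof
  fix s assume "s \<in> track_positions r f x n"
  then obtain m y where m: "track r f x m = Some (y, Some s)" by (auto simp: track_positions_def)
  then obtain k where "m = Suc k" by (cases m) auto
  then show "s \<in> pos f"
    using track_SucE[OF assms, of f x k y "Some s"] m
    by (auto simp: is_least_def occurrences_def)
qed

lemma track_occurrence:
  assumes "antisym r" "track r f x (Suc n) = Some (y, Some s)" shows "s \<in> occurrences y f"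
  using assms(2) by (rule track_SucE[OF assms(1)])
    (auto simp: is_least_def occurrences_def other_end_def)

lemma up_to_or_follows:
  assumes f: "linear_word f" and "track (ord_rel f) f x n = Some (y, q)" "s \<in> pos f"
  shows "up_to (ord_rel f) q s \<or> follows (ord_rel f) q s"
proof (cases q)
  case (Some s0)
  have tot: "total_on (pos f) (ord_rel f)" and re: "refl_on (pos f) (ord_rel f)" and an: "antisym (ord_rel f)"
    using f by (auto simp: order_on_defs)
  have "s0 \<in> pos f"
    using track_positions_pos[OF an, of f x n] assms(2) Some by (auto simp: track_positions_def)
  then have "(s, s0) \<in> ord_rel f \<or> (s0, s) \<in> ord_rel f \<and> s \<noteq> s0"
    using tot re assms(3) unfolding total_on_def refl_on_def by (cases "s = s0") auto
  then show ?thesis using Some by (simp add: up_to_def follows_def)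
qed (simp add: follows_def)

text \<open>Between two successive positions of the sequence the current point does not occur, so
  whatever else \<open>F\<close> contains there leaves it in place. Hence any finite
  \<open>F\<close> that includes the visited positions reproduces the sequence.\<close>

lemma word_act_track:
  assumes f: "linear_word f"
    and "track (ord_rel f) f x n = Some (y, q)"
    and F: "finite F" "F \<subseteq> pos f" and "track_positions (ord_rel f) f x n \<subseteq> F"
  shows "word_act f {s \<in> F. up_to (ord_rel f) q s} x = y"
  using assms(2,5)
proof (induction n arbitrary: y q)
  case 0
  then show ?case using f by (simp add: up_to_def word_act_empty)
next
  case (Suc n z q')
  let ?r = "ord_rel f"
  have re: "refl_on (pos f) ?r" and tr: "trans ?r" and an: "antisym ?r"
    using f by (auto simp: order_on_defs)
  obtain y q t where y: "track ?r f x n = Some (y, q)"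
    and t: "is_least ?r {t \<in> occurrences y f. follows ?r q t} t"
    and z: "z = other_end (letter f t) y" and q': "q' = Some t"
    using track_SucE[OF an Suc.prems(1)] by metis
  have tF: "t \<in> F" using Suc.prems q' unfolding track_positions_def by blast
  have tfol: "follows ?r q t" and tocc: "t \<in> occurrences y f" using t by (auto simp: is_least_def)
  \<comment> \<open>\<open>?B\<close> is the part of \<open>F\<close> already passed and
    \<open>?M\<close> the part strictly between the last position and \<open>t\<close>. Since
    \<open>t\<close> is the least later occurrence of \<open>y\<close>, no position of
    \<open>?M\<close> moves \<open>y\<close>.\<close>
  let ?B = "{s \<in> F. up_to ?r q s}" and ?M = "{s \<in> F. follows ?r q s \<and> (s, t) \<in> ?r \<and> s \<noteq> t}"
  have IH: "word_act f ?B x = y"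
  proof (rule Suc.IH[OF y])
    have "track_positions ?r f x n \<subseteq> track_positions ?r f x (Suc n)"
      unfolding track_positions_def using le_SucI by blast
    then show "track_positions ?r f x n \<subseteq> F" using Suc.prems(2) by simp
  qed
  have dich: "up_to ?r q s \<or> follows ?r q s" if "s \<in> F" for s
    using up_to_or_follows[OF f y] that F(2) by auto
  have Bt: "(s, t) \<in> ?r \<and> s \<noteq> t" if "s \<in> ?B" for s
    using that tfol an tr
    by (auto simp: up_to_def follows_def split: option.splits dest: transD antisymD)
  have BM: "(s, u) \<in> ?r \<and> s \<noteq> u" if "s \<in> ?B" "u \<in> ?M" for s u
    using that an tr
    by (auto simp: up_to_def follows_def split: option.splits dest: transD antisymD)
  have eq: "{s \<in> F. up_to ?r q' s} = (?B \<union> ?M) \<union> {t}"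
    using dich Bt tF re F(2) q' by (auto simp: up_to_def refl_on_def)
  have "word_act f ?M y = y"
    by (rule word_act_fixed[OF f])
      (use t an F in \<open>auto simp: is_least_def dest: antisymD\<close>)
  then have "word_act f (?B \<union> ?M) x = y"
    using IH F BM by (subst word_act_Un[OF f]) auto
  then have "word_act f {s \<in> F. up_to ?r q' s} x = letter_act (letter f t) y"
    unfolding eq using F tF Bt by (subst word_act_Un[OF f]) (auto simp: word_act_singleton[OF f])
  also have "\<dots> = z"
    using tocc z by (simp add: letter_act_other_end occurrences_def)
  finally show ?case .
qed

text \<open>Only the positions in \<open>F\<close> must avoid the current point afterwards. This
  covers the end of a finite sequence, where no later occurrence exists, and also intermediate
  stages of an infinite one for suitable \<open>F\<close>.\<close>

lemma word_act_track_rest: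
  assumes f: "linear_word f"
    and tr: "track (ord_rel f) f x n = Some (y, q)"
    and F: "finite F" "F \<subseteq> pos f" "track_positions (ord_rel f) f x n \<subseteq> F"
    and rest: "\<And>s. s \<in> F \<Longrightarrow> follows (ord_rel f) q s \<Longrightarrow> s \<notin> occurrences y f"
  shows "word_act f F x = y"
proof -
  let ?r = "ord_rel f"
  have trr: "trans ?r" and an: "antisym ?r"
    using f by (auto simp: order_on_defs)
  let ?B = "{s \<in> F. up_to ?r q s}" and ?M = "{s \<in> F. follows ?r q s}"
  have dich: "up_to ?r q s \<or> follows ?r q s" if "s \<in> F" for s
    using up_to_or_follows[OF f tr] that F(2) by auto
  have BM: "(s, u) \<in> ?r \<and> s \<noteq> u" if "s \<in> ?B" "u \<in> ?M" for s u
    using that an trr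
    by (auto simp: up_to_def follows_def split: option.splits dest: transD antisymD)
  have eq: "F = ?B \<union> ?M" using dich by auto
  have "word_act f F x = word_act f (?B \<union> ?M) x"
    by (rule arg_cong[where f = "\<lambda>F. word_act f F x", OF eq])
  also have "\<dots> = word_act f ?M (word_act f ?B x)"
    by (rule word_act_Un[OF f _ _ _ _ BM]) (use F in auto)
  also have "word_act f ?B x = y" by (rule word_act_track[OF f tr F])
  also have "word_act f ?M y = y" by (rule word_act_fixed[OF f]) (use F rest in auto)
  finally show ?thesis .
qed

text \<open>A sequence stops when there is no least later occurrence; as occurrences are finite in
  number, there is then no later occurrence at all. The visited positions serve as
  threshold.\<close>

lemma word_lim_track_end:
  assumes f: "linear_word f" and fin: "\<And>z. finite (occurrences z f)"
    and tr: "track (ord_rel f) f x n = Some (y, q)" and stop: "track (ord_rel f) f x (Suc n) = None"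
  shows "word_lim f x y"
proof -
  have an: "antisym (ord_rel f)" using f by (simp add: order_on_defs)
  let ?O = "{t \<in> occurrences y f. follows (ord_rel f) q t}"
  have O: "?O = {}"
  proof (rule ccontr)
    assume "?O \<noteq> {}"
    then have "\<exists>t\<in>?O. \<forall>s\<in>?O. (t, s) \<in> ord_rel f"
      by (intro finite_has_least[OF f] finite_subset[OF _ fin[of y]]) (auto simp: occurrences_def)
    then have "\<exists>t. is_least (ord_rel f) ?O t" by (auto simp: is_least_def)
    then show False using stop track_Suc[OF tr] by (simp add: Let_def del: track.simps)
  qed
  show ?thesis
    by (rule word_limI[OF finite_track_positions track_positions_pos[OF an]],
        rule word_act_track_rest[OF f tr]) (use O in auto)
qed

text \<open>An infinite upward sequence visits infinitely many points, so a finite set of positions, enlarged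
  by an initial part of the sequence, can be made to move \<open>x\<close> to different points.\<close>

lemma word_lim_track_stops:
  assumes f: "linear_word f" and fin: "\<And>z. finite (occurrences z f)"
    and ne: "\<And>s. s \<in> pos f \<Longrightarrow> fst (letter f s) \<noteq> snd (letter f s)"
    and lim: "word_lim f x y"
  shows "\<exists>n. track (ord_rel f) f x (Suc n) = None"
proof (rule ccontr)
  let ?r = "ord_rel f"
  have trr: "trans ?r" and an: "antisym ?r"
    using f by (auto simp: order_on_defs)
  assume "\<nexists>n. track ?r f x (Suc n) = None"
  then have "\<exists>z s. track ?r f x (Suc n) = Some (z, Some s)" for n
    using track_SucE[OF an] by (metis not_None_eq surj_pair)
  \<comment> \<open>Stage 0 has no position, so \<open>z n\<close> and \<open>s n\<close> belong to
    stage \<open>Suc n\<close>; this shift recurs in the sets of visited positions below.\<close>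
  then obtain z s where zs: "\<And>n. track ?r f x (Suc n) = Some (z n, Some (s n))" by metis
  have step: "(s n, s (Suc n)) \<in> ?r \<and> s n \<noteq> s (Suc n) \<and> s (Suc n) \<in> occurrences (z n) f
     \<and> z (Suc n) = other_end (letter f (s (Suc n))) (z n)" for n
    by (rule track_SucE[OF an zs[of "Suc n"]]) (use zs[of n] in \<open>auto simp: is_least_def follows_def\<close>)
  have mono: "(s m, s (Suc m + k)) \<in> ?r \<and> s m \<noteq> s (Suc m + k)" for m k
  proof (induction k)
    case 0
    then show ?case using step by simp
  next
    case (Suc k)
    then show ?case using step[of "Suc m + k"] trr an by (auto dest: transD antisymD)
  qed
  have less: "(s m, s n) \<in> ?r \<and> s m \<noteq> s n" if "m < n" for m n
    using mono[of m "n - Suc m"] that by simp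
  have inj: "inj s" using less by (metis injI linorder_neqE_nat)
  have fibre: "finite {n. z n = a}" for a
  proof -
    have "s ` {n. z n = a} \<subseteq> occurrences a f"
      using track_occurrence[OF an zs] by auto
    then show ?thesis using fin inj by (meson finite_imageD finite_subset inj_on_subset subset_UNIV)
  qed
  obtain P where P: "finite P" "P \<subseteq> pos f"
    "\<And>F. finite F \<Longrightarrow> P \<subseteq> F \<Longrightarrow> F \<subseteq> pos f \<Longrightarrow> word_act f F x = y"
    using lim by (elim word_limE) blast
  \<comment> \<open>The points moved by letters of \<open>P\<close>. Positions of the sequence are
    distinct and each point occurs finitely often, so from some \<open>N\<close> on the sequence
    avoids these points and \<open>P\<close> no longer interferes with it.\<close>
  let ?Z = "fst ` letter f ` P \<union> snd ` letter f ` P"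
  have "finite {n. z n \<in> ?Z}"
  proof -
    have "{n. z n \<in> ?Z} = (\<Union>a\<in>?Z. {n. z n = a})" by auto
    then show ?thesis using P(1) fibre by simp
  qed
  then obtain N where N: "n < N" if "z n \<in> ?Z" for n
    unfolding finite_nat_set_iff_bounded by blast
  have val: "z n = y" if "N \<le> n" for n
  proof -
    let ?F = "P \<union> track_positions ?r f x (Suc n)"
    have F: "finite ?F" "?F \<subseteq> pos f"
      using P(1,2) finite_track_positions[of ?r f x "Suc n"] track_positions_pos[OF an, of f x "Suc n"]
      by auto
    have "word_act f ?F x = z n"
    proof (rule word_act_track_rest[OF f zs])
      fix t assume t: "t \<in> ?F" "follows ?r (Some (s n)) t"
      have "t \<notin> track_positions ?r f x (Suc n)"
      proof
        assume "t \<in> track_positions ?r f x (Suc n)"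
        then obtain m a where m: "m \<le> Suc n" "track ?r f x m = Some (a, Some t)"
          by (auto simp: track_positions_def)
        then obtain k where k: "m = Suc k" by (cases m) auto
        then have "t = s k" "k \<le> n" using m zs[of k] by auto
        then show False using t(2) less[of k n] an
          by (cases "k = n") (auto simp: follows_def dest: antisymD)
      qed
      then have "t \<in> P" using t(1) by simp
      then show "t \<notin> occurrences (z n) f" using N[of n] that by (auto simp: occurrences_def)
    qed (use F in auto)
    moreover have "word_act f ?F x = y"
      using F by (intro P(3)) auto
    ultimately show ?thesis by simp
  qed
  \<comment> \<open>The limit would equal two consecutive points of the sequence, but these are the
    two different ends of one letter.\<close>
  have "z (Suc N) \<noteq> z N"
    using step[of N] ne[of "s (Suc N)"] by (auto simp: occurrences_def other_end_def)
  then show False using val[of N] val[of "Suc N"] by simp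
qed

lemma track_before_end:
  assumes "\<And>m. m < n \<Longrightarrow> track r f x (Suc m) \<noteq> None"
  shows "\<exists>y q. track r f x n = Some (y, q)"
  using assms by (cases n) auto

lemma word_lim_x_infinity:
  assumes f: "linear_word f" and fin: "\<And>z. finite (occurrences z f)"
    and ex: "\<exists>n. track (ord_rel f) f x (Suc n) = None"
  shows "word_lim f x (x_infinity f x)"
proof -
  \<comment> \<open>\<open>?N\<close> counts the steps made: the state at \<open>?N\<close> still
    exists and its successor does not, so it holds the last point.\<close>
  let ?N = "LEAST n. track (ord_rel f) f x (Suc n) = None"
  have N: "track (ord_rel f) f x (Suc ?N) = None" using ex by (rule LeastI_ex)
  have "track (ord_rel f) f x (Suc m) \<noteq> None" if "m < ?N" for m
    using that by (rule not_less_Least)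
  then obtain y q where yq: "track (ord_rel f) f x ?N = Some (y, q)"
    using track_before_end by metis
  have "x_infinity f x = y"
    using ex yq by (simp add: x_infinity_def n_plus_def track_length_def)
  then show ?thesis using word_lim_track_end[OF f fin yq N] by simp
qed

lemma n_plus_finite_iff:
  assumes "linear_word f" "\<And>z. finite (occurrences z f)"
    "\<And>s. s \<in> pos f \<Longrightarrow> fst (letter f s) \<noteq> snd (letter f s)"
  shows "n_plus f x < \<infinity> \<longleftrightarrow> (\<exists>y. word_lim f x y)"
proof
  assume "n_plus f x < \<infinity>"
  then have "\<exists>n. track (ord_rel f) f x (Suc n) = None"
    by (auto simp: n_plus_def track_length_def split: if_splits)
  then show "\<exists>y. word_lim f x y" using word_lim_x_infinity[OF assms(1,2)] by blast
next
  assume "\<exists>y. word_lim f x y"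
  then have "\<exists>n. track (ord_rel f) f x (Suc n) = None" using word_lim_track_stops[OF assms] by blast
  then show "n_plus f x < \<infinity>" by (simp add: n_plus_def track_length_def)
qed

lemma x_infinity_eqI:
  assumes "linear_word f" "\<And>z. finite (occurrences z f)"
    "\<And>s. s \<in> pos f \<Longrightarrow> fst (letter f s) \<noteq> snd (letter f s)" and "word_lim f x y"
  shows "x_infinity f x = y"
  using word_lim_x_infinity[OF assms(1,2) word_lim_track_stops[OF assms]] assms(4) word_lim_unique by metis

section \<open>Group theory without infinite words: coset topologies and transposition
  relations\<close>

section \<open>Group topologies given by a family of subgroups\<close>

text \<open>The subgroups are not assumed to be normal; the conjugation condition is what makes
  multiplication and inversion continuous for the topology of left cosets.\<close>

locale subgroup_basis = group G for G (structure) +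
  fixes \<B> :: "'a set set"
  assumes subgroup_basis: "U \<in> \<B> \<Longrightarrow> subgroup U G" and nonempty: "\<B> \<noteq> {}"
    and directed: "U \<in> \<B> \<Longrightarrow> V \<in> \<B> \<Longrightarrow> \<exists>W\<in>\<B>. W \<subseteq> U \<inter> V"
    and conjugation: "U \<in> \<B> \<Longrightarrow> g \<in> carrier G \<Longrightarrow> \<exists>V\<in>\<B>. \<forall>v\<in>V. inv g \<otimes> v \<otimes> g \<in> U"
begin

lemma cancel_left:
  assumes "y \<in> carrier G" "z \<in> carrier G"
  shows "y \<otimes> (inv y \<otimes> z) = z" "inv y \<otimes> (y \<otimes> z) = z"
  using assms by (simp_all add: m_assoc[symmetric])

lemma openin_iff:
  "openin (subgroup_topology G \<B>) A \<longleftrightarrow> A \<subseteq> carrier G \<and> (\<forall>g\<in>A. \<exists>U\<in>\<B>. g <# U \<subseteq> A)"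
  by (rule openin_subgroup_topology[OF is_group subgroup_basis nonempty directed])

lemma topspace_eq: "topspace (subgroup_topology G \<B>) = carrier G"
proof
  show "topspace (subgroup_topology G \<B>) \<subseteq> carrier G"
    using openin_topspace openin_iff by blast
  have "openin (subgroup_topology G \<B>) (carrier G)"
    unfolding openin_iff
    using nonempty subgroup.subset[OF subgroup_basis] l_coset_subset_G by blast
  then show "carrier G \<subseteq> topspace (subgroup_topology G \<B>)" by (rule openin_subset)
qed

lemma openin_coset: "g \<in> carrier G \<Longrightarrow> U \<in> \<B> \<Longrightarrow> openin (subgroup_topology G \<B>) (g <# U)"
  unfolding subgroup_topology_def by (rule topology_generated_by_Basis) blast

lemma mem_coset: "g \<in> carrier G \<Longrightarrow> U \<in> \<B> \<Longrightarrow> g \<in> g <# U"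
  using subgroup.one_closed[OF subgroup_basis, of U] r_one[of g] unfolding l_coset_def by force

lemma in_closureI:
  assumes g: "g \<in> carrier G" and "\<And>U. U \<in> \<B> \<Longrightarrow> \<exists>u\<in>U. g \<otimes> u \<in> S"
  shows "g \<in> subgroup_topology G \<B> closure_of S"
  unfolding in_closure_of topspace_eq
proof (intro conjI allI impI g)
  fix T assume "g \<in> T \<and> openin (subgroup_topology G \<B>) T"
  then obtain U where U: "U \<in> \<B>" "g <# U \<subseteq> T" unfolding openin_iff by blast
  then obtain u where "u \<in> U" "g \<otimes> u \<in> S" using assms(2) by blast
  then show "\<exists>y. y \<in> S \<and> y \<in> T" using U(2) by (auto simp: l_coset_def)
qed

lemma topological_group: "topological_group_on G (subgroup_topology G \<B>)"
  unfolding topological_group_on_def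
proof (intro conjI is_group topspace_eq)
  let ?T = "subgroup_topology G \<B>"
  have sub: "v \<in> carrier G" if "v \<in> V" "V \<in> \<B>" for v V
    using subgroup.mem_carrier[OF subgroup_basis[OF that(2)] that(1)] .
  show "continuous_map (prod_topology ?T ?T) ?T (\<lambda>(x, y). x \<otimes> y)"
    unfolding continuous_map
  proof (intro conjI allI impI)
    show "(\<lambda>(x, y). x \<otimes> y) ` topspace (prod_topology ?T ?T) \<subseteq> topspace ?T"
      by (auto simp: topspace_eq)
    fix W assume W: "openin ?T W"
    let ?S = "{p \<in> topspace (prod_topology ?T ?T). (\<lambda>(x, y). x \<otimes> y) p \<in> W}"
    show "openin (prod_topology ?T ?T) ?S"
      unfolding openin_prod_topology_alt
    proof (intro allI impI)
      fix x y assume "(x, y) \<in> ?S"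
      then have xy: "x \<in> carrier G" "y \<in> carrier G" "x \<otimes> y \<in> W" by (auto simp: topspace_eq)
      then obtain U where U: "U \<in> \<B>" "(x \<otimes> y) <# U \<subseteq> W" using W openin_iff by meson
      \<comment> \<open>Since (x v)(y u) = (x y)(y^{-1} v y) u, the neighbourhood of
        \<open>x\<close> has to be conjugated into \<open>U\<close>, while \<open>U\<close> itself
        serves for \<open>y\<close>.\<close>
      obtain V where V: "V \<in> \<B>" "\<forall>v\<in>V. inv y \<otimes> v \<otimes> y \<in> U" using conjugation[OF U(1) xy(2)] by blast
      have "(x <# V) \<times> (y <# U) \<subseteq> ?S"
      proof
        fix p assume "p \<in> (x <# V) \<times> (y <# U)"
        then obtain a b v u where vu: "p = (a, b)" "v \<in> V" "a = x \<otimes> v" "u \<in> U" "b = y \<otimes> u"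
          by (auto simp: l_coset_def)
        have c: "v \<in> carrier G" "u \<in> carrier G" using vu V U sub by auto
        have "(inv y \<otimes> v \<otimes> y) \<otimes> u \<in> U"
          using V vu subgroup.m_closed[OF subgroup_basis[OF U(1)]] by blast
        then have "(x \<otimes> y) \<otimes> ((inv y \<otimes> v \<otimes> y) \<otimes> u) \<in> W" using U(2) by (auto simp: l_coset_def)
        moreover have "(x \<otimes> y) \<otimes> ((inv y \<otimes> v \<otimes> y) \<otimes> u) = a \<otimes> b"
          using xy c unfolding vu by (simp add: m_assoc cancel_left)
        ultimately show "p \<in> ?S" using vu c xy by (simp add: topspace_eq)
      qed
      then show "\<exists>A B. openin ?T A \<and> openin ?T B \<and> x \<in> A \<and> y \<in> B \<and> A \<times> B \<subseteq> ?S"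
        using openin_coset[OF xy(1) V(1)] openin_coset[OF xy(2) U(1)] mem_coset[OF xy(1) V(1)]
          mem_coset[OF xy(2) U(1)] by blast
    qed
  qed
  show "continuous_map ?T ?T (\<lambda>x. inv x)"
    unfolding continuous_map
  proof (intro conjI allI impI)
    show "(\<lambda>x. inv x) ` topspace ?T \<subseteq> topspace ?T" by (auto simp: topspace_eq)
    fix W assume W: "openin ?T W"
    let ?S = "{x \<in> topspace ?T. inv x \<in> W}"
    have "\<exists>V\<in>\<B>. x <# V \<subseteq> ?S" if "x \<in> ?S" for x
    proof -
      have x: "x \<in> carrier G" "inv x \<in> W" using that by (auto simp: topspace_eq)
      then obtain U where U: "U \<in> \<B>" "inv x <# U \<subseteq> W" using W openin_iff by meson
      \<comment> \<open>Since (x v)^{-1} = x^{-1} (x v^{-1} x^{-1}), the conjugation condition is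
        used at the inverse of \<open>x\<close>.\<close>
      obtain V where V: "V \<in> \<B>" "\<forall>v\<in>V. inv (inv x) \<otimes> v \<otimes> inv x \<in> U"
        using conjugation[OF U(1), of "inv x"] x by blast
      have "x <# V \<subseteq> ?S"
      proof
        fix a assume "a \<in> x <# V"
        then obtain v where v: "v \<in> V" "a = x \<otimes> v" by (auto simp: l_coset_def)
        have c: "v \<in> carrier G" using v V sub by auto
        have "inv v \<in> V" using subgroup.m_inv_closed[OF subgroup_basis[OF V(1)] v(1)] .
        then have "x \<otimes> inv v \<otimes> inv x \<in> U" using V(2) x by simp
        then have "inv x \<otimes> (x \<otimes> inv v \<otimes> inv x) \<in> W" using U(2) by (auto simp: l_coset_def)
        moreover have "inv x \<otimes> (x \<otimes> inv v \<otimes> inv x) = inv a"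
          using x c unfolding v by (simp add: m_assoc inv_mult_group cancel_left)
        ultimately show "a \<in> ?S" using v c x by (simp add: topspace_eq)
      qed
      then show ?thesis using V by blast
    qed
    then show "openin ?T ?S" unfolding openin_iff by (auto simp: topspace_eq)
  qed
qed

text \<open>A coset of a subgroup that contains \<open>W\<close> is a union of cosets of
  \<open>W\<close>, so the sets generating the coarser topology are open in the finer one.\<close>

lemma finer_than:
  assumes U: "openin (subgroup_topology G \<A>) U"
    and \<A>: "\<And>A. A \<in> \<A> \<Longrightarrow> subgroup A G \<and> (\<exists>W\<in>\<B>. W \<subseteq> A)"
  shows "openin (subgroup_topology G \<B>) U"
proof -
  have "openin (subgroup_topology G \<B>) (g <# A)" if g: "g \<in> carrier G" and A: "A \<in> \<A>" for g A
    unfolding openin_iff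
  proof (intro conjI ballI)
    have sA: "subgroup A G" using \<A> A by blast
    then show "g <# A \<subseteq> carrier G" using g by (simp add: l_coset_subset_G subgroup.subset)
    fix h assume h: "h \<in> g <# A"
    obtain W where W: "W \<in> \<B>" "W \<subseteq> A" using \<A> A by blast
    have "h <# W \<subseteq> h <# A" using W(2) by (auto simp: l_coset_def)
    also have "h <# A = g <# A" using l_repr_independence[OF h g sA] by simp
    finally show "\<exists>W\<in>\<B>. h <# W \<subseteq> g <# A" using W(1) by blast
  qed
  then have S: "openin (subgroup_topology G \<B>) s" if "s \<in> {g <# A | g A. g \<in> carrier G \<and> A \<in> \<A>}" for s
    using that by blast
  have "generate_topology_on {g <# A | g A. g \<in> carrier G \<and> A \<in> \<A>} U"
    using U by (simp add: subgroup_topology_def openin_topology_generated_by_iff)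
  then show ?thesis
    by induction (use S in auto)
qed

end

section \<open>Words in transpositions modulo the relations\<close>

definition letter_prod :: "('g, 'b) monoid_scheme \<Rightarrow> ('l \<Rightarrow> 'g) \<Rightarrow> 'l list \<Rightarrow> 'g" where
  "letter_prod G t ls = foldr (\<lambda>l a. t l \<otimes>\<^bsub>G\<^esub> a) ls \<one>\<^bsub>G\<^esub>"

lemma letter_prod_simps [simp]:
  "letter_prod G t [] = \<one>\<^bsub>G\<^esub>" "letter_prod G t (l # ls) = t l \<otimes>\<^bsub>G\<^esub> letter_prod G t ls"
  by (simp_all add: letter_prod_def)

lemma (in monoid) letter_prod_closed:
  "(\<And>l. l \<in> set ls \<Longrightarrow> t l \<in> carrier G) \<Longrightarrow> letter_prod G t ls \<in> carrier G"
  by (induction ls) auto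

lemma (in monoid) letter_prod_append:
  assumes "\<And>l. l \<in> set ls \<union> set ms \<Longrightarrow> t l \<in> carrier G"
  shows "letter_prod G t (ls @ ms) = letter_prod G t ls \<otimes> letter_prod G t ms"
  using assms by (induction ls) (auto simp: letter_prod_closed m_assoc)

lemma hom_letter_prod:
  assumes "group G" "group H" "h \<in> hom G H" "\<And>l. l \<in> set ls \<Longrightarrow> t l \<in> carrier G"
  shows "h (letter_prod G t ls) = letter_prod H (h \<circ> t) ls"
  using assms(4)
proof (induction ls)
  case Nil
  then show ?case using hom_one[OF assms(3,1,2)] by simp
next
  case (Cons l ls)
  then show ?case
    using hom_mult[OF assms(3)] monoid.letter_prod_closed[OF group.is_monoid[OF assms(1)], of ls t] by simp
qed

text \<open>The relations as they hold modulo a normal subgroup containing R: every letter is an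
  involution, letters are unoriented, and the other relators become equations between products of
  two letters.\<close>

locale transposition_system = group Q for Q (structure) +
  fixes X :: "'x set" and t :: "'x \<times> 'x \<Rightarrow> 'a"
  assumes t_closed: "l \<in> transp_letters X \<Longrightarrow> t l \<in> carrier Q"
    and t_swap: "(x, y) \<in> transp_letters X \<Longrightarrow> t (y, x) = t (x, y)"
    and t_square: "l \<in> transp_letters X \<Longrightarrow> t l \<otimes> t l = \<one>"
    and t_commute: "{x, y, z, w} \<subseteq> X \<Longrightarrow> card {x, y, z, w} = 4 \<Longrightarrow> t (x, y) \<otimes> t (z, w) = t (z, w) \<otimes> t (x, y)"
    and t_conj: "{x, y, z} \<subseteq> X \<Longrightarrow> card {x, y, z} = 3 \<Longrightarrow> t (x, y) \<otimes> t (x, z) = t (y, z) \<otimes> t (x, y)"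
begin

text \<open>Equality in \<open>Q\<close> says nothing about permutations of \<open>X\<close>, yet
  the rewriting is steered by which points are fixed. Product and action are therefore preserved
  together.\<close>

definition same :: "('x \<times> 'x) list \<Rightarrow> ('x \<times> 'x) list \<Rightarrow> bool" where
  "same ls ms \<longleftrightarrow> letter_prod Q t ls = letter_prod Q t ms \<and> fold letter_act ls = fold letter_act ms"

text \<open>The final letter of the normal form. Coding its absence by y = x makes \<open>y\<close>
  the image of \<open>x\<close> in either case.\<close>

definition tail_of :: "'x \<Rightarrow> 'x \<Rightarrow> ('x \<times> 'x) list" where
  "tail_of x y = (if y = x then [] else [(x, y)])"

lemma transp_lettersI: "x \<in> X \<Longrightarrow> y \<in> X \<Longrightarrow> x \<noteq> y \<Longrightarrow> (x, y) \<in> transp_letters X"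
  by (simp add: transp_letters_def)

lemma same_append:
  assumes "same ls ls'" "same ms ms'" "set ls \<union> set ls' \<union> set ms \<union> set ms' \<subseteq> transp_letters X"
  shows "same (ls @ ms) (ls' @ ms')"
proof -
  have "letter_prod Q t (ls @ ms) = letter_prod Q t ls \<otimes> letter_prod Q t ms"
    "letter_prod Q t (ls' @ ms') = letter_prod Q t ls' \<otimes> letter_prod Q t ms'"
    using assms(3) by (auto intro!: letter_prod_append t_closed)
  then show ?thesis using assms by (simp add: same_def)
qed

lemma same_refl: "same ls ls" and same_trans: "same ls ms \<Longrightarrow> same ms ns \<Longrightarrow> same ls ns"
  by (auto simp: same_def)

lemma same_swap: "(x, y) \<in> transp_letters X \<Longrightarrow> same [(x, y)] [(y, x)]"
  using t_swap[of x y] by (simp add: same_def letter_act_def fun_eq_iff transpose_commute)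

lemma transpose_square_id: "letter_act l \<circ> letter_act l = id"
  by (simp add: fun_eq_iff)

text \<open>A letter to the right of T_{x,y} is moved across it: it cancels, commutes, or is
  conjugated by the three-point relation, and what comes out on the left avoids \<open>x\<close>.
  The side conditions orient the letter so that a common end with the tail is its first
  entry.\<close>

lemma push_letter:
  assumes D: "D \<subseteq> X" "x \<in> D" "y \<in> D" and l: "(a, b) \<in> transp_letters D" and "b \<noteq> x" "a = x \<or> b \<noteq> y"
  shows "\<exists>v y'. set v \<subseteq> transp_letters (D - {x}) \<and> y' \<in> D \<and> same (tail_of x y @ [(a, b)]) (v @ tail_of x y')"
proof -
  have ab: "a \<in> D" "b \<in> D" "a \<noteq> b" using l by (auto simp: transp_letters_def)
  have cl: "t (u, v) \<in> carrier Q" if "u \<in> D" "v \<in> D" "u \<noteq> v" for u v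
    using that D(1) by (auto intro!: t_closed transp_lettersI)
  have sw: "t (u, v) = t (v, u)" if "u \<in> D" "v \<in> D" "u \<noteq> v" for u v
    using that D(1) t_swap[of v u] by (auto simp: transp_letters_def)
  consider "y = x" "a = x" | "y = x" "a \<noteq> x" | "y \<noteq> x" "a = x" "b = y" | "y \<noteq> x" "a = x" "b \<noteq> y"
    | "y \<noteq> x" "a = y" | "y \<noteq> x" "a \<noteq> x" "a \<noteq> y" by blast
  then show ?thesis
  proof cases
    case 1
    then show ?thesis
      using assms ab by (intro exI[of _ "[]"] exI[of _ b]) (simp add: tail_of_def same_refl)
  next
    case 2
    then show ?thesis
      using assms ab by (intro exI[of _ "[(a, b)]"] exI[of _ x])
        (simp add: tail_of_def same_refl transp_letters_def)
  next
    case 3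
    have "t (x, y) \<otimes> t (x, y) = \<one>" using D 3 by (intro t_square transp_lettersI) auto
    then show ?thesis
      using assms ab 3 cl[of x y] by (intro exI[of _ "[]"] exI[of _ x])
        (simp add: tail_of_def same_def transpose_square_id)
  next
    case 4
    have "t (x, y) \<otimes> t (x, b) = t (y, b) \<otimes> t (x, y)"
      using D ab 4 assms(5) by (intro t_conj) auto
    \<comment> \<open>The left letter of a list acts first, so the identity of permutations is
      written in the order opposite to that of the products.\<close>
    moreover have "letter_act (x, b) \<circ> letter_act (x, y) = letter_act (x, y) \<circ> letter_act (y, b)"
      using 4 assms(5) by (auto simp: fun_eq_iff letter_act_def Transposition.transpose_def)
    ultimately show ?thesis
      using 4 assms ab cl[of x y] cl[of x b] cl[of y b] by (intro exI[of _ "[(y, b)]"] exI[of _ y])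
        (auto simp: tail_of_def same_def transp_letters_def)
  next
    case 5
    \<comment> \<open>The three-point relation based at \<open>b\<close>, used from right to
      left.\<close>
    have "t (b, y) \<otimes> t (b, x) = t (y, x) \<otimes> t (b, y)"
      using D ab 5 assms(5) by (intro t_conj) auto
    then have "t (x, y) \<otimes> t (y, b) = t (y, b) \<otimes> t (x, b)"
      using sw[of x y] sw[of y b] sw[of x b] D ab 5 assms(5) by simp
    moreover have "letter_act (y, b) \<circ> letter_act (x, y) = letter_act (x, b) \<circ> letter_act (y, b)"
      using 5 ab assms(5) by (auto simp: fun_eq_iff letter_act_def Transposition.transpose_def)
    ultimately show ?thesis
      using 5 assms ab cl[of x y] cl[of x b] cl[of y b] by (intro exI[of _ "[(y, b)]"] exI[of _ b])
        (auto simp: tail_of_def same_def transp_letters_def)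
  next
    case 6
    then have bny: "b \<noteq> y" using assms(6) by simp
    have "t (x, y) \<otimes> t (a, b) = t (a, b) \<otimes> t (x, y)"
      using D ab 6 assms(5) bny by (intro t_commute) auto
    moreover have "letter_act (a, b) \<circ> letter_act (x, y) = letter_act (x, y) \<circ> letter_act (a, b)"
      using 6 ab assms(5) bny by (auto simp: fun_eq_iff letter_act_def Transposition.transpose_def)
    ultimately show ?thesis
      using 6 assms ab cl[of x y] cl[of a b] by (intro exI[of _ "[(a, b)]"] exI[of _ y])
        (auto simp: tail_of_def same_def transp_letters_def)
  qed
qed

text \<open>Of the two orientations of a letter with distinct ends, at least one meets the side
  conditions of \<open>push_letter\<close>, and reorienting preserves \<open>same\<close>.\<close>

lemma push_letter_any:
  assumes D: "D \<subseteq> X" "x \<in> D" "y \<in> D" and l: "l \<in> transp_letters D"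
  shows "\<exists>v y'. set v \<subseteq> transp_letters (D - {x}) \<and> y' \<in> D \<and> same (tail_of x y @ [l]) (v @ tail_of x y')"
proof -
  obtain a b where l': "l = (a, b)" by fastforce
  have tl: "set (tail_of x y) \<subseteq> transp_letters X"
    using D by (auto simp: tail_of_def transp_letters_def)
  have ab: "(a, b) \<in> transp_letters X" "(b, a) \<in> transp_letters X" "(b, a) \<in> transp_letters D" "a \<noteq> b"
    using l l' D by (auto simp: transp_letters_def)
  consider "b \<noteq> x" "a = x \<or> b \<noteq> y" | "a \<noteq> x" "b = x \<or> a \<noteq> y" using ab(4) by blast
  then show ?thesis
  proof cases
    case 1
    then show ?thesis using push_letter[OF D, of a b] l l' by simp
  next
    case 2
    then obtain v y' where v: "set v \<subseteq> transp_letters (D - {x})" "y' \<in> D"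
      "same (tail_of x y @ [(b, a)]) (v @ tail_of x y')"
      using push_letter[OF D ab(3)] by blast
    have "same (tail_of x y @ [(a, b)]) (tail_of x y @ [(b, a)])"
      using tl ab by (intro same_append same_refl same_swap) auto
    then show ?thesis using v same_trans l' by blast
  qed
qed

text \<open>Letters are appended one at a time to the normal form. Each is pushed across the tail,
  so that only a single letter at the end can involve \<open>x\<close>.\<close>

lemma isolate_point:
  assumes D: "D \<subseteq> X" "x \<in> D" and "set ls \<subseteq> transp_letters D"
  shows "\<exists>w y. set w \<subseteq> transp_letters (D - {x}) \<and> y \<in> D \<and> same ls (w @ tail_of x y)"
  using assms(3)
proof (induction ls rule: rev_induct)
  case Nil
  then show ?case using D by (intro exI[of _ "[]"] exI[of _ x]) (simp add: tail_of_def same_refl)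
next
  case (snoc l ls)
  have mono: "transp_letters (D - {x}) \<subseteq> transp_letters X" "transp_letters D \<subseteq> transp_letters X"
    using D by (auto simp: transp_letters_def)
  have tl: "set (tail_of x y) \<subseteq> transp_letters X" if "y \<in> D" for y
    using D that by (auto simp: tail_of_def transp_letters_def)
  obtain w y where w: "set w \<subseteq> transp_letters (D - {x})" "y \<in> D" "same ls (w @ tail_of x y)"
    using snoc by auto
  obtain v y' where v: "set v \<subseteq> transp_letters (D - {x})" "y' \<in> D"
    "same (tail_of x y @ [l]) (v @ tail_of x y')"
    using push_letter_any[OF D w(2), of l] snoc.prems by auto
  have "same (ls @ [l]) ((w @ tail_of x y) @ [l])"
    using snoc.prems w tl mono by (intro same_append same_refl) auto
  moreover have "same (w @ (tail_of x y @ [l])) (w @ (v @ tail_of x y'))"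
    by (rule same_append[OF same_refl v(3)])
      (use snoc.prems w(1) v(1) tl[OF w(2)] tl[OF v(2)] mono in auto)
  ultimately have "same (ls @ [l]) ((w @ v) @ tail_of x y')" using same_trans by simp
  then show ?case using w v by (intro exI[of _ "w @ v"] exI[of _ y']) simp
qed

text \<open>In the normal form w T_{x,y} the word w fixes \<open>x\<close>, so a word fixing
  \<open>x\<close> has an empty tail. The points of \<open>C\<close> are treated in turn; since the
  alphabet only shrinks, points removed earlier do not return.\<close>

lemma avoid_fixed_points:
  assumes "finite C" and D: "D \<subseteq> X" "C \<subseteq> D" and ls: "set ls \<subseteq> transp_letters D"
    and fixed: "\<And>x. x \<in> C \<Longrightarrow> fold letter_act ls x = x"
  shows "\<exists>w. set w \<subseteq> transp_letters (D - C) \<and> same ls w"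
  using assms(1) D(2) fixed
proof (induction C rule: finite_induct)
  case empty
  then show ?case using ls same_refl by (intro exI[of _ ls]) simp
next
  case (insert x C)
  then obtain w where w: "set w \<subseteq> transp_letters (D - C)" "same ls w" by auto
  have "x \<in> D - C" "D - C \<subseteq> X" using insert D by auto
  then obtain w' y where w': "set w' \<subseteq> transp_letters (D - C - {x})" "y \<in> D - C" "same w (w' @ tail_of x y)"
    using isolate_point[of "D - C" x w] w(1) by blast
  have s: "same ls (w' @ tail_of x y)" using same_trans w w' by blast
  have "fold letter_act w' x = x"
    using w'(1) by (intro fold_letter_act_fixed) (auto simp: transp_letters_def)
  then have "x = fold letter_act (tail_of x y) x"
    using s insert.prems(2)[of x] by (simp add: same_def)
  then have "y = x" by (auto simp: tail_of_def letter_act_def split: if_splits)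
  then have "same ls w'" using s by (simp add: tail_of_def)
  moreover have "D - C - {x} = D - insert x C" by auto
  ultimately show ?case using w'(1) by auto
qed

end

section \<open>The group BF(\<Lambda>;S), its action on X, and its topology\<close>

section \<open>The admissible set of the symmetric group\<close>

lemma swap_transp_letters:
  "l \<in> transp_letters X \<Longrightarrow> prod.swap l \<in> transp_letters X \<and> prod.swap (prod.swap l) = l"
  by (auto simp: transp_letters_def)

lemma transp_letters_mono: "C \<subseteq> D \<Longrightarrow> transp_letters C \<subseteq> transp_letters D"
  by (auto simp: transp_letters_def)

lemma finite_transp_letters: "finite C \<Longrightarrow> finite (transp_letters C)"
  by (rule finite_subset[of _ "C \<times> C"]) (auto simp: transp_letters_def)

lemma words_letter_ne:
  "f \<in> words (transp_letters X) \<Longrightarrow> s \<in> pos f \<Longrightarrow> fst (letter f s) \<noteq> snd (letter f s)"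
  by (force simp: words_def transp_letters_def)

lemma words_letter_in:
  "f \<in> words (transp_letters X) \<Longrightarrow> s \<in> pos f \<Longrightarrow> fst (letter f s) \<in> X \<and> snd (letter f s) \<in> X"
  by (force simp: words_def transp_letters_def)

lemma S0_words: "f \<in> S0 X \<Longrightarrow> f \<in> words (transp_letters X)"
  by (simp add: S0_def)

lemma S0_finite_occurrences:
  assumes "f \<in> S0 X" shows "finite (occurrences z f)"
proof (cases "z \<in> X")
  case False
  then have "occurrences z f = {}"
    using words_letter_in[OF S0_words[OF assms]] by (auto simp: occurrences_def)
  then show ?thesis by simp
qed (use assms in \<open>simp add: S0_def\<close>)

text \<open>The order is a separate argument of \<open>track\<close>, so the downward sequences of a
  word can be read as the upward sequences of the word with reversed order.\<close>

lemma track_cong: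
  assumes "pos g = pos f" "letter g = letter f" shows "track r g x n = track r f x n"
proof -
  have occ: "occurrences z g = occurrences z f" for z using assms by (simp add: occurrences_def)
  show ?thesis
  proof (induction n)
    case (Suc n)
    show ?case
    proof (cases "track r f x n")
      case (Some p)
      obtain y q where "p = (y, q)" by fastforce
      then show ?thesis using Suc Some occ assms(2) by (cases q) (simp_all add: Let_def)
    qed (use Suc in simp)
  qed simp
qed

text \<open>Swapping the ends of a letter does not change its transposition, so the inverse word and
  the word with merely reversed order have the same limits.\<close>

lemma word_lim_inverse:
  "word_lim (word_inverse prod.swap f) x y \<longleftrightarrow> word_lim (f\<lparr>ord_rel := (ord_rel f)\<inverse>\<rparr>) x y"
proof -
  have "word_act (word_inverse prod.swap f) F = word_act (f\<lparr>ord_rel := (ord_rel f)\<inverse>\<rparr>) F" for F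
    by (simp add: word_act_def letters_on_def fold_map comp_def)
  then show ?thesis by (simp add: word_lim_def)
qed

lemma n_minus_finite_iff:
  assumes "f \<in> S0 X"
  shows "n_minus f x < \<infinity> \<longleftrightarrow> (\<exists>y. word_lim (word_inverse prod.swap f) x y)"
proof -
  let ?g = "f\<lparr>ord_rel := (ord_rel f)\<inverse>\<rparr>"
  have "track_length (ord_rel ?g) ?g x = track_length (ord_rel ?g) f x"
    unfolding track_length_def by (subst (1 2) track_cong[of ?g f]) simp_all
  then have "n_minus f x = n_plus ?g x"
    by (simp add: n_minus_def n_plus_def)
  moreover have "occurrences z ?g = occurrences z f" for z by (simp add: occurrences_def)
  then have "n_plus ?g x < \<infinity> \<longleftrightarrow> (\<exists>y. word_lim ?g x y)"
    using S0_finite_occurrences[OF assms] words_linear[OF S0_words[OF assms]]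
      words_letter_ne[OF S0_words[OF assms]]
    by (intro n_plus_finite_iff) simp_all
  ultimately show ?thesis by (simp add: word_lim_inverse)
qed

text \<open>Both finiteness conditions become existence of limits, for the word and for its inverse.
  Closure of the admissible set under the operations is then checked on limits.\<close>

lemma perm_words_iff:
  "f \<in> perm_words X \<longleftrightarrow> f \<in> S0 X \<and> (\<forall>x\<in>X. \<exists>y. word_lim f x y) \<and>
     (\<forall>x\<in>X. \<exists>y. word_lim (word_inverse prod.swap f) x y)"
proof -
  have "n_plus f x < \<infinity> \<longleftrightarrow> (\<exists>y. word_lim f x y)" if "f \<in> S0 X" for x
    using that by (intro n_plus_finite_iff words_linear[OF S0_words] S0_finite_occurrences
        words_letter_ne[OF S0_words])
  then show ?thesis
    using n_minus_finite_iff[of f X] unfolding perm_words_def by blast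
qed

lemma perm_words_S0: "f \<in> perm_words X \<Longrightarrow> f \<in> S0 X"
  by (simp add: perm_words_def)

lemma perm_words_words: "f \<in> perm_words X \<Longrightarrow> f \<in> words (transp_letters X)"
  by (simp add: perm_words_S0 S0_words)

lemma x_infinity_lim:
  assumes "f \<in> perm_words X" "x \<in> X" shows "word_lim f x (x_infinity f x)"
proof -
  obtain y where y: "word_lim f x y" using assms by (auto simp: perm_words_iff)
  have "x_infinity f x = y"
    using assms(1) y by (intro x_infinity_eqI words_linear[OF perm_words_words]
        S0_finite_occurrences[OF perm_words_S0] words_letter_ne[OF perm_words_words])
  then show ?thesis using y by simp
qed

lemma x_infinity_eq:
  "f \<in> perm_words X \<Longrightarrow> x \<in> X \<Longrightarrow> word_lim f x y \<Longrightarrow> x_infinity f x = y"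
  using x_infinity_lim word_lim_unique by metis

lemma fold_letter_act_in:
  "set ls \<subseteq> transp_letters X \<Longrightarrow> x \<in> X \<Longrightarrow> fold letter_act ls x \<in> X"
  by (induction ls arbitrary: x)
    (auto simp: letter_act_def transp_letters_def Transposition.transpose_def)

lemma word_act_in:
  assumes "f \<in> words (transp_letters X)" "finite F" "F \<subseteq> pos f" "x \<in> X"
  shows "word_act f F x \<in> X"
  unfolding word_act_def
proof (rule fold_letter_act_in)
  show "set (letters_on f F) \<subseteq> transp_letters X"
    using assms set_enum_by[OF words_linear[OF assms(1)] assms(2,3)]
    by (auto simp: letters_on_def words_def)
qed fact

lemma word_lim_in:
  assumes "f \<in> words (transp_letters X)" "word_lim f x y" "x \<in> X" shows "y \<in> X"
proof -
  obtain P where "finite P" "P \<subseteq> pos f"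
    "\<And>F. finite F \<Longrightarrow> P \<subseteq> F \<Longrightarrow> F \<subseteq> pos f \<Longrightarrow> word_act f F x = y"
    using assms(2) by (elim word_limE) blast
  then show ?thesis using word_act_in[OF assms(1) _ _ assms(3), of P] by auto
qed

lemma occurrences_concat:
  "occurrences z (word_concat f g) = left_copy ` occurrences z f \<union> right_copy ` occurrences z g"
  by (auto simp: occurrences_def pos_concat)

lemma occurrences_inverse [simp]: "occurrences z (word_inverse prod.swap f) = occurrences z f"
  by (auto simp: occurrences_def)

lemma finite_occurrences_cancels:
  assumes "cancels i f g" "finite (occurrences z f)" shows "finite (occurrences z g)"
proof -
  obtain T where "word_iso g (word_restrict f (pos f - T))"
    using assms(1) by (auto simp: cancels_iff)
  then obtain \<phi> where bij: "bij_betw \<phi> (pos g) (pos f \<inter> (pos f - T))"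
    and let_eq: "\<And>s. s \<in> pos g \<Longrightarrow> letter g s = letter f (\<phi> s)"
    by (auto simp: word_iso_def)
  have "\<phi> ` occurrences z g \<subseteq> occurrences z f"
    using bij let_eq by (auto simp: occurrences_def bij_betw_def)
  moreover have "inj_on \<phi> (occurrences z g)"
    using bij by (auto simp: occurrences_def bij_betw_def inj_on_def)
  ultimately show ?thesis using assms(2) by (meson finite_imageD finite_subset)
qed

lemma inverse_concat_iso:
  "word_iso (word_inverse i (word_concat f g)) (word_concat (word_inverse i g) (word_inverse i f))"
proof -
  let ?\<phi> = "join_maps right_copy left_copy :: 'a \<times> nat \<Rightarrow> 'a \<times> nat"
  let ?a = "word_inverse i (word_concat f g)" and ?b = "word_concat (word_inverse i g) (word_inverse i f)"
  have "bij_betw ?\<phi> (pos ?a) (pos ?b)"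
    unfolding bij_betw_def
  proof
    show "inj_on ?\<phi> (pos ?a)" unfolding pos_inverse by (rule inj_onI) (elim pos_concatE; simp)
    show "?\<phi> ` pos ?a = pos ?b" by (auto simp: pos_concat image_Un image_image)
  qed
  moreover have "\<forall>s\<in>pos ?a. \<forall>t\<in>pos ?a. (s, t) \<in> ord_rel ?a \<longleftrightarrow> (?\<phi> s, ?\<phi> t) \<in> ord_rel ?b"
    unfolding pos_inverse by (intro ballI; elim pos_concatE; simp; blast)
  moreover have "\<forall>s\<in>pos ?a. letter ?a s = letter ?b (?\<phi> s)"
    unfolding pos_inverse by (intro ballI; elim pos_concatE; simp)
  ultimately show ?thesis unfolding word_iso_def by blast
qed

lemma cancels_inverse:
  assumes "cancels i f g"
  shows "cancels i (word_inverse i f) (word_inverse i g)"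
proof -
  obtain T star where c: "cancelling i f T star" and iso: "word_iso g (word_restrict f (pos f - T))"
    using assms by (auto simp: cancels_iff)
  have int: "word_interval (word_inverse i f) t u = word_interval f u t" for t u
    by (auto simp: word_interval_def)
  \<comment> \<open>Reversal turns the interval from \<open>t\<close> to \<open>star t\<close> into
    the one from \<open>star t\<close> to \<open>t\<close>, which is the interval belonging to
    \<open>star t\<close>.\<close>
  have int': "word_interval f (star t) t = word_interval f (star t) (star (star t))" if "t \<in> T" for t
    using cancellingD(3)[OF c that] by simp
  have "cancelling i (word_inverse i f) T star"
  proof (rule cancellingI)
    fix t assume t: "t \<in> T"
    note D = cancellingD[OF c cancellingD(2)[OF c t]]
    show "word_interval (word_inverse i f) t (star t) \<subseteq> T"
      "\<And>u. u \<in> word_interval (word_inverse i f) t (star t) \<Longrightarrow>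
           star u \<in> word_interval (word_inverse i f) t (star t)"
      unfolding int int'[OF t] using D by auto
    show "star t \<in> T \<and> star (star t) = t \<and> letter (word_inverse i f) (star t) = i (letter (word_inverse i f) t)"
      using cancellingD[OF c t] by simp
  qed (use cancellingD(1)[OF c] in auto)
  moreover have "word_iso (word_inverse i g) (word_restrict (word_inverse i f) (pos (word_inverse i f) - T))"
  proof -
    obtain \<phi> where bij: "bij_betw \<phi> (pos g) (pos f \<inter> (pos f - T))"
      and ord: "\<And>s t. s \<in> pos g \<Longrightarrow> t \<in> pos g \<Longrightarrow>
        (s, t) \<in> ord_rel g \<longleftrightarrow> (\<phi> s, \<phi> t) \<in> ord_rel (word_restrict f (pos f - T))"
      and let_eq: "\<And>s. s \<in> pos g \<Longrightarrow> letter g s = letter f (\<phi> s)"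
      using iso by (auto simp: word_iso_def)
    show ?thesis
      unfolding word_iso_def
      by (rule exI[of _ \<phi>]) (use bij ord let_eq in auto)
  qed
  ultimately show ?thesis unfolding cancels_iff by blast
qed

section \<open>Closure properties of the admissible set\<close>

lemma perm_words_inverse:
  assumes f: "f \<in> perm_words X" shows "word_inverse prod.swap f \<in> perm_words X"
proof -
  let ?g = "word_inverse prod.swap f"
  have w: "f \<in> words (transp_letters X)" using f by (rule perm_words_words)
  have g: "?g \<in> words (transp_letters X)" using w swap_transp_letters by (rule inverse_words)
  then have "?g \<in> S0 X" using perm_words_S0[OF f] by (simp add: S0_def)
  moreover have "word_lim (word_inverse prod.swap ?g) x y" if "word_lim f x y" for x y
    by (rule word_lim_iso[OF words_linear[OF w] _ word_iso_sym[OF inverse_inverse_iso] that])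
      (use words_linear[OF w] in simp_all)
  ultimately show ?thesis using f unfolding perm_words_iff by blast
qed

lemma perm_words_concat_lim:
  assumes "f \<in> words (transp_letters X)" "g \<in> words (transp_letters X)" "x \<in> X"
    "\<And>x. x \<in> X \<Longrightarrow> \<exists>y. word_lim f x y" "\<And>x. x \<in> X \<Longrightarrow> \<exists>y. word_lim g x y"
  shows "\<exists>z. word_lim (word_concat f g) x z"
proof -
  obtain y where y: "word_lim f x y" using assms by blast
  then have "y \<in> X" using word_lim_in assms by metis
  then obtain z where "word_lim g y z" using assms by blast
  then show ?thesis
    using word_lim_concat[OF words_linear[OF assms(1)] words_linear[OF assms(2)] y] by blast
qed

lemma perm_words_concat:
  assumes f: "f \<in> perm_words X" and g: "g \<in> perm_words X"
  shows "word_concat f g \<in> perm_words X"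
proof -
  let ?i = "word_inverse prod.swap"
  have w: "f \<in> words (transp_letters X)" "g \<in> words (transp_letters X)"
    "?i f \<in> words (transp_letters X)" "?i g \<in> words (transp_letters X)"
    using f g by (simp_all add: perm_words_words perm_words_inverse)
  have "word_concat f g \<in> S0 X"
    using perm_words_S0[OF f] perm_words_S0[OF g] concat_words[OF w(1,2)]
    by (simp add: S0_def occurrences_concat)
  moreover have "\<exists>z. word_lim (word_concat f g) x z" if "x \<in> X" for x
    using w f g that by (intro perm_words_concat_lim) (auto simp: perm_words_iff)
  moreover have "\<exists>z. word_lim (?i (word_concat f g)) x z" if "x \<in> X" for x
  proof -
    have "\<exists>z. word_lim (word_concat (?i g) (?i f)) x z"
      using w f g that by (intro perm_words_concat_lim) (auto simp: perm_words_iff)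
    then show ?thesis
      using word_lim_iso[OF words_linear[OF concat_words[OF w(4,3)]]
          inverse_linear[OF words_linear[OF concat_words[OF w(1,2)]]]
          word_iso_sym[OF inverse_concat_iso]] by blast
  qed
  ultimately show ?thesis by (simp add: perm_words_iff)
qed

lemma perm_words_cancels:
  assumes f: "f \<in> perm_words X" and g: "g \<in> words (transp_letters X)" and c: "cancels prod.swap f g"
  shows "g \<in> perm_words X"
proof -
  let ?i = "word_inverse prod.swap"
  have w: "f \<in> words (transp_letters X)" "?i f \<in> words (transp_letters X)"
    using f by (simp_all add: perm_words_words perm_words_inverse)
  have "g \<in> S0 X"
    using g finite_occurrences_cancels[OF c S0_finite_occurrences[OF perm_words_S0[OF f]]]
    by (simp add: S0_def)
  moreover have "word_lim g x y" if "word_lim f x y" for x y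
    using word_lim_cancels[OF words_linear[OF w(1)] words_linear[OF g] c words_letter_ne[OF w(1)] that] .
  moreover have "word_lim (?i g) x y" if "word_lim (?i f) x y" for x y
    using word_lim_cancels[OF words_linear[OF w(2)] inverse_linear[OF words_linear[OF g]]
        cancels_inverse[OF c] words_letter_ne[OF w(2)] that] .
  ultimately show ?thesis using f unfolding perm_words_iff by blast
qed

lemma admissible_perm_words: "admissible_words (transp_letters X) prod.swap (perm_words X)"
  unfolding admissible_words_def
  by (intro conjI ballI impI subsetI perm_words_concat perm_words_inverse)
    (simp_all add: perm_words_words, rule perm_words_cancels)

lemma finite_perm_words:
  assumes "f \<in> words (transp_letters X)" "finite (pos f)" shows "f \<in> perm_words X"
proof -
  have "f \<in> S0 X" using assms by (auto simp: S0_def occurrences_def)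
  then show ?thesis
    using assms word_lim_finite[of f] word_lim_finite[of "word_inverse prod.swap f"]
    unfolding perm_words_iff pos_inverse by blast
qed

lemma word_empty_perm_words: "word_empty \<in> perm_words X"
  by (rule finite_perm_words[OF word_empty_words]) (simp add: word_empty_def)

lemma word_single_perm_words: "l \<in> transp_letters X \<Longrightarrow> word_single l \<in> perm_words X"
  by (rule finite_perm_words[OF word_single_words]) (simp_all add: word_single_def)

lemma x_infinity_finite:
  fixes f :: "('a \<times> 'a) bword"
  assumes "f \<in> words (transp_letters X)" "finite (pos f)" "x \<in> X"
  shows "x_infinity f x = word_act f (pos f) x"
  by (rule x_infinity_eq[OF finite_perm_words[OF assms(1,2)] assms(3) word_lim_finite[OF assms(2)]])

section \<open>The action of a class of words\<close>

text \<open>Finite sets of positions singled out by letters, which makes sense simultaneously for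
  all words of a class; every finite set of positions is contained in such a set.\<close>

definition cut :: "('s, 'a \<times> 'a) lword \<Rightarrow> 'a set \<Rightarrow> 's set" where
  "cut f C = {s \<in> pos f. letter f s \<in> transp_letters C}"

lemma finite_cut:
  assumes "f \<in> words (transp_letters X)" "finite C" "C \<subseteq> X" shows "finite (cut f C)"
proof -
  have "cut f C = (\<Union>l\<in>transp_letters C. {s \<in> pos f. letter f s = l})" by (auto simp: cut_def)
  moreover have "finite {s \<in> pos f. letter f s = l}" if "l \<in> transp_letters C" for l
    using assms(1) transp_letters_mono[OF assms(3)] that by (auto simp: words_def)
  ultimately show ?thesis using finite_transp_letters[OF assms(2)] by simp
qed

text \<open>Restricted to the letters in \<Lambda>(C), a cancellation relates two finite words, and
  the limit of a finite word is the action of all its positions. Words of the chain outside the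
  admissible set are thereby covered as well.\<close>

lemma word_act_cut_equiv:
  assumes "(f, g) \<in> word_equiv (transp_letters X) prod.swap" "finite C" "C \<subseteq> X"
  shows "word_act f (cut f C) = word_act g (cut g C)"
  using assms(1)
proof (rule word_equiv_invariant)
  fix f g :: "('a \<times> 'a) bword"
  assume f: "f \<in> words (transp_letters X)" and g: "g \<in> words (transp_letters X)"
    and c: "cancels prod.swap f g"
  let ?r = "\<lambda>f :: ('a \<times> 'a) bword. letter_restrict f (transp_letters C)"
  have cut: "pos (?r f) = cut f C" "pos (?r g) = cut g C" by (auto simp: cut_def)
  have lin: "linear_word (?r f)" "linear_word (?r g)"
    by (rule word_restrict_linear[OF words_linear], rule f g)+
  have c': "cancels prod.swap (?r f) (?r g)"
    by (rule cancels_restrict[OF c]) (simp add: swap_transp_letters)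
  have fin: "finite (pos (?r f))" "finite (pos (?r g))"
    unfolding cut using finite_cut f g assms by auto
  have act: "word_act (?r f) (pos (?r f)) = word_act f (cut f C)"
    "word_act (?r g) (pos (?r g)) = word_act g (cut g C)"
    using fin unfolding cut
    by (auto intro!: word_act_restrict words_linear[OF f] words_linear[OF g] simp: cut_def)
  have "word_act g (cut g C) x = word_act f (cut f C) x" for x
  proof (rule word_lim_unique)
    show "word_lim (?r g) x (word_act g (cut g C) x)"
      using word_lim_finite[OF fin(2)] unfolding act .
    show "word_lim (?r g) x (word_act f (cut f C) x)"
      by (rule word_lim_cancels[OF lin c'])
        (use word_lim_finite[OF fin(1)] act words_letter_ne[OF f] in auto)
  qed
  then show "word_act f (cut f C) = word_act g (cut g C)" by auto
qed

lemma word_act_cut_eventually: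
  assumes f: "f \<in> perm_words X" and x: "x \<in> X"
  shows "\<exists>C0. finite C0 \<and> C0 \<subseteq> X \<and>
    (\<forall>C. finite C \<longrightarrow> C0 \<subseteq> C \<longrightarrow> C \<subseteq> X \<longrightarrow> word_act f (cut f C) x = x_infinity f x)"
proof -
  have w: "f \<in> words (transp_letters X)" using f by (rule perm_words_words)
  obtain P where P: "finite P" "P \<subseteq> pos f"
    "\<And>F. finite F \<Longrightarrow> P \<subseteq> F \<Longrightarrow> F \<subseteq> pos f \<Longrightarrow> word_act f F x = x_infinity f x"
    using x_infinity_lim[OF f x] by (elim word_limE) blast
  \<comment> \<open>All ends of letters of the threshold \<open>P\<close>; once \<open>C\<close>
    contains them, the positions of \<open>P\<close> are among those cut out by
    \<open>C\<close>.\<close>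
  let ?C = "fst ` letter f ` P \<union> snd ` letter f ` P"
  have "word_act f (cut f C) x = x_infinity f x" if "finite C" "?C \<subseteq> C" "C \<subseteq> X" for C
  proof (rule P(3)[OF finite_cut[OF w that(1,3)]])
    show "P \<subseteq> cut f C"
      using P(2) that(2) words_letter_ne[OF w]
      by (force simp: cut_def transp_letters_def case_prod_unfold)
  qed (auto simp: cut_def)
  moreover have "?C \<subseteq> X" using words_letter_in[OF w] P(2) by auto
  ultimately show ?thesis using P(1) by (intro exI[of _ ?C]) auto
qed

lemma x_infinity_equiv:
  assumes "(f, g) \<in> word_equiv (transp_letters X) prod.swap"
    and f: "f \<in> perm_words X" and g: "g \<in> perm_words X" and x: "x \<in> X"
  shows "x_infinity f x = x_infinity g x"
proof -
  obtain C where C: "finite C" "C \<subseteq> X"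
    "\<And>D. finite D \<Longrightarrow> C \<subseteq> D \<Longrightarrow> D \<subseteq> X \<Longrightarrow> word_act f (cut f D) x = x_infinity f x"
    using word_act_cut_eventually[OF f x] by blast
  obtain C' where C': "finite C'" "C' \<subseteq> X"
    "\<And>D. finite D \<Longrightarrow> C' \<subseteq> D \<Longrightarrow> D \<subseteq> X \<Longrightarrow> word_act g (cut g D) x = x_infinity g x"
    using word_act_cut_eventually[OF g x] by blast
  show ?thesis
    using C(3)[of "C \<union> C'"] C'(3)[of "C \<union> C'"] C(1,2) C'(1,2)
      word_act_cut_equiv[OF assms(1), of "C \<union> C'"] by simp
qed

text \<open>The class is formed among all words over \<Lambda> and may contain words outside
  \<open>perm_words X\<close>, so the representative is chosen inside it.\<close>

definition class_act :: "'a set \<Rightarrow> ('a \<times> 'a) bword set \<Rightarrow> 'a \<Rightarrow> 'a" where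
  "class_act X a = x_infinity (SOME f. f \<in> a \<inter> perm_words X)"

abbreviation perm_class :: "'a set \<Rightarrow> ('a \<times> 'a) bword \<Rightarrow> ('a \<times> 'a) bword set" where
  "perm_class X \<equiv> word_class (transp_letters X) prod.swap"

lemma class_act_class:
  assumes f: "f \<in> perm_words X" and x: "x \<in> X"
  shows "class_act X (perm_class X f) x = x_infinity f x"
proof -
  have "f \<in> perm_class X f \<inter> perm_words X"
    using f word_class_self[OF perm_words_words[OF f]] by simp
  then have "(SOME f'. f' \<in> perm_class X f \<inter> perm_words X) \<in> perm_class X f \<inter> perm_words X"
    by (rule someI)
  then show ?thesis
    unfolding class_act_def using x_infinity_equiv[OF word_classD(1) f _ x] by (metis IntE)
qed

lemma group_perm_BF: "group (perm_BF X)"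
  unfolding perm_BF_def
  by (rule group_BF_sub[OF _ admissible_perm_words])
    (use swap_transp_letters word_empty_perm_words in blast)+

lemma carrier_perm_BF: "carrier (perm_BF X) = perm_class X ` perm_words X"
  by (simp add: perm_BF_def carrier_BF_sub)

lemma one_perm_BF: "\<one>\<^bsub>perm_BF X\<^esub> = perm_class X word_empty"
  by (simp add: perm_BF_def one_BF_sub)

lemma mult_perm_BF:
  "f \<in> perm_words X \<Longrightarrow> g \<in> perm_words X \<Longrightarrow>
   perm_class X f \<otimes>\<^bsub>perm_BF X\<^esub> perm_class X g = perm_class X (word_concat f g)"
  by (simp add: perm_BF_def mult_BF_sub perm_words_words)

lemma inv_perm_BF:
  "f \<in> perm_words X \<Longrightarrow> inv\<^bsub>perm_BF X\<^esub> (perm_class X f) = perm_class X (word_inverse prod.swap f)"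
  unfolding perm_BF_def by (rule inv_BF_sub[OF _ admissible_perm_words]) (auto simp: swap_transp_letters)

lemma class_act_in: "a \<in> carrier (perm_BF X) \<Longrightarrow> x \<in> X \<Longrightarrow> class_act X a x \<in> X"
  unfolding carrier_perm_BF
  by (elim imageE) (simp add: class_act_class word_lim_in[OF perm_words_words x_infinity_lim])

text \<open>The left factor acts first, since its positions precede those of the right factor:
  classes act on X from the right.\<close>

lemma class_act_mult:
  assumes "a \<in> carrier (perm_BF X)" "b \<in> carrier (perm_BF X)" and x: "x \<in> X"
  shows "class_act X (a \<otimes>\<^bsub>perm_BF X\<^esub> b) x = class_act X b (class_act X a x)"
proof -
  obtain f g where f: "f \<in> perm_words X" "a = perm_class X f" and g: "g \<in> perm_words X" "b = perm_class X g"
    using assms by (auto simp: carrier_perm_BF)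
  have y: "x_infinity f x \<in> X" using class_act_in[OF assms(1) x] f class_act_class x by metis
  have "x_infinity (word_concat f g) x = x_infinity g (x_infinity f x)"
    by (rule x_infinity_eq[OF perm_words_concat[OF f(1) g(1)] x word_lim_concat[OF
        words_linear[OF perm_words_words[OF f(1)]] words_linear[OF perm_words_words[OF g(1)]]
        x_infinity_lim[OF f(1) x] x_infinity_lim[OF g(1) y]]])
  then show ?thesis
    using f g x y by (simp add: mult_perm_BF class_act_class perm_words_concat)
qed

lemma class_act_one:
  assumes "x \<in> X" shows "class_act X \<one>\<^bsub>perm_BF X\<^esub> x = x"
proof -
  have "occurrences x word_empty = {}" by (simp add: occurrences_def word_empty_def)
  then have "x_infinity word_empty x = x"
    by (rule x_infinity_eq[OF word_empty_perm_words assms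
          word_lim_fixed[OF words_linear[OF word_empty_words]]])
  then show ?thesis
    using assms by (simp add: one_perm_BF class_act_class word_empty_perm_words)
qed

lemma class_act_inv:
  assumes a: "a \<in> carrier (perm_BF X)" and x: "x \<in> X"
  shows "class_act X (inv\<^bsub>perm_BF X\<^esub> a) (class_act X a x) = x"
    "class_act X a (class_act X (inv\<^bsub>perm_BF X\<^esub> a) x) = x"
proof -
  interpret group "perm_BF X" by (rule group_perm_BF)
  show "class_act X (inv\<^bsub>perm_BF X\<^esub> a) (class_act X a x) = x"
    "class_act X a (class_act X (inv\<^bsub>perm_BF X\<^esub> a) x) = x"
    using class_act_mult[OF a inv_closed[OF a] x] class_act_mult[OF inv_closed[OF a] a x]
      class_act_one[OF x] a by simp_all
qed

section \<open>The topology\<close>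

lemma stab_nbhd_eq:
  assumes "C \<subseteq> X"
  shows "stab_nbhd X C = {a \<in> carrier (perm_BF X). \<forall>x\<in>C. class_act X a x = x}"
proof -
  have "(\<forall>x\<in>C. class_act X (perm_class X f) x = x) \<longleftrightarrow> (\<forall>x\<in>C. x_infinity f x = x)"
    if "f \<in> perm_words X" for f
    using class_act_class[OF that] assms by (metis subsetD)
  then show ?thesis by (auto simp: stab_nbhd_def carrier_perm_BF)
qed

lemma word_restrict_empty: "word_restrict word_empty P = word_empty"
  by (simp add: word_restrict_def word_empty_def)

lemma perm_proj_group_hom:
  assumes A: "A \<subseteq> transp_letters X" "\<And>l. l \<in> A \<Longrightarrow> prod.swap l \<in> A"
  shows "group_hom (perm_BF X) (BF A prod.swap) (BF_proj A prod.swap)"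
proof -
  have "BF_proj A prod.swap \<in> hom (perm_BF X) (BF A prod.swap)"
    unfolding perm_BF_def by (rule BF_proj_hom) (use A perm_words_words in auto)
  moreover have "group (BF A prod.swap)"
    using A(2) by (intro group_BF) auto
  ultimately show ?thesis
    using group_perm_BF by (simp add: group_hom_def group_hom_axioms_def)
qed

abbreviation proj_kernel :: "'a set \<Rightarrow> ('a \<times> 'a) set \<Rightarrow> ('a \<times> 'a) bword set set" where
  "proj_kernel X A \<equiv> kernel (perm_BF X) (BF A prod.swap) (BF_proj A prod.swap)"

text \<open>The projection to the smaller alphabet factors through the projection to the larger
  one.\<close>

lemma kernel_proj_mono:
  assumes "A \<subseteq> B" "B \<subseteq> transp_letters X"
    "\<And>l. l \<in> A \<Longrightarrow> prod.swap l \<in> A" "\<And>l. l \<in> B \<Longrightarrow> prod.swap l \<in> B"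
  shows "proj_kernel X B
     \<subseteq> proj_kernel X A"
proof
  fix a assume a: "a \<in> proj_kernel X B"
  then obtain f where f: "f \<in> words (transp_letters X)" "a = perm_class X f"
    unfolding kernel_def carrier_perm_BF using perm_words_words by blast
  let ?fB = "letter_restrict f B"
  have fB: "?fB \<in> words B" using f(1) assms(2) by (rule word_restrict_words) auto
  have A: "A \<subseteq> transp_letters X" using assms by blast
  have "word_class B prod.swap ?fB = word_class B prod.swap word_empty"
    using a f BF_proj_class[OF f(1) assms(2,4)] by (simp add: kernel_def one_BF)
  then have "BF_proj A prod.swap (word_class B prod.swap ?fB)
     = BF_proj A prod.swap (word_class B prod.swap word_empty)" by simp
  then have "word_class A prod.swap (letter_restrict ?fB A) =
      word_class A prod.swap word_empty"
    by (simp only: BF_proj_class[OF fB assms(1,3)] BF_proj_class[OF word_empty_words assms(1,3)]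
        word_restrict_empty)
  moreover have "letter_restrict ?fB A = letter_restrict f A"
    unfolding word_restrict_restrict by (rule word_restrict_cong) (use assms(1) in auto)
  ultimately show "a \<in> proj_kernel X A"
    using a f BF_proj_class[OF f(1) A assms(3)] by (simp add: kernel_def one_BF)
qed

lemma subgroup_stab_nbhd:
  assumes C: "C \<subseteq> X" shows "subgroup (stab_nbhd X C) (perm_BF X)"
proof -
  interpret group "perm_BF X" by (rule group_perm_BF)
  let ?S = "{a \<in> carrier (perm_BF X). \<forall>x\<in>C. class_act X a x = x}"
  show ?thesis
    unfolding stab_nbhd_eq[OF C]
  proof (rule subgroupI)
    fix a assume a: "a \<in> ?S"
    then show "inv\<^bsub>perm_BF X\<^esub> a \<in> ?S"
      using class_act_inv(1)[of a X] C by fastforce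
    fix b assume "b \<in> ?S"
    then show "a \<otimes>\<^bsub>perm_BF X\<^esub> b \<in> ?S"
      using a class_act_mult[of a X b] C by (auto simp: subset_iff)
  next
    have "\<one>\<^bsub>perm_BF X\<^esub> \<in> ?S"
      by (auto intro!: class_act_one subsetD[OF C])
    then show "?S \<noteq> {}" by blast
  qed auto
qed

lemma proj_transp_group_hom:
  "C \<subseteq> X \<Longrightarrow> group_hom (perm_BF X) (BF (transp_letters C) prod.swap) (BF_proj (transp_letters C) prod.swap)"
  by (intro perm_proj_group_hom transp_letters_mono) (auto simp: swap_transp_letters)

lemma subgroup_basic_nbhd:
  assumes "C \<subseteq> X" shows "subgroup (basic_nbhd X C) (perm_BF X)"
  unfolding basic_nbhd_def
  by (rule group.subgroups_Inter_pair[OF group_perm_BF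
        group_hom.subgroup_kernel[OF proj_transp_group_hom[OF assms]] subgroup_stab_nbhd[OF assms]])

lemma basic_nbhd_mono:
  assumes "C \<subseteq> D" "D \<subseteq> X" shows "basic_nbhd X D \<subseteq> basic_nbhd X C"
proof -
  have "stab_nbhd X D \<subseteq> stab_nbhd X C" using assms by (auto simp: stab_nbhd_def)
  moreover have "proj_kernel X (transp_letters D)
     \<subseteq> proj_kernel X (transp_letters C)"
    using assms by (intro kernel_proj_mono transp_letters_mono) (auto simp: swap_transp_letters)
  ultimately show ?thesis by (auto simp: basic_nbhd_def)
qed

abbreviation basic_nbhds :: "'a set \<Rightarrow> ('a \<times> 'a) bword set set set" where
  "basic_nbhds X \<equiv> {basic_nbhd X C | C. C \<subseteq> X \<and> finite C}"

lemma perm_subgroup_basis: "subgroup_basis (perm_BF X) (basic_nbhds X)"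
proof -
  interpret G: group "perm_BF X" by (rule group_perm_BF)
  show ?thesis
  proof (intro subgroup_basis.intro subgroup_basis_axioms.intro group_perm_BF)
    show "basic_nbhds X \<noteq> {}" by blast
  next
    fix U assume "U \<in> basic_nbhds X"
    then show "subgroup U (perm_BF X)" using subgroup_basic_nbhd by blast
  next
    fix U V assume "U \<in> basic_nbhds X" "V \<in> basic_nbhds X"
    then obtain C D where CD: "U = basic_nbhd X C" "C \<subseteq> X" "finite C" "V = basic_nbhd X D" "D \<subseteq> X" "finite D"
      by blast
    then have "basic_nbhd X (C \<union> D) \<subseteq> U \<inter> V" using basic_nbhd_mono[of _ "C \<union> D" X] by simp
    moreover have "C \<union> D \<subseteq> X" "finite (C \<union> D)" using CD by auto
    ultimately show "\<exists>W\<in>basic_nbhds X. W \<subseteq> U \<inter> V" by blast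
  next
    fix U g assume "U \<in> basic_nbhds X" and g: "g \<in> carrier (perm_BF X)"
    then obtain C where C: "U = basic_nbhd X C" "C \<subseteq> X" "finite C" by blast
    \<comment> \<open>The conjugate applies the inverse of \<open>g\<close> first, so
      \<open>v\<close> must fix the images of \<open>C\<close> under that inverse. The kernel part
      of the neighbourhood is normal and only needs \<open>C\<close> itself.\<close>
    let ?D = "C \<union> class_act X (inv\<^bsub>perm_BF X\<^esub> g) ` C"
    have D: "?D \<subseteq> X" "finite ?D" using C g class_act_in[of "inv\<^bsub>perm_BF X\<^esub> g" X] by auto
    interpret h: group_hom "perm_BF X" "BF (transp_letters C) prod.swap" "BF_proj (transp_letters C) prod.swap"
      by (rule proj_transp_group_hom[OF C(2)])
    have "inv\<^bsub>perm_BF X\<^esub> g \<otimes>\<^bsub>perm_BF X\<^esub> v \<otimes>\<^bsub>perm_BF X\<^esub> g \<in> U" if v: "v \<in> basic_nbhd X ?D" for v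
    proof -
      have "v \<in> basic_nbhd X C" using v basic_nbhd_mono[OF _ D(1), of C] by blast
      then have "inv\<^bsub>perm_BF X\<^esub> g \<otimes>\<^bsub>perm_BF X\<^esub> v \<otimes>\<^bsub>perm_BF X\<^esub> g
          \<in> proj_kernel X (transp_letters C)"
        using normal.inv_op_closed1[OF h.normal_kernel g] by (simp add: basic_nbhd_def)
      moreover have vG: "v \<in> carrier (perm_BF X)"
        using subgroup.mem_carrier[OF subgroup_basic_nbhd[OF D(1)] v] .
      have "class_act X (inv\<^bsub>perm_BF X\<^esub> g \<otimes>\<^bsub>perm_BF X\<^esub> v \<otimes>\<^bsub>perm_BF X\<^esub> g) x = x" if x: "x \<in> C" for x
      proof -
        have xX: "x \<in> X" "class_act X (inv\<^bsub>perm_BF X\<^esub> g) x \<in> X"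
          using x C class_act_in[OF G.inv_closed[OF g], of x] by auto
        have "class_act X v (class_act X (inv\<^bsub>perm_BF X\<^esub> g) x) = class_act X (inv\<^bsub>perm_BF X\<^esub> g) x"
          using v x by (simp add: basic_nbhd_def stab_nbhd_eq[OF D(1)])
        then show ?thesis
          using xX g vG class_act_inv(2)[OF g xX(1)] by (simp add: class_act_mult)
      qed
      ultimately show ?thesis
        using g vG by (simp add: C(1) basic_nbhd_def stab_nbhd_eq[OF C(2)])
    qed
    then show "\<exists>V\<in>basic_nbhds X.
        \<forall>v\<in>V. inv\<^bsub>perm_BF X\<^esub> g \<otimes>\<^bsub>perm_BF X\<^esub> v \<otimes>\<^bsub>perm_BF X\<^esub> g \<in> U"
      using D by blast
  qed
qed

section \<open>Approximation by finite words\<close>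

text \<open>Splitting off the least position writes a finite word as one letter followed by a
  shorter word. This connects words indexed by ordered sets with lists of letters.\<close>

lemma finite_word_class:
  assumes "finite (pos w)" "w \<in> words \<Lambda>"
  shows "word_class \<Lambda> i w = letter_prod (BF \<Lambda> i) (\<lambda>l. word_class \<Lambda> i (word_single l)) (letters_on w (pos w))"
  using assms
proof (induction "card (pos w)" arbitrary: w)
  case 0
  then have e: "pos w = {}" by simp
  have "word_class \<Lambda> i w = word_class \<Lambda> i word_empty"
    using 0 e by (intro word_class_iso word_empty_words empty_iso) (simp_all add: word_empty_def)
  moreover have "letters_on w (pos w) = []"
    using words_linear[OF 0(3)] e by (simp add: letters_on_def enum_by_empty order_on_defs)
  ultimately show ?case by (simp add: one_BF)
next
  case (Suc n)
  have lin: "linear_word w" using Suc.prems(2) by (rule words_linear)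
  have "pos w \<noteq> {}" using Suc by auto
  then obtain m where m: "m \<in> pos w" "\<forall>t\<in>pos w. (m, t) \<in> ord_rel w"
    using finite_has_least[OF lin Suc.prems(1)] by blast
  have an: "antisym (ord_rel w)" and re: "refl_on (pos w) (ord_rel w)"
    using lin by (simp_all add: order_on_defs)
  let ?v = "word_restrict w (pos w - {m})" and ?l = "letter w m"
  have pv: "pos ?v = pos w - {m}" by auto
  have v: "?v \<in> words \<Lambda>"
    by (rule word_restrict_words[OF Suc.prems(2) subset_refl])
      (use Suc.prems(2) in \<open>auto simp: words_def\<close>)
  have lL: "?l \<in> \<Lambda>" using Suc.prems(2) m by (auto simp: words_def)
  \<comment> \<open>The index 0 is that of the only position of \<open>word_single\<close>; the
    remaining positions keep their names in the right copy.\<close>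
  let ?\<phi> = "\<lambda>s. if s = m then left_copy (?l, 0) else right_copy s"
  have "word_iso w (word_concat (word_single ?l) ?v)"
    unfolding word_iso_def
  proof (intro exI[of _ ?\<phi>] conjI)
    show "bij_betw ?\<phi> (pos w) (pos (word_concat (word_single ?l) ?v))"
      using m(1) unfolding bij_betw_def pos_concat pv inj_on_def
      by (auto simp: word_single_def image_iff)
    show "\<forall>s\<in>pos w. \<forall>t\<in>pos w. (s, t) \<in> ord_rel w \<longleftrightarrow>
        (?\<phi> s, ?\<phi> t) \<in> ord_rel (word_concat (word_single ?l) ?v)"
      using m re an by (auto simp: word_single_def refl_on_def dest: antisymD)
    show "\<forall>s\<in>pos w. letter w s = letter (word_concat (word_single ?l) ?v) (?\<phi> s)"
      by (simp add: word_single_def)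
  qed
  then have "word_class \<Lambda> i w = word_class \<Lambda> i (word_concat (word_single ?l) ?v)"
    using Suc.prems(2) v lL by (intro word_class_iso concat_words word_single_words)
  also have "\<dots> = word_class \<Lambda> i (word_single ?l) \<otimes>\<^bsub>BF \<Lambda> i\<^esub> word_class \<Lambda> i ?v"
    using v lL by (simp add: mult_BF word_single_words)
  also have "word_class \<Lambda> i ?v =
      letter_prod (BF \<Lambda> i) (\<lambda>l. word_class \<Lambda> i (word_single l)) (letters_on ?v (pos ?v))"
    by (rule Suc.hyps(1)) (use Suc.hyps(2) Suc.prems(1) m(1) v pv in auto)
  also have "letters_on ?v (pos ?v) = letters_on w (pos w - {m})"
    unfolding pv using lin Suc.prems(1) by (intro letters_on_restrict) auto
  also have "letters_on w (pos w) = ?l # letters_on w (pos w - {m})"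
  proof -
    have "enum_by (ord_rel w) ({m} \<union> (pos w - {m})) = enum_by (ord_rel w) {m} @ enum_by (ord_rel w) (pos w - {m})"
      by (rule enum_by_append[OF lin]) (use m Suc.prems(1) in auto)
    moreover have "{m} \<union> (pos w - {m}) = pos w" using m by auto
    ultimately show ?thesis by (simp add: letters_on_def enum_by_singleton[OF an])
  qed
  ultimately show ?case by simp
qed

abbreviation perm_letter :: "'a set \<Rightarrow> 'a \<times> 'a \<Rightarrow> ('a \<times> 'a) bword set" where
  "perm_letter X l \<equiv> perm_class X (word_single l)"

abbreviation perm_prod :: "'a set \<Rightarrow> ('a \<times> 'a) list \<Rightarrow> ('a \<times> 'a) bword set" where
  "perm_prod X \<equiv> letter_prod (perm_BF X) (perm_letter X)"

lemma perm_letter_carrier: "l \<in> transp_letters X \<Longrightarrow> perm_letter X l \<in> carrier (perm_BF X)"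
  by (simp add: carrier_perm_BF word_single_perm_words)

lemma finite_perm_class:
  assumes "finite (pos w)" "w \<in> words (transp_letters X)"
  shows "perm_class X w = perm_prod X (letters_on w (pos w))"
  using finite_word_class[OF assms] by (simp add: letter_prod_def perm_BF_def BF_sub_def)

text \<open>A representative is truncated to the letters in \<Lambda>(D). The inclusion of
  \<open>C\<close> in \<open>D\<close> makes the projections to \<Lambda>(C) agree, and
  \<open>D\<close> is chosen so large that the truncation moves the relevant points as the whole
  word does.\<close>

lemma finite_approximation:
  assumes a: "a \<in> carrier (perm_BF X)" and C: "finite C" "C \<subseteq> X"
  shows "\<exists>D ls. finite D \<and> C \<subseteq> D \<and> D \<subseteq> X \<and> set ls \<subseteq> transp_letters D \<and>
     inv\<^bsub>perm_BF X\<^esub> a \<otimes>\<^bsub>perm_BF X\<^esub> perm_prod X ls \<in> basic_nbhd X C \<and>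
     (\<forall>x\<in>C. fold letter_act ls x = class_act X a x)"
proof -
  interpret G: group "perm_BF X" by (rule group_perm_BF)
  obtain f where f: "f \<in> perm_words X" "a = perm_class X f" using a by (auto simp: carrier_perm_BF)
  have fw: "f \<in> words (transp_letters X)" using f by (simp add: perm_words_words)
  have ia: "inv\<^bsub>perm_BF X\<^esub> a \<in> carrier (perm_BF X)" using a by simp
  \<comment> \<open>On \<open>C\<close> the truncation must agree with \<open>a\<close> for the
    final claim; on the preimage of \<open>C\<close> it must agree so that the quotient, which
    applies the inverse of \<open>a\<close> first, fixes \<open>C\<close>.\<close>
  let ?E = "C \<union> class_act X (inv\<^bsub>perm_BF X\<^esub> a) ` C"
  have E: "finite ?E" "?E \<subseteq> X" using C class_act_in[OF ia] by auto
  have "\<exists>K. \<forall>x\<in>?E. finite (K x) \<and> K x \<subseteq> X \<and>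
    (\<forall>C. finite C \<longrightarrow> K x \<subseteq> C \<longrightarrow> C \<subseteq> X \<longrightarrow> word_act f (cut f C) x = x_infinity f x)"
    by (intro bchoice ballI word_act_cut_eventually[OF f(1)]) (use E(2) in blast)
  then obtain K where K: "\<forall>x\<in>?E. finite (K x) \<and> K x \<subseteq> X \<and>
    (\<forall>C. finite C \<longrightarrow> K x \<subseteq> C \<longrightarrow> C \<subseteq> X \<longrightarrow> word_act f (cut f C) x = x_infinity f x)" ..
  define D where "D = C \<union> (\<Union>x\<in>?E. K x)"
  have D: "finite D" "C \<subseteq> D" "D \<subseteq> X" using K E(1) C by (auto simp: D_def)
  have act: "word_act f (cut f D) x = x_infinity f x" if "x \<in> ?E" for x
    using bspec[OF K that] D that unfolding D_def by blast
  define w where "w = letter_restrict f (transp_letters D)"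
  have pw: "pos w = cut f D" by (auto simp: w_def cut_def)
  have finw: "finite (pos w)" unfolding pw using finite_cut[OF fw D(1,3)] .
  have wD: "w \<in> words (transp_letters D)"
    unfolding w_def using fw transp_letters_mono[OF D(3)] by (rule word_restrict_words) auto
  have wX: "w \<in> words (transp_letters X)"
    unfolding w_def using fw subset_refl
    by (rule word_restrict_words) (use transp_letters_mono[OF D(3)] in auto)
  have wp: "w \<in> perm_words X" using wX finw by (rule finite_perm_words)
  define ls where "ls = letters_on w (pos w)"
  have ls: "set ls \<subseteq> transp_letters D"
    using wD set_enum_by[OF words_linear[OF wX] finw]
    by (auto simp: ls_def letters_on_def words_def)
  have cls: "perm_class X w = perm_prod X ls"
    unfolding ls_def using finw wX by (rule finite_perm_class)
  have actw: "fold letter_act ls x = x_infinity f x" if "x \<in> ?E" for x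
  proof -
    have "fold letter_act ls x = word_act w (pos w) x" by (simp add: ls_def word_act_def)
    also have "\<dots> = word_act f (cut f D) x"
      unfolding pw unfolding w_def
      by (subst word_act_restrict[OF words_linear[OF fw]]) (use finw pw in \<open>auto simp: cut_def\<close>)
    finally show ?thesis using act[OF that] by simp
  qed
  have cact: "class_act X (perm_class X w) x = class_act X a x" if "x \<in> ?E" for x
  proof -
    have "x \<in> X" using that E by blast
    then show ?thesis
      using x_infinity_finite[OF wX finw] actw[OF that] f wp
      by (simp add: class_act_class ls_def word_act_def)
  qed
  have wG: "perm_class X w \<in> carrier (perm_BF X)" using wp by (simp add: carrier_perm_BF)
  let ?u = "inv\<^bsub>perm_BF X\<^esub> a \<otimes>\<^bsub>perm_BF X\<^esub> perm_class X w"
  have uG: "?u \<in> carrier (perm_BF X)" using wG ia by simp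
  interpret h: group_hom "perm_BF X" "BF (transp_letters C) prod.swap" "BF_proj (transp_letters C) prod.swap"
    by (rule proj_transp_group_hom[OF C(2)])
  have "BF_proj (transp_letters C) prod.swap (perm_class X w) = BF_proj (transp_letters C) prod.swap a"
  proof -
    have "letter_restrict w (transp_letters C) = letter_restrict f (transp_letters C)"
      unfolding w_def word_restrict_restrict
      by (rule word_restrict_cong) (use transp_letters_mono[OF D(2)] in auto)
    then show ?thesis
      using BF_proj_class[OF wX transp_letters_mono[OF C(2)]]
        BF_proj_class[OF fw transp_letters_mono[OF C(2)]] f(2) by (simp add: swap_transp_letters)
  qed
  then have "BF_proj (transp_letters C) prod.swap ?u = \<one>\<^bsub>BF (transp_letters C) prod.swap\<^esub>"
    using a ia wG by simp
  moreover have "class_act X ?u x = x" if "x \<in> C" for x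
    using that C ia wG cact[of "class_act X (inv\<^bsub>perm_BF X\<^esub> a) x"] class_act_inv(2)[OF a]
    by (auto simp: class_act_mult)
  ultimately have "?u \<in> basic_nbhd X C"
    using uG by (simp add: basic_nbhd_def kernel_def stab_nbhd_eq[OF C(2)])
  moreover have "fold letter_act ls x = class_act X a x" if "x \<in> C" for x
    using actw that f C by (auto simp: class_act_class)
  ultimately show ?thesis using D ls cls by auto
qed

lemma letter_prod_perm_closed:
  "set ls \<subseteq> transp_letters X \<Longrightarrow> perm_prod X ls \<in> carrier (perm_BF X)"
  by (rule monoid.letter_prod_closed[OF group.is_monoid[OF group_perm_BF]])
    (auto intro: perm_letter_carrier)

lemma letter_prod_generate:
  "set ls \<subseteq> transp_letters X \<Longrightarrow>
   perm_prod X ls \<in> generate (perm_BF X) (perm_letter X ` transp_letters X)"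
proof (induction ls)
  case (Cons l ls)
  then have "perm_letter X l \<in> perm_letter X ` transp_letters X" by simp
  from generate.eng[OF generate.incl[OF this] Cons.IH] show ?case using Cons.prems by simp
qed (simp add: generate.one)

lemma admissible_perm_topology:
  "admissible_topology (transp_letters X) prod.swap (perm_words X) (perm_topology X)"
  unfolding admissible_topology_def
proof (intro conjI allI impI)
  interpret subgroup_basis "perm_BF X" "basic_nbhds X"
    by (rule perm_subgroup_basis)
  show "topological_group_on (BF_sub (transp_letters X) prod.swap (perm_words X)) (perm_topology X)"
    using topological_group by (simp add: perm_topology_def perm_BF_def)
  show "openin (perm_topology X) U"
    if "openin (natural_topology (transp_letters X) prod.swap (perm_words X)) U" for U
    unfolding perm_topology_def
  proof (rule finer_than)
    show "openin (subgroup_topology (perm_BF X)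
        {proj_kernel X A | A.
          A \<subseteq> transp_letters X \<and> prod.swap ` A = A \<and> finite A}) U"
      using that by (simp add: natural_topology_def perm_BF_def)
  next
    fix K assume "K \<in> {proj_kernel X A | A.
          A \<subseteq> transp_letters X \<and> prod.swap ` A = A \<and> finite A}"
    then obtain A where A: "K = proj_kernel X A"
      "A \<subseteq> transp_letters X" "prod.swap ` A = A" "finite A" by blast
    have sw: "prod.swap l \<in> A" if "l \<in> A" for l using A(3) that by blast
    \<comment> \<open>The ends of the finitely many letters in \<open>A\<close>, so that the
      projection to \<open>A\<close> factors through the projection to the letters over
      \<open>?C\<close>.\<close>
    let ?C = "fst ` A \<union> snd ` A"
    have C: "?C \<subseteq> X" "finite ?C" "A \<subseteq> transp_letters ?C"
      using A(2,4) by (force simp: transp_letters_def)+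
    have "proj_kernel X (transp_letters ?C) \<subseteq> K"
      unfolding A(1)
      by (rule kernel_proj_mono[OF C(3) transp_letters_mono[OF C(1)] sw]) (auto simp: swap_transp_letters)
    then have "basic_nbhd X ?C \<subseteq> K" by (auto simp: basic_nbhd_def)
    moreover have "subgroup K (perm_BF X)"
      unfolding A(1) by (rule group_hom.subgroup_kernel[OF perm_proj_group_hom[OF A(2) sw]])
    ultimately show "subgroup K (perm_BF X) \<and> (\<exists>W\<in>basic_nbhds X. W \<subseteq> K)"
      using C by blast
  qed
  show "perm_topology X closure_of
      generate (BF_sub (transp_letters X) prod.swap (perm_words X)) (perm_letter X ` transp_letters X)
    = topspace (perm_topology X)"
  proof (rule antisym[OF closure_of_subset_topspace], rule subsetI)
    fix a assume "a \<in> topspace (perm_topology X)"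
    then have a: "a \<in> carrier (perm_BF X)" by (simp add: perm_topology_def topspace_eq)
    show "a \<in> perm_topology X closure_of
      generate (BF_sub (transp_letters X) prod.swap (perm_words X)) (perm_letter X ` transp_letters X)"
      unfolding perm_topology_def perm_BF_def[symmetric]
    proof (rule in_closureI[OF a])
      fix U assume "U \<in> basic_nbhds X"
      then obtain C where C: "U = basic_nbhd X C" "C \<subseteq> X" "finite C" by blast
      obtain D ls where D: "D \<subseteq> X" "set ls \<subseteq> transp_letters D"
        "inv\<^bsub>perm_BF X\<^esub> a \<otimes>\<^bsub>perm_BF X\<^esub> perm_prod X ls \<in> U"
        using finite_approximation[OF a C(3,2)] C(1) by blast
      have ls: "set ls \<subseteq> transp_letters X" using D transp_letters_mono by blast
      show "\<exists>u\<in>U. a \<otimes>\<^bsub>perm_BF X\<^esub> u \<in> generate (perm_BF X) (perm_letter X ` transp_letters X)"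
        using D(3) letter_prod_generate[OF ls] letter_prod_perm_closed[OF ls] a
        by (intro bexI[OF _ D(3)]) (simp add: cancel_left)
    qed
  qed
qed

section \<open>The epimorphism onto \<Sigma>(X), its kernel, and the cardinality of the
  presentation\<close>

section \<open>The epimorphism and its kernel\<close>

text \<open>Inverting turns the right action into a homomorphism for composition of maps. The
  restriction is required because elements of \<open>Bij X\<close> are extensional.\<close>

definition perm_rep :: "'a set \<Rightarrow> ('a \<times> 'a) bword set \<Rightarrow> 'a \<Rightarrow> 'a" where
  "perm_rep X a = restrict (class_act X (inv\<^bsub>perm_BF X\<^esub> a)) X"

lemma perm_rep_Bij:
  assumes a: "a \<in> carrier (perm_BF X)" shows "perm_rep X a \<in> Bij X"
proof -
  interpret group "perm_BF X" by (rule group_perm_BF)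
  have "bij_betw (class_act X (inv\<^bsub>perm_BF X\<^esub> a)) X X"
    by (rule bij_betw_byWitness[where f' = "class_act X a"])
      (use class_act_inv[OF a] class_act_in[OF a] class_act_in[OF inv_closed[OF a]] in auto)
  then show ?thesis by (simp add: Bij_def perm_rep_def bij_betw_restrict_eq)
qed

lemma perm_rep_hom: "perm_rep X \<in> hom (perm_BF X) (BijGroup X)"
proof (rule homI)
  interpret group "perm_BF X" by (rule group_perm_BF)
  show "perm_rep X a \<in> carrier (BijGroup X)" if "a \<in> carrier (perm_BF X)" for a
    using perm_rep_Bij[OF that] by (simp add: BijGroup_def)
  fix a b assume ab: "a \<in> carrier (perm_BF X)" "b \<in> carrier (perm_BF X)"
  have "perm_rep X (a \<otimes>\<^bsub>perm_BF X\<^esub> b) = compose X (perm_rep X a) (perm_rep X b)"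
  proof
    fix x
    show "perm_rep X (a \<otimes>\<^bsub>perm_BF X\<^esub> b) x = compose X (perm_rep X a) (perm_rep X b) x"
      using ab class_act_in[OF inv_closed[OF ab(2)], of x]
      by (simp add: perm_rep_def compose_def inv_mult_group class_act_mult)
  qed
  then show "perm_rep X (a \<otimes>\<^bsub>perm_BF X\<^esub> b) = perm_rep X a \<otimes>\<^bsub>BijGroup X\<^esub> perm_rep X b"
    using perm_rep_Bij[OF ab(1)] perm_rep_Bij[OF ab(2)] by (simp add: BijGroup_def)
qed

lemma kernel_perm_rep:
  "kernel (perm_BF X) (BijGroup X) (perm_rep X) = {a \<in> carrier (perm_BF X). \<forall>x\<in>X. class_act X a x = x}"
proof -
  interpret group "perm_BF X" by (rule group_perm_BF)
  have "perm_rep X a = (\<lambda>x\<in>X. x) \<longleftrightarrow> (\<forall>x\<in>X. class_act X a x = x)" if a: "a \<in> carrier (perm_BF X)" for a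
  proof -
    have "perm_rep X a = (\<lambda>x\<in>X. x) \<longleftrightarrow> (\<forall>x\<in>X. class_act X (inv\<^bsub>perm_BF X\<^esub> a) x = x)"
      by (auto simp: perm_rep_def fun_eq_iff restrict_def)
    also have "\<dots> \<longleftrightarrow> (\<forall>x\<in>X. class_act X a x = x)"
      using class_act_inv[OF a] by metis
    finally show ?thesis .
  qed
  then show ?thesis by (auto simp: kernel_def BijGroup_def)
qed

lemma class_act_letter:
  assumes "l \<in> transp_letters X" "x \<in> X"
  shows "class_act X (perm_letter X l) x = letter_act l x"
proof -
  have w: "word_single l \<in> words (transp_letters X)" using assms(1) by (rule word_single_words)
  have pos: "pos (word_single l) = {(l, 0)}" "letter (word_single l) (l, 0) = l"
    by (simp_all add: word_single_def)
  have "x_infinity (word_single l) x = word_act (word_single l) {(l, 0)} x"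
    using x_infinity_finite[OF w _ assms(2)] by (simp add: pos)
  then show ?thesis
    using word_act_singleton[OF words_linear[OF w]] assms
    by (simp add: class_act_class word_single_perm_words pos)
qed

lemma class_act_letter_prod:
  assumes "set ls \<subseteq> transp_letters X" "x \<in> X"
  shows "class_act X (perm_prod X ls) x = fold letter_act ls x"
  using assms
proof (induction ls arbitrary: x)
  case Nil
  then show ?case by (simp add: class_act_one)
next
  case (Cons l ls)
  have "letter_act l x \<in> X"
    using fold_letter_act_in[of "[l]" X x] Cons.prems by simp
  then show ?case
    using Cons by (simp add: class_act_mult perm_letter_carrier letter_prod_perm_closed class_act_letter)
qed

lemma inv_perm_letter:
  assumes "l \<in> transp_letters X"
  shows "inv\<^bsub>perm_BF X\<^esub> (perm_letter X l) = perm_letter X (prod.swap l)"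
proof -
  have w: "word_single l \<in> words (transp_letters X)" using assms by (rule word_single_words)
  have "word_iso (word_inverse prod.swap (word_single l)) (word_single (prod.swap l))"
    unfolding word_iso_def by (rule exI[of _ "\<lambda>_. (prod.swap l, 0)"]) (auto simp: word_single_def word_inverse_def)
  then have "perm_class X (word_inverse prod.swap (word_single l)) = perm_letter X (prod.swap l)"
    using inverse_words[OF w swap_transp_letters] swap_transp_letters[OF assms]
    by (intro word_class_iso word_single_words) auto
  then show ?thesis using inv_perm_BF[OF word_single_perm_words[OF assms]] by simp
qed

text \<open>The relators spelled with letters only, an inverse being the swapped letter. In this
  form both their action on X and their image in a quotient are products over a list.\<close>

definition relator_lists :: "'a set \<Rightarrow> ('a \<times> 'a) list set" where
  "relator_lists X = {[(x, y), (x, y)] | x y. x \<in> X \<and> y \<in> X \<and> x \<noteq> y}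
     \<union> {[(x, y), (z, w), (y, x), (w, z)] | x y z w. {x, y, z, w} \<subseteq> X \<and> card {x, y, z, w} = 4}
     \<union> {[(x, y), (x, z), (y, x), (z, y)] | x y z. {x, y, z} \<subseteq> X \<and> card {x, y, z} = 3}"

lemma card_4_distinct: "card {x, y, z, w} = 4 \<Longrightarrow> x \<noteq> y \<and> x \<noteq> z \<and> x \<noteq> w \<and> y \<noteq> z \<and> y \<noteq> w \<and> z \<noteq> w"
  by (auto simp: card_insert_if split: if_splits)

lemma card_3_distinct: "card {x, y, z} = 3 \<Longrightarrow> x \<noteq> y \<and> x \<noteq> z \<and> y \<noteq> z"
  by (auto simp: card_insert_if split: if_splits)

lemma relator_lists_letters: "ls \<in> relator_lists X \<Longrightarrow> set ls \<subseteq> transp_letters X"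
  by (auto simp: relator_lists_def transp_letters_def dest!: card_4_distinct card_3_distinct)

lemma relator_lists_act: "ls \<in> relator_lists X \<Longrightarrow> fold letter_act ls = id"
  by (auto simp: relator_lists_def fun_eq_iff letter_act_def Transposition.transpose_def
      dest!: card_4_distinct card_3_distinct)

lemma Collect_image_cong2:
  assumes "\<And>x y. P x y \<Longrightarrow> f x y = g x y"
  shows "{f x y | x y. P x y} = {g x y | x y. P x y}"
  using assms by (metis (mono_tags, lifting))

lemma Collect_image_cong3:
  assumes "\<And>x y z. P x y z \<Longrightarrow> f x y z = g x y z"
  shows "{f x y z | x y z. P x y z} = {g x y z | x y z. P x y z}"
  using assms by (metis (mono_tags, lifting))

lemma Collect_image_cong4:
  assumes "\<And>x y z w. P x y z w \<Longrightarrow> f x y z w = g x y z w"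
  shows "{f x y z w | x y z w. P x y z w} = {g x y z w | x y z w. P x y z w}"
  using assms by (metis (mono_tags, lifting))

lemma perm_relators_eq:
  "perm_relators X = perm_prod X ` relator_lists X"
proof -
  interpret group "perm_BF X" by (rule group_perm_BF)
  let ?P = "perm_prod X" and ?T = "transp_gen X"
  have c: "?T x y \<in> carrier (perm_BF X)" "inv\<^bsub>perm_BF X\<^esub> (?T x y) = ?T y x"
    if "x \<in> X" "y \<in> X" "x \<noteq> y" for x y
    using that inv_perm_letter[of "(x, y)" X] perm_letter_carrier[of "(x, y)" X]
    by (auto simp: transp_gen_def transp_letters_def)
  have 1: "?T x y [^]\<^bsub>perm_BF X\<^esub> (2::nat) = ?P [(x, y), (x, y)]" if "x \<in> X" "y \<in> X" "x \<noteq> y" for x y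
    using c(1)[OF that] by (simp add: numeral_2_eq_2 transp_gen_def)
  have 2: "?T x y \<otimes>\<^bsub>perm_BF X\<^esub> ?T z w \<otimes>\<^bsub>perm_BF X\<^esub> inv\<^bsub>perm_BF X\<^esub> (?T x y) \<otimes>\<^bsub>perm_BF X\<^esub> inv\<^bsub>perm_BF X\<^esub> (?T z w)
      = ?P [(x, y), (z, w), (y, x), (w, z)]" if "{x, y, z, w} \<subseteq> X" "card {x, y, z, w} = 4" for x y z w
  proof -
    have "x \<noteq> y" "z \<noteq> w" "y \<noteq> x" "w \<noteq> z" using card_4_distinct[OF that(2)] by auto
    then show ?thesis
      using c[of x y] c[of z w] c[of y x] c[of w z] that(1) by (simp add: m_assoc transp_gen_def)
  qed
  have 3: "?T x y \<otimes>\<^bsub>perm_BF X\<^esub> ?T x z \<otimes>\<^bsub>perm_BF X\<^esub> inv\<^bsub>perm_BF X\<^esub> (?T x y) \<otimes>\<^bsub>perm_BF X\<^esub> inv\<^bsub>perm_BF X\<^esub> (?T y z)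
      = ?P [(x, y), (x, z), (y, x), (z, y)]" if "{x, y, z} \<subseteq> X" "card {x, y, z} = 3" for x y z
  proof -
    have "x \<noteq> y" "x \<noteq> z" "y \<noteq> x" "y \<noteq> z" "z \<noteq> y" using card_3_distinct[OF that(2)] by auto
    then show ?thesis
      using c[of x y] c[of x z] c[of y x] c[of y z] c[of z y] that(1) by (simp add: m_assoc transp_gen_def)
  qed
  have "{?T x y [^]\<^bsub>perm_BF X\<^esub> (2::nat) | x y. x \<in> X \<and> y \<in> X \<and> x \<noteq> y} =
      {?P [(x, y), (x, y)] | x y. x \<in> X \<and> y \<in> X \<and> x \<noteq> y}"
    by (rule Collect_image_cong2) (use 1 in blast)
  moreover have "{?T x y \<otimes>\<^bsub>perm_BF X\<^esub> ?T z w \<otimes>\<^bsub>perm_BF X\<^esub> inv\<^bsub>perm_BF X\<^esub> (?T x y) \<otimes>\<^bsub>perm_BF X\<^esub> inv\<^bsub>perm_BF X\<^esub> (?T z w)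
      | x y z w. {x, y, z, w} \<subseteq> X \<and> card {x, y, z, w} = 4} =
      {?P [(x, y), (z, w), (y, x), (w, z)] | x y z w. {x, y, z, w} \<subseteq> X \<and> card {x, y, z, w} = 4}"
    by (rule Collect_image_cong4) (use 2 in blast)
  moreover have "{?T x y \<otimes>\<^bsub>perm_BF X\<^esub> ?T x z \<otimes>\<^bsub>perm_BF X\<^esub> inv\<^bsub>perm_BF X\<^esub> (?T x y) \<otimes>\<^bsub>perm_BF X\<^esub> inv\<^bsub>perm_BF X\<^esub> (?T y z)
      | x y z. {x, y, z} \<subseteq> X \<and> card {x, y, z} = 3} =
      {?P [(x, y), (x, z), (y, x), (z, y)] | x y z. {x, y, z} \<subseteq> X \<and> card {x, y, z} = 3}"
    by (rule Collect_image_cong3) (use 3 in blast)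
  moreover have "?P ` relator_lists X = {?P [(x, y), (x, y)] | x y. x \<in> X \<and> y \<in> X \<and> x \<noteq> y}
      \<union> {?P [(x, y), (z, w), (y, x), (w, z)] | x y z w. {x, y, z, w} \<subseteq> X \<and> card {x, y, z, w} = 4}
      \<union> {?P [(x, y), (x, z), (y, x), (z, y)] | x y z. {x, y, z} \<subseteq> X \<and> card {x, y, z} = 3}"
    unfolding relator_lists_def by blast
  ultimately show ?thesis
    unfolding perm_relators_def Let_def by (simp only:)
qed

lemma perm_relators_kernel: "perm_relators X \<subseteq> kernel (perm_BF X) (BijGroup X) (perm_rep X)"
proof
  fix r assume "r \<in> perm_relators X"
  then obtain ls where ls: "ls \<in> relator_lists X" "r = perm_prod X ls"
    by (auto simp: perm_relators_eq)
  note lX = relator_lists_letters[OF ls(1)]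
  have "class_act X r x = x" if "x \<in> X" for x
    using class_act_letter_prod[OF lX that] relator_lists_act[OF ls(1)] ls(2) by simp
  then show "r \<in> kernel (perm_BF X) (BijGroup X) (perm_rep X)"
    unfolding kernel_perm_rep using letter_prod_perm_closed[OF lX] ls(2) by blast
qed

lemma closedin_kernel_perm_rep: "closedin (perm_topology X) (kernel (perm_BF X) (BijGroup X) (perm_rep X))"
  unfolding closedin_def
proof (intro conjI)
  interpret subgroup_basis "perm_BF X" "basic_nbhds X"
    by (rule perm_subgroup_basis)
  let ?K = "kernel (perm_BF X) (BijGroup X) (perm_rep X)"
  have top: "topspace (perm_topology X) = carrier (perm_BF X)"
    by (simp add: perm_topology_def topspace_eq)
  show "?K \<subseteq> topspace (perm_topology X)" by (auto simp: top kernel_def)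
  show "openin (perm_topology X) (topspace (perm_topology X) - ?K)"
    unfolding top unfolding perm_topology_def openin_iff
  proof (intro conjI ballI)
    fix g assume "g \<in> carrier (perm_BF X) - ?K"
    then obtain x where g: "g \<in> carrier (perm_BF X)" and x: "x \<in> X" "class_act X g x \<noteq> x"
      by (auto simp: kernel_perm_rep)
    \<comment> \<open>Multiplying on the right by an element that fixes the image of
      \<open>x\<close> leaves this image unchanged, so every element of the coset still moves
      \<open>x\<close>.\<close>
    let ?C = "{class_act X g x}"
    have C: "?C \<subseteq> X" "finite ?C" using class_act_in[OF g x(1)] by auto
    have "g <#\<^bsub>perm_BF X\<^esub> basic_nbhd X ?C \<subseteq> carrier (perm_BF X) - ?K"
    proof
      fix h assume "h \<in> g <#\<^bsub>perm_BF X\<^esub> basic_nbhd X ?C"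
      then obtain u where u: "u \<in> basic_nbhd X ?C" "h = g \<otimes>\<^bsub>perm_BF X\<^esub> u" by (auto simp: l_coset_def)
      have uG: "u \<in> carrier (perm_BF X)" using subgroup.mem_carrier[OF subgroup_basic_nbhd[OF C(1)] u(1)] .
      have "class_act X u (class_act X g x) = class_act X g x"
        using u(1) by (simp add: basic_nbhd_def stab_nbhd_eq[OF C(1)])
      then have "class_act X h x \<noteq> x" using class_act_mult[OF g uG x(1)] u(2) x(2) by simp
      moreover have "h \<in> carrier (perm_BF X)" using g uG u(2) by simp
      ultimately show "h \<in> carrier (perm_BF X) - ?K" unfolding kernel_perm_rep using x(1) by blast
    qed
    then show "\<exists>U\<in>basic_nbhds X. g <#\<^bsub>perm_BF X\<^esub> U \<subseteq> carrier (perm_BF X) - ?K"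
      using C by blast
  qed auto
qed

text \<open>The commutation and three-point relators both have this shape in the quotient, with
  \<open>c\<close> and \<open>d\<close> involutions; the inverse of the last two factors is moved to
  the other side.\<close>

lemma (in group) relation_imp_eq:
  assumes c: "a \<in> carrier G" "b \<in> carrier G" "c \<in> carrier G" "d \<in> carrier G"
    and "a \<otimes> (b \<otimes> (c \<otimes> d)) = \<one>" "c \<otimes> c = \<one>" "d \<otimes> d = \<one>"
  shows "a \<otimes> b = d \<otimes> c"
proof -
  have "c \<otimes> d \<otimes> (d \<otimes> c) = c \<otimes> (d \<otimes> d) \<otimes> c" using c by (simp add: m_assoc)
  then have cd: "c \<otimes> d \<otimes> (d \<otimes> c) = \<one>" using assms by simp
  have "a \<otimes> b = a \<otimes> b \<otimes> (c \<otimes> d \<otimes> (d \<otimes> c))" using cd c by simp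
  also have "\<dots> = a \<otimes> (b \<otimes> (c \<otimes> d)) \<otimes> (d \<otimes> c)" using c by (simp add: m_assoc)
  finally show ?thesis using assms by simp
qed

lemma coset_letter_prod:
  assumes N: "N \<lhd> perm_BF X" and ls: "set ls \<subseteq> transp_letters X"
  shows "N #>\<^bsub>perm_BF X\<^esub> perm_prod X ls =
    letter_prod (perm_BF X Mod N) (\<lambda>l. N #>\<^bsub>perm_BF X\<^esub> perm_letter X l) ls"
proof -
  have "perm_letter X l \<in> carrier (perm_BF X)" if "l \<in> set ls" for l
    using ls that perm_letter_carrier by blast
  from hom_letter_prod[OF group_perm_BF normal.factorgroup_is_group[OF N] normal.r_coset_hom_Mod[OF N] this]
  show ?thesis by (simp add: comp_def)
qed

lemma transposition_system_Mod:
  assumes N: "N \<lhd> perm_BF X" and R: "perm_relators X \<subseteq> N"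
  shows "transposition_system (perm_BF X Mod N) X (\<lambda>l. N #>\<^bsub>perm_BF X\<^esub> perm_letter X l)"
proof -
  interpret N: normal N "perm_BF X" by (rule N)
  interpret Q: group "perm_BF X Mod N" by (rule N.factorgroup_is_group)
  note mult_FactGroup [simp del] one_FactGroup [simp del]
  let ?t = "\<lambda>l. N #>\<^bsub>perm_BF X\<^esub> perm_letter X l" and ?Q = "perm_BF X Mod N"
  have hom: "(\<lambda>a. N #>\<^bsub>perm_BF X\<^esub> a) \<in> hom (perm_BF X) ?Q" by (rule N.r_coset_hom_Mod)
  have cl: "?t l \<in> carrier ?Q" if "l \<in> transp_letters X" for l
    using hom_in_carrier[OF hom perm_letter_carrier[OF that]] .
  have rel: "letter_prod ?Q ?t ls = \<one>\<^bsub>?Q\<^esub>" if ls: "ls \<in> relator_lists X" for ls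
  proof -
    let ?a = "perm_prod X ls"
    have "?a \<in> N" using R ls perm_relators_eq by blast
    then have "N #>\<^bsub>perm_BF X\<^esub> ?a = N"
      using N.rcos_const by simp
    moreover have "N #>\<^bsub>perm_BF X\<^esub> ?a = letter_prod ?Q ?t ls"
      using coset_letter_prod[OF N relator_lists_letters[OF ls]] .
    ultimately show ?thesis by (simp add: FactGroup_def)
  qed
  have square: "?t l \<otimes>\<^bsub>?Q\<^esub> ?t l = \<one>\<^bsub>?Q\<^esub>" if l: "l \<in> transp_letters X" for l
  proof -
    obtain x y where "l = (x, y)" by fastforce
    then have "[l, l] \<in> relator_lists X" using l by (auto simp: relator_lists_def transp_letters_def)
    from rel[OF this] show ?thesis using cl[OF l] by simp
  qed
  \<comment> \<open>T_{y,x} is the inverse of T_{x,y} already in the big free group, and modulo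
    \<open>N\<close> the latter is its own inverse.\<close>
  have swap: "?t (y, x) = ?t (x, y)" if l: "(x, y) \<in> transp_letters X" for x y
  proof -
    have l': "(y, x) \<in> transp_letters X" using l by (auto simp: transp_letters_def)
    have "?t (y, x) \<otimes>\<^bsub>?Q\<^esub> ?t (x, y) = N #>\<^bsub>perm_BF X\<^esub> (perm_letter X (y, x) \<otimes>\<^bsub>perm_BF X\<^esub> perm_letter X (x, y))"
      using hom_mult[OF hom perm_letter_carrier[OF l'] perm_letter_carrier[OF l]] by simp
    also have "perm_letter X (y, x) \<otimes>\<^bsub>perm_BF X\<^esub> perm_letter X (x, y) = \<one>\<^bsub>perm_BF X\<^esub>"
      using inv_perm_letter[OF l] N.l_inv[OF perm_letter_carrier[OF l]] by simp
    also have "N #>\<^bsub>perm_BF X\<^esub> \<one>\<^bsub>perm_BF X\<^esub> = \<one>\<^bsub>?Q\<^esub>"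
      using hom_one[OF hom group_perm_BF Q.is_group] .
    finally show ?thesis
      using square[OF l] cl[OF l] cl[OF l'] by (metis Q.inv_equality)
  qed
  have mem: "(x, y) \<in> transp_letters X" if "x \<in> X" "y \<in> X" "x \<noteq> y" for x y
    using that by (simp add: transp_letters_def)
  show ?thesis
  proof (intro transposition_system.intro transposition_system_axioms.intro Q.is_group)
    fix x y z w assume D: "{x, y, z, w} \<subseteq> X" "card {x, y, z, w} = 4"
    have "[(x, y), (z, w), (y, x), (w, z)] \<in> relator_lists X" using D unfolding relator_lists_def by blast
    note rel = rel[OF this]
    have m: "(x, y) \<in> transp_letters X" "(z, w) \<in> transp_letters X" "(w, z) \<in> transp_letters X"
      using D(1) card_4_distinct[OF D(2)] by (auto intro: mem)
    have r: "?t (x, y) \<otimes>\<^bsub>?Q\<^esub> (?t (z, w) \<otimes>\<^bsub>?Q\<^esub> (?t (y, x) \<otimes>\<^bsub>?Q\<^esub> ?t (w, z))) = \<one>\<^bsub>?Q\<^esub>"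
      using rel unfolding letter_prod_simps Q.r_one[OF cl[OF m(3)]] .
    show "?t (x, y) \<otimes>\<^bsub>?Q\<^esub> ?t (z, w) = ?t (z, w) \<otimes>\<^bsub>?Q\<^esub> ?t (x, y)"
      by (rule Q.relation_imp_eq[OF cl[OF m(1)] cl[OF m(2)] cl[OF m(1)] cl[OF m(2)]
            r[unfolded swap[OF m(1)] swap[OF m(2)]] square[OF m(1)] square[OF m(2)]])
  next
    fix x y z assume D: "{x, y, z} \<subseteq> X" "card {x, y, z} = 3"
    have "[(x, y), (x, z), (y, x), (z, y)] \<in> relator_lists X" using D unfolding relator_lists_def by blast
    note rel = rel[OF this]
    have m: "(x, y) \<in> transp_letters X" "(x, z) \<in> transp_letters X" "(y, z) \<in> transp_letters X"
      "(z, y) \<in> transp_letters X"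
      using D(1) card_3_distinct[OF D(2)] by (auto intro: mem)
    have r: "?t (x, y) \<otimes>\<^bsub>?Q\<^esub> (?t (x, z) \<otimes>\<^bsub>?Q\<^esub> (?t (y, x) \<otimes>\<^bsub>?Q\<^esub> ?t (z, y))) = \<one>\<^bsub>?Q\<^esub>"
      using rel unfolding letter_prod_simps Q.r_one[OF cl[OF m(4)]] .
    show "?t (x, y) \<otimes>\<^bsub>?Q\<^esub> ?t (x, z) = ?t (y, z) \<otimes>\<^bsub>?Q\<^esub> ?t (x, y)"
      by (rule Q.relation_imp_eq[OF cl[OF m(1)] cl[OF m(2)] cl[OF m(1)] cl[OF m(3)]
            r[unfolded swap[OF m(1)] swap[OF m(3)]] square[OF m(1)] square[OF m(3)]])
  qed (use cl square swap in auto)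
qed

text \<open>Approximate an element of the kernel by a finite word, which fixes a given finite set \<open>C\<close>, and use
  the relations to write the latter as a product of an element of \<open>N\<close> and a word avoiding \<open>C\<close>.\<close>

lemma kernel_perm_rep_least:
  assumes N: "N \<lhd> perm_BF X" and closed: "closedin (perm_topology X) N" and R: "perm_relators X \<subseteq> N"
  shows "kernel (perm_BF X) (BijGroup X) (perm_rep X) \<subseteq> N"
proof
  interpret subgroup_basis "perm_BF X" "basic_nbhds X"
    by (rule perm_subgroup_basis)
  interpret N: normal N "perm_BF X" by (rule N)
  let ?t = "\<lambda>l. N #>\<^bsub>perm_BF X\<^esub> perm_letter X l" and ?Q = "perm_BF X Mod N"
  let ?P = "perm_prod X"
  interpret Q: transposition_system ?Q X ?t by (rule transposition_system_Mod[OF N R])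
  fix a assume "a \<in> kernel (perm_BF X) (BijGroup X) (perm_rep X)"
  then have a: "a \<in> carrier (perm_BF X)" "\<And>x. x \<in> X \<Longrightarrow> class_act X a x = x"
    by (auto simp: kernel_perm_rep)
  have "a \<in> perm_topology X closure_of N"
    unfolding perm_topology_def
  proof (rule in_closureI[OF a(1)])
    fix U assume "U \<in> basic_nbhds X"
    then obtain C where C: "U = basic_nbhd X C" "C \<subseteq> X" "finite C" by blast
    interpret U: subgroup U "perm_BF X" unfolding C(1) by (rule subgroup_basic_nbhd[OF C(2)])
    obtain D ls where D: "C \<subseteq> D" "D \<subseteq> X" "set ls \<subseteq> transp_letters D"
      "inv\<^bsub>perm_BF X\<^esub> a \<otimes>\<^bsub>perm_BF X\<^esub> ?P ls \<in> U" "\<forall>x\<in>C. fold letter_act ls x = class_act X a x"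
      using finite_approximation[OF a(1) C(3,2)] C(1) by blast
    obtain w where w: "set w \<subseteq> transp_letters (D - C)" "Q.same ls w"
      using Q.avoid_fixed_points[OF C(3) D(2,1,3)] D(5) a(2) C(2) by auto
    have lX: "set ls \<subseteq> transp_letters X" "set w \<subseteq> transp_letters X"
      using D(2,3) w(1) by (auto simp: transp_letters_def)
    have cl: "?P ls \<in> carrier (perm_BF X)" "?P w \<in> carrier (perm_BF X)"
      using lX by (auto intro: letter_prod_perm_closed)
    have "N #>\<^bsub>perm_BF X\<^esub> ?P ls = N #>\<^bsub>perm_BF X\<^esub> ?P w"
      using w(2) lX by (simp add: Q.same_def coset_letter_prod[OF N])
    then have "?P ls \<in> N #>\<^bsub>perm_BF X\<^esub> ?P w"
      using rcos_self[OF cl(1) N.subgroup_axioms] by simp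
    then obtain n where n: "n \<in> N" "?P ls = n \<otimes>\<^bsub>perm_BF X\<^esub> ?P w" by (auto simp: r_coset_def)
    have nN: "?P ls \<otimes>\<^bsub>perm_BF X\<^esub> inv\<^bsub>perm_BF X\<^esub> (?P w) = n"
      using n cl N.mem_carrier[OF n(1)] by (simp add: m_assoc)
    \<comment> \<open>Both ends of the letter lie outside \<open>C\<close>: it fixes
      \<open>C\<close> pointwise, and its restriction to \<Lambda>(C) is the empty word.\<close>
    have "perm_letter X l \<in> U" if l: "l \<in> transp_letters (D - C)" for l
    proof -
      have lX: "l \<in> transp_letters X" using l D(2) by (auto simp: transp_letters_def)
      have "class_act X (perm_letter X l) x = x" if "x \<in> C" for x
      proof -
        have "x \<notin> {fst l, snd l}" "x \<in> X" using that l C(2) by (auto simp: transp_letters_def)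
        then show ?thesis using class_act_letter[OF lX, of x] letter_act_other[of x l] by simp
      qed
      moreover have "BF_proj (transp_letters C) prod.swap (perm_letter X l) =
          \<one>\<^bsub>BF (transp_letters C) prod.swap\<^esub>"
      proof -
        have e: "pos (letter_restrict (word_single l) (transp_letters C)) = {}"
          using l by (auto simp: word_single_def transp_letters_def)
        have "word_class (transp_letters C) prod.swap
            (letter_restrict (word_single l) (transp_letters C)) =
          word_class (transp_letters C) prod.swap word_empty"
          by (rule word_class_iso[OF word_restrict_words[OF word_single_words[OF lX] transp_letters_mono[OF C(2)]]
                word_empty_words empty_iso[OF e]]) (auto simp: word_empty_def)
        then show ?thesis
          using BF_proj_class[OF word_single_words[OF lX] transp_letters_mono[OF C(2)], of prod.swap]
          by (simp add: one_BF swap_transp_letters)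
      qed
      ultimately show ?thesis
        unfolding C(1) basic_nbhd_def kernel_def stab_nbhd_eq[OF C(2)]
        using perm_letter_carrier[OF lX] by blast
    qed
    then have "?P w \<in> U" using w(1)
      by (induction w) (auto intro: U.one_closed U.m_closed)
    \<comment> \<open>This element of \<open>U\<close> carries \<open>a\<close> to the product of
      \<open>?P ls\<close> with the inverse of \<open>?P w\<close>, which is the element
      \<open>n\<close> of \<open>N\<close>.\<close>
    then have u: "inv\<^bsub>perm_BF X\<^esub> a \<otimes>\<^bsub>perm_BF X\<^esub> ?P ls \<otimes>\<^bsub>perm_BF X\<^esub> inv\<^bsub>perm_BF X\<^esub> (?P w) \<in> U"
      using D(4) U.m_closed U.m_inv_closed by blast
    have "a \<otimes>\<^bsub>perm_BF X\<^esub> (inv\<^bsub>perm_BF X\<^esub> a \<otimes>\<^bsub>perm_BF X\<^esub> ?P ls \<otimes>\<^bsub>perm_BF X\<^esub> inv\<^bsub>perm_BF X\<^esub> (?P w)) = n"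
      using a(1) cl nN N.mem_carrier[OF n(1)] by (simp add: m_assoc cancel_left)
    then show "\<exists>u\<in>U. a \<otimes>\<^bsub>perm_BF X\<^esub> u \<in> N" using u n(1) by metis
  qed
  then show "a \<in> N" using closure_of_closedin[OF closed] by simp
qed

section \<open>Surjectivity\<close>

text \<open>The sequence from \<open>x\<close> takes its single step at \<open>s\<close> and stops,
  as the new point does not occur later. This evaluates words of pairwise disjoint
  transpositions.\<close>

lemma word_lim_single_occurrence:
  assumes f: "linear_word f" and fin: "\<And>z. finite (occurrences z f)"
    and occ: "occurrences x f = {s}" "occurrences (other_end (letter f s) x) f = {s}"
  shows "word_lim f x (other_end (letter f s) x)"
proof (rule word_lim_track_end[OF f fin])
  have "(s, s) \<in> ord_rel f"
    using f occ(1) by (auto simp: order_on_defs refl_on_def occurrences_def)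
  then have ex: "is_least (ord_rel f) {t \<in> occurrences x f. follows (ord_rel f) None t} s"
    by (simp add: is_least_def occ(1) follows_def)
  have "(THE t. is_least (ord_rel f) {t \<in> occurrences x f. follows (ord_rel f) None t} t) = s"
    using ex by (rule the_equality) (simp add: is_least_def occ(1))
  moreover have "\<exists>t. is_least (ord_rel f) {t \<in> occurrences x f. follows (ord_rel f) None t} t"
    using ex by blast
  ultimately show tr: "track (ord_rel f) f x 1 = Some (other_end (letter f s) x, Some s)"
    unfolding One_nat_def using track_Suc[OF track.simps(1)[of "ord_rel f" f x]] by (simp add: Let_def del: track.simps)
  have "{t \<in> occurrences (other_end (letter f s) x) f. follows (ord_rel f) (Some s) t} = {}"
    by (simp add: occ(2) follows_def)
  then have none: "\<nexists>t. is_least (ord_rel f) {t \<in> occurrences (other_end (letter f s) x) f.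
      follows (ord_rel f) (Some s) t} t"
    by (simp only: is_least_def empty_iff simp_thms)
  show "track (ord_rel f) f x (Suc 1) = None"
    unfolding track_Suc[OF tr] if_not_P[OF none] ..
qed

text \<open>An involution \<open>\<iota>\<close> is represented by the word with one letter for each pair \<open>{x, \<iota> x}\<close> with
  \<open>x \<noteq> \<iota> x\<close>, in an arbitrary order.\<close>

lemma involution_word:
  assumes inv: "\<And>x. x \<in> X \<Longrightarrow> \<iota> x \<in> X \<and> \<iota> (\<iota> x) = x"
  shows "\<exists>f \<in> perm_words X. \<forall>x\<in>X. word_lim f x (\<iota> x)"
proof -
  obtain r :: "'a rel" where r: "well_order_on UNIV r" using Zorn.well_order_on ..
  have lin: "refl_on UNIV r" "trans r" "antisym r" "total_on UNIV r"
    using r by (auto simp: order_on_defs)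
  \<comment> \<open>The well-order has two uses: it selects the smaller point of each two-element
    orbit, so that every pair contributes one letter, and it orders the positions.\<close>
  define D where "D = {x \<in> X. \<iota> x \<noteq> x \<and> (x, \<iota> x) \<in> r}"
  define p where "p x = ((x, \<iota> x), 0::nat)" for x
  define f :: "('a \<times> 'a) bword" where
    "f = \<lparr>pos = p ` D, ord_rel = {(p x, p y) | x y. x \<in> D \<and> y \<in> D \<and> (x, y) \<in> r}, letter = fst\<rparr>"
  have p_eq [simp]: "p x = p y \<longleftrightarrow> x = y" for x y by (auto simp: p_def)
  have sel: "pos f = p ` D" "letter f = fst" by (simp_all add: f_def)
  have ord: "ord_rel f = {(p x, p y) | x y. x \<in> D \<and> y \<in> D \<and> (x, y) \<in> r}" by (simp add: f_def)
  have mem_ord: "(p x, p y) \<in> ord_rel f \<longleftrightarrow> x \<in> D \<and> y \<in> D \<and> (x, y) \<in> r" for x y by (auto simp: ord)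
  have linf: "linear_word f"
    unfolding order_on_defs
  proof (intro conjI)
    show "ord_rel f \<subseteq> pos f \<times> pos f" by (auto simp: ord sel)
    show "refl_on (pos f) (ord_rel f)" using lin(1) by (auto simp: refl_on_def sel mem_ord)
    show "trans (ord_rel f)"
    proof (rule transI)
      fix a b c assume "(a, b) \<in> ord_rel f" "(b, c) \<in> ord_rel f"
      then obtain x y z where "a = p x" "b = p y" "c = p z" "x \<in> D" "y \<in> D" "z \<in> D" "(x, y) \<in> r" "(y, z) \<in> r"
        by (auto simp: ord)
      then show "(a, c) \<in> ord_rel f" using transD[OF lin(2)] mem_ord by blast
    qed
    show "antisym (ord_rel f)"
    proof (rule antisymI)
      fix a b assume "(a, b) \<in> ord_rel f" "(b, a) \<in> ord_rel f"
      then obtain x y where "a = p x" "b = p y" "(x, y) \<in> r" "(y, x) \<in> r"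
        by (auto simp: ord)
      then show "a = b" using antisymD[OF lin(3)] by blast
    qed
    show "total_on (pos f) (ord_rel f)"
      unfolding total_on_def sel
    proof (intro ballI impI)
      fix a b assume "a \<in> p ` D" "b \<in> p ` D" "a \<noteq> b"
      then obtain x y where "a = p x" "b = p y" "x \<in> D" "y \<in> D" "x \<noteq> y" by blast
      then show "(a, b) \<in> ord_rel f \<or> (b, a) \<in> ord_rel f"
        using lin(4) mem_ord unfolding total_on_def by blast
    qed
  qed
  have occ: "occurrences z f = p ` {x \<in> D. z = x \<or> z = \<iota> x}" for z
    by (auto simp: occurrences_def sel p_def)
  have sing: "\<exists>s. occurrences x f = {s} \<and> occurrences (\<iota> x) f = {s} \<and> other_end (letter f s) x = \<iota> x"
    if x: "x \<in> X" "\<iota> x \<noteq> x" for x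
  proof -
    have x': "\<iota> x \<in> X" "\<iota> (\<iota> x) = x" using inv[OF x(1)] by auto
    have swap: "x = \<iota> y \<longleftrightarrow> y = \<iota> x" "\<iota> x = \<iota> y \<longleftrightarrow> y = x" if "y \<in> D" for y
    proof -
      have "\<iota> (\<iota> y) = y" using inv[of y] that by (simp add: D_def)
      then show "x = \<iota> y \<longleftrightarrow> y = \<iota> x" "\<iota> x = \<iota> y \<longleftrightarrow> y = x" using x'(2) by metis+
    qed
    have "{y \<in> D. x = y \<or> x = \<iota> y} = D \<inter> {x, \<iota> x}"
      "{y \<in> D. \<iota> x = y \<or> \<iota> x = \<iota> y} = D \<inter> {x, \<iota> x}"
      using swap by blast+
    then have o: "occurrences x f = p ` (D \<inter> {x, \<iota> x})" "occurrences (\<iota> x) f = p ` (D \<inter> {x, \<iota> x})"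
      by (simp_all add: occ)
    show ?thesis
    proof (cases "(x, \<iota> x) \<in> r")
      case True
      then have "(\<iota> x, x) \<notin> r" using antisymD[OF lin(3), of x "\<iota> x"] x(2) by auto
      then have "D \<inter> {x, \<iota> x} = {x}" using True x x' by (auto simp: D_def)
      then have "occurrences x f = {p x}" "occurrences (\<iota> x) f = {p x}" "other_end (letter f (p x)) x = \<iota> x"
        using o by (simp_all add: sel p_def other_end_def)
      then show ?thesis by blast
    next
      case False
      then have "(\<iota> x, x) \<in> r" using lin(4) x(2) by (metis UNIV_I total_on_def)
      then have "D \<inter> {x, \<iota> x} = {\<iota> x}" using False x x' by (auto simp: D_def)
      then have "occurrences x f = {p (\<iota> x)}" "occurrences (\<iota> x) f = {p (\<iota> x)}"
        "other_end (letter f (p (\<iota> x))) x = \<iota> x"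
        using o x(2) x' by (simp_all add: sel p_def other_end_def)
      then show ?thesis by blast
    qed
  qed
  have fix_occ: "occurrences x f = {}" if "x \<in> X" "\<iota> x = x" for x
  proof -
    have "\<not> (x = y \<or> x = \<iota> y)" if "y \<in> D" for y
    proof -
      have "\<iota> (\<iota> y) = y" "\<iota> y \<noteq> y" using inv[of y] that by (simp_all add: D_def)
      then show ?thesis using \<open>\<iota> x = x\<close> by metis
    qed
    then show ?thesis by (auto simp: occ)
  qed
  have w: "f \<in> words (transp_letters X)"
  proof -
    have "finite {s \<in> pos f. letter f s = l}" for l
      by (rule finite_subset[of _ "{(l, 0)}"]) (auto simp: sel p_def)
    moreover have "letter f ` pos f \<subseteq> transp_letters X"
      using inv by (auto simp: sel p_def D_def transp_letters_def)
    ultimately show ?thesis using linf by (simp add: words_def)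
  qed
  have "finite (occurrences x f)" if "x \<in> X" for x
    using sing[OF that] fix_occ[OF that] by (cases "\<iota> x = x") auto
  then have S0: "f \<in> S0 X" using w by (simp add: S0_def)
  have lim: "word_lim f x (\<iota> x)" if x: "x \<in> X" for x
  proof (cases "\<iota> x = x")
    case True
    then show ?thesis using word_lim_fixed[OF linf fix_occ[OF x True]] by simp
  next
    case False
    then obtain s where s: "occurrences x f = {s}" "occurrences (\<iota> x) f = {s}" "other_end (letter f s) x = \<iota> x"
      using sing[OF x] by blast
    then show ?thesis
      using word_lim_single_occurrence[OF linf S0_finite_occurrences[OF S0] s(1)] by simp
  qed
  have lim': "\<exists>y. word_lim (word_inverse prod.swap f) x y" if x: "x \<in> X" for x
  proof (cases "\<iota> x = x")
    case True
    have "word_lim (word_inverse prod.swap f) x x"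
      by (rule word_lim_fixed[OF inverse_linear[OF linf]]) (simp add: fix_occ[OF x True])
    then show ?thesis ..
  next
    case False
    then obtain s where s: "occurrences x f = {s}" "occurrences (\<iota> x) f = {s}" "other_end (letter f s) x = \<iota> x"
      using sing[OF x] by blast
    have "s \<in> pos f" "x \<in> {fst (letter f s), snd (letter f s)}"
      using s(1) by (auto simp: occurrences_def)
    \<comment> \<open>The ends of a letter differ, so exchanging them does not affect which end is
      opposite to \<open>x\<close>.\<close>
    then have "other_end (prod.swap (letter f s)) x = \<iota> x"
      using s(3) words_letter_ne[OF w, of s] by (auto simp: other_end_def split: if_splits)
    then have "word_lim (word_inverse prod.swap f) x (other_end (letter (word_inverse prod.swap f) s) x)"
      using S0_finite_occurrences[OF S0] s
      by (intro word_lim_single_occurrence inverse_linear[OF linf]) simp_all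
    then show ?thesis by blast
  qed
  have "\<exists>y. word_lim f x y" if "x \<in> X" for x using lim[OF that] ..
  then have "f \<in> perm_words X" unfolding perm_words_iff by (intro conjI ballI S0 lim')
  then show ?thesis using lim by (intro bexI[of _ f] ballI)
qed

lemma involution_in_image:
  assumes \<iota>: "\<iota> \<in> Bij X" and inv: "\<And>x. x \<in> X \<Longrightarrow> \<iota> (\<iota> x) = x"
  shows "\<iota> \<in> perm_rep X ` carrier (perm_BF X)"
proof -
  interpret group "perm_BF X" by (rule group_perm_BF)
  have inX: "\<iota> x \<in> X" if "x \<in> X" for x using Bij_imp_funcset[OF \<iota>] that by auto
  obtain f where f: "f \<in> perm_words X" "\<forall>x\<in>X. word_lim f x (\<iota> x)"
    using involution_word[of X \<iota>] inv inX by blast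
  let ?a = "perm_class X f"
  have a: "?a \<in> carrier (perm_BF X)" using f(1) by (simp add: carrier_perm_BF)
  have "class_act X ?a x = \<iota> x" if "x \<in> X" for x
    using f that x_infinity_eq[OF f(1) that] by (simp add: class_act_class)
  \<comment> \<open>The two inversions cancel: on the inverse class \<open>perm_rep\<close> is given
    by the action of \<open>?a\<close> itself.\<close>
  then have "perm_rep X (inv\<^bsub>perm_BF X\<^esub> ?a) = restrict \<iota> X"
    using a by (auto simp: perm_rep_def restrict_def)
  also have "\<dots> = \<iota>" using Bij_imp_extensional[OF \<iota>] by (rule extensional_restrict)
  finally show ?thesis using a by (metis imageI inv_closed)
qed

text \<open>On each orbit, write points as \<open>\<sigma>\<^sup>k r\<close> with a chosen base point \<open>r\<close>; the reflection
  \<open>\<sigma>\<^sup>k r \<mapsto> \<sigma>\<^sup>-\<^sup>k r\<close> is an involution inverting \<open>\<sigma>\<close>.\<close>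

lemma Bij_reflection:
  assumes \<sigma>: "\<sigma> \<in> Bij X"
  shows "\<exists>\<iota>\<in>Bij X. (\<forall>x\<in>X. \<iota> (\<iota> x) = x) \<and> (\<forall>x\<in>X. \<sigma> (\<iota> (\<sigma> (\<iota> x))) = x)"
proof -
  let ?G = "BijGroup X"
  interpret group ?G by (rule group_BijGroup)
  have \<sigma>G: "\<sigma> \<in> carrier ?G" using \<sigma> by (simp add: BijGroup_def)
  define pw where "pw k = \<sigma> [^]\<^bsub>?G\<^esub> (k::int)" for k
  have pwB: "pw k \<in> Bij X" for k
    using int_pow_closed[OF \<sigma>G] by (simp add: pw_def BijGroup_def)
  have pwX: "pw k x \<in> X" if "x \<in> X" for k x using Bij_imp_funcset[OF pwB] that by auto
  have pw_add: "pw (j + k) x = pw j (pw k x)" if "x \<in> X" for j k x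
  proof -
    have "pw (j + k) = pw j \<otimes>\<^bsub>?G\<^esub> pw k" by (simp add: pw_def int_pow_mult[OF \<sigma>G])
    then show ?thesis using pwB that by (simp add: BijGroup_def compose_def)
  qed
  have pw_0: "pw 0 x = x" if "x \<in> X" for x using that by (simp add: pw_def BijGroup_def)
  have pw_1: "pw 1 = \<sigma>" by (simp add: pw_def int_pow_1[OF \<sigma>G])
  \<comment> \<open>The choice depends only on the set of points available, which is the orbit, so
    all points of an orbit receive the same base point.\<close>
  define r where "r x = (SOME y. \<exists>k. y = pw k x)" for x
  have r: "\<exists>k. r x = pw k x" for x unfolding r_def by (rule someI_ex) blast
  have r_pw: "r (pw j x) = r x" if x: "x \<in> X" for j x
  proof -
    have "(\<exists>k. y = pw k (pw j x)) \<longleftrightarrow> (\<exists>k. y = pw k x)" for y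
    proof
      assume "\<exists>k. y = pw k (pw j x)"
      then show "\<exists>k. y = pw k x" using pw_add[OF x] by metis
    next
      assume "\<exists>k. y = pw k x"
      then obtain k where "y = pw k x" ..
      also have "\<dots> = pw (k - j) (pw j x)" using pw_add[OF x, of "k - j" j] by simp
      finally show "\<exists>k. y = pw k (pw j x)" ..
    qed
    then show ?thesis unfolding r_def by simp
  qed
  have rX: "r x \<in> X" if "x \<in> X" for x using r[of x] pwX[OF that] by auto
  have base: "\<exists>k. x = pw k (r x)" if x: "x \<in> X" for x
  proof -
    obtain k where "r x = pw k x" using r by blast
    then have "pw (- k) (r x) = x" using pw_add[OF x, of "- k" k] pw_0[OF x] by simp
    then show ?thesis by metis
  qed
  define e where "e x = (SOME k. x = pw k (r x))" for x
  have e: "x = pw (e x) (r x)" if "x \<in> X" for x unfolding e_def using base[OF that] by (rule someI_ex)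
  define \<iota> where "\<iota> = (\<lambda>x\<in>X. pw (- e x) (r x))"
  have \<iota>_pw: "\<iota> (pw k (r x)) = pw (- k) (r x)" if x: "x \<in> X" for k x
  proof -
    let ?y = "pw k (r x)"
    have rx: "r x \<in> X" by (rule rX[OF x])
    have y: "?y \<in> X" by (rule pwX[OF rx])
    have "r (r x) = r x" using r[of x] r_pw[OF x] by metis
    then have ry: "r ?y = r x" using r_pw[OF rx] by simp
    have ey: "pw (e ?y) (r x) = pw k (r x)" using e[OF y] ry by simp
    \<comment> \<open>On a finite orbit the exponent of a point is not unique. Two exponents of the
      same point differ by a period of the orbit, so their negatives again define the same
      point.\<close>
    have "pw (- e ?y) (r x) = pw (- e ?y - k) (pw k (r x))" using pw_add[OF rx, of "- e ?y - k" k] by simp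
    also have "\<dots> = pw (- e ?y - k) (pw (e ?y) (r x))" using ey by simp
    also have "\<dots> = pw (- k) (r x)" using pw_add[OF rx, of "- e ?y - k" "e ?y"] by simp
    finally show ?thesis using y ry by (simp add: \<iota>_def)
  qed
  have \<iota>X: "\<iota> x \<in> X" if "x \<in> X" for x using that pwX[OF rX[OF that]] by (simp add: \<iota>_def)
  have inv: "\<iota> (\<iota> x) = x" if x: "x \<in> X" for x
  proof -
    have "\<iota> x = pw (- e x) (r x)" using x by (simp add: \<iota>_def)
    then have "\<iota> (\<iota> x) = pw (- (- e x)) (r x)" using \<iota>_pw[OF x] by simp
    then show ?thesis using e[OF x] by simp
  qed
  have inv': "\<sigma> (\<iota> (\<sigma> (\<iota> x))) = x" if x: "x \<in> X" for x
  proof -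
    \<comment> \<open>The composite of \<open>\<sigma>\<close> with the reflection sends exponent k
      to 1 - k, hence is again an involution.\<close>
    have step: "\<sigma> (\<iota> (pw k (r x))) = pw (1 - k) (r x)" for k
      using \<iota>_pw[OF x] pw_add[OF rX[OF x], of 1 "- k"] pw_1 by simp
    have "\<sigma> (\<iota> x) = pw (1 - e x) (r x)" using step[of "e x"] e[OF x] by simp
    then have "\<sigma> (\<iota> (\<sigma> (\<iota> x))) = pw (1 - (1 - e x)) (r x)" using step by simp
    then show ?thesis using e[OF x] by simp
  qed
  have "bij_betw \<iota> X X" by (rule bij_betw_byWitness[where f' = \<iota>]) (use inv \<iota>X in auto)
  then have "\<iota> \<in> Bij X" by (simp add: Bij_def \<iota>_def)
  then show ?thesis using inv inv' by blast
qed

lemma perm_rep_epi: "perm_rep X \<in> epi (perm_BF X) (BijGroup X)"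
proof -
  interpret group "perm_BF X" by (rule group_perm_BF)
  have "\<sigma> \<in> perm_rep X ` carrier (perm_BF X)" if \<sigma>: "\<sigma> \<in> Bij X" for \<sigma>
  proof -
    obtain \<iota> where \<iota>: "\<iota> \<in> Bij X" "\<forall>x\<in>X. \<iota> (\<iota> x) = x" "\<forall>x\<in>X. \<sigma> (\<iota> (\<sigma> (\<iota> x))) = x"
      using Bij_reflection[OF \<sigma>] by blast
    have inX: "\<iota> x \<in> X" "\<sigma> x \<in> X" if "x \<in> X" for x
      using Bij_imp_funcset[OF \<iota>(1)] Bij_imp_funcset[OF \<sigma>] that by auto
    \<comment> \<open>\<open>\<sigma>\<close> is recovered as the product of the two involutions
      \<open>compose X \<sigma> \<iota>\<close> and \<open>\<iota>\<close>.\<close>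
    have "compose X \<sigma> \<iota> \<in> perm_rep X ` carrier (perm_BF X)"
      by (rule involution_in_image[OF compose_Bij[OF \<sigma> \<iota>(1)]]) (use \<iota>(3) inX in \<open>simp add: compose_def\<close>)
    then obtain a where a: "a \<in> carrier (perm_BF X)" "perm_rep X a = compose X \<sigma> \<iota>" by auto
    obtain b where b: "b \<in> carrier (perm_BF X)" "perm_rep X b = \<iota>"
      using involution_in_image[OF \<iota>(1)] \<iota>(2) by auto
    have "perm_rep X (a \<otimes>\<^bsub>perm_BF X\<^esub> b) = compose X (compose X \<sigma> \<iota>) \<iota>"
      using hom_mult[OF perm_rep_hom a(1) b(1)] a(2) b(2) compose_Bij[OF \<sigma> \<iota>(1)] \<iota>(1)
      by (simp add: BijGroup_def)
    also have "\<dots> = \<sigma>"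
      using \<iota>(2) inX Bij_imp_extensional[OF \<sigma>] by (auto simp: compose_def fun_eq_iff extensional_def)
    finally show ?thesis using a(1) b(1) by (metis imageI m_closed)
  qed
  then show ?thesis using perm_rep_hom by (auto simp: epi_iff_subset BijGroup_def)
qed

section \<open>Cardinality\<close>

lemma card_transp_letters:
  assumes "infinite X" shows "|transp_letters X| \<le>o |X|"
proof -
  have "|transp_letters X| \<le>o |X \<times> X|"
    by (rule card_of_mono1) (auto simp: transp_letters_def)
  then show ?thesis
    using card_of_Times_same_infinite[OF assms] ordLeq_ordIso_trans by blast
qed

lemma card_perm_relators:
  assumes X: "infinite X" shows "|perm_relators X| \<le>o |X|"
proof -
  have fin: "|X \<times> X \<times> X \<times> X| \<le>o |X|"
    using X by (intro card_of_Times_ordLeq_infinite_Field ordLeq_refl card_of_Card_order)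
      (simp_all add: Field_card_of ordLeq_refl[OF card_of_Card_order])
  \<comment> \<open>The number tags the three kinds of relators, so that one family indexed by
    {0,1,2} and four points contains them all; a relator with fewer points repeats one of
    them.\<close>
  let ?F = "\<lambda>(n :: nat, x, y, z, w). if n = 0 then [(x, y), (x, y)]
     else if n = 1 then [(x, y), (z, w), (y, x), (w, z)] else [(x, y), (x, z), (y, x), (z, y)]"
  have sub: "relator_lists X \<subseteq> ?F ` ({..2} \<times> X \<times> X \<times> X \<times> X)"
  proof
    fix ls assume "ls \<in> relator_lists X"
    then consider x y where "x \<in> X" "y \<in> X" "ls = ?F (0, x, y, x, x)"
      | x y z w where "{x, y, z, w} \<subseteq> X" "ls = ?F (1, x, y, z, w)"
      | x y z where "{x, y, z} \<subseteq> X" "ls = ?F (2, x, y, z, z)"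
      unfolding relator_lists_def by auto
    then show "ls \<in> ?F ` ({..2} \<times> X \<times> X \<times> X \<times> X)"
    proof cases
      case (1 x y)
      then show ?thesis by (intro image_eqI[where x = "(0, x, y, x, x)"]) auto
    next
      case (2 x y z w)
      then show ?thesis by (intro image_eqI[where x = "(1, x, y, z, w)"]) auto
    next
      case (3 x y z)
      then show ?thesis by (intro image_eqI[where x = "(2, x, y, z, z)"]) auto
    qed
  qed
  have "|perm_relators X| \<le>o |relator_lists X|"
    unfolding perm_relators_eq by (rule card_of_image)
  also have "|relator_lists X| \<le>o |?F ` ({..2} \<times> X \<times> X \<times> X \<times> X)|"
    by (rule card_of_mono1[OF sub])
  also have "|?F ` ({..2} \<times> X \<times> X \<times> X \<times> X)| \<le>o |{..2::nat} \<times> X \<times> X \<times> X \<times> X|"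
    by (rule card_of_image)
  also have "|{..2::nat} \<times> X \<times> X \<times> X \<times> X| \<le>o |X|"
  proof (rule card_of_Times_ordLeq_infinite_Field)
    show "|{..2::nat}| \<le>o |X|"
      by (rule ordLess_imp_ordLeq, rule finite_ordLess_infinite)
        (use X in \<open>simp_all add: Field_card_of card_of_well_order_on\<close>)
  qed (use X fin in \<open>simp_all add: Field_card_of card_of_card_order_on\<close>)
  finally show ?thesis .
qed

theorem theorem3p4p2:
  fixes X :: "'a set"
  shows "generalized_presentation (transp_letters X) prod.swap (perm_words X) (perm_topology X)
           (perm_relators X) (BijGroup X) \<and>
         (infinite X \<longrightarrow>
           (\<exists>(\<Lambda> :: ('a \<times> 'a) set) i S \<T> R.
              generalized_presentation \<Lambda> i S \<T> R (BijGroup X) \<and> presentation_of_type |X| \<Lambda> R))"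
proof -
  have "free_involution_on (transp_letters X) prod.swap"
    by (auto simp: free_involution_on_def transp_letters_def)
  moreover have "word_single ` transp_letters X \<subseteq> perm_words X"
    using word_single_perm_words by blast
  moreover have "perm_relators X \<subseteq> carrier (perm_BF X)"
    using perm_relators_kernel by (auto simp: kernel_def)
  moreover have "kernel (perm_BF X) (BijGroup X) (perm_rep X) \<lhd> perm_BF X"
    by (rule group_hom.normal_kernel)
      (simp add: group_hom_def group_hom_axioms_def group_perm_BF group_BijGroup perm_rep_hom)
  ultimately have pres: "generalized_presentation (transp_letters X) prod.swap (perm_words X)
      (perm_topology X) (perm_relators X) (BijGroup X)"
    unfolding generalized_presentation_def perm_BF_def[symmetric] Let_def
    by (intro conjI bexI[OF _ perm_rep_epi] ballI)
      (simp_all add: group_BijGroup admissible_perm_words admissible_perm_topology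
        closedin_kernel_perm_rep perm_relators_kernel kernel_perm_rep_least)
  moreover have "presentation_of_type |X| (transp_letters X) (perm_relators X)" if "infinite X"
    using card_transp_letters[OF that] card_perm_relators[OF that] by (simp add: presentation_of_type_def)
  ultimately show ?thesis by blast
qed

end
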